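(* Let $V$ be a finite nonempty set and $r=(r(i,j))_{i,j\in V}$ an irreducible family of transition rates with $r(i,i)=0$ for all $i$, and let $\lambda\in\mathbb{R}^V$ be given by $\lambda(j)=\sum_{i\in V}[r(i,j)-r(j,i)]$. For any $u\in\Sigma$, there is a unique solution $\zeta\in C([0,\infty),\Sigma)$ of the $(\lambda,\mathcal{D}_V)$-problem with $\zeta_0=u$, and it is $\zeta^{\lambda,u}=\zeta^u$, where $\zeta^{\lambda,u}$ is the path component of the unique solution of the oblique reflection problem with input $\xi^u_t=u+t\lambda$, and $\zeta^u$ is the piecewise linear path defined in the context.
   Context: $\Sigma=\{u\in[0,1]^V:\sum_{i\in V}u(i)=1\}$; $1_{\{i\}}\in\mathbb{R}^V$ is the indicator of $i$; $C([0,\infty),\Sigma)$ is the set of continuous $\Sigma$-valued paths. Trace rates: for $k\in V$ and nonempty $B\subseteq V$, let $T^k_B$ be the hitting time of $B$ by the continuous-time random walk on $V$ with jump rates $r$ started at $k$, and $T^k_j=T^k_{\{j\}}$. For nonempty $A\subseteq V$ and $i\ne j$ in $A$ put $r^A(i,j)=r(i,j)+\sum_{k\notin A}r(i,k)P(T^k_A=T^k_j)$, and $r^A(i,i)=0$. Put $\lambda^A(i)=\sum_{j\in A}[r^A(j,i)-r^A(i,j)]$ for $i\in A$. A set $A\subseteq V$ is $r$-absorbing if $A=V$ or $\lambda^{A\cup\{j\}}(j)\le0$ for all $j\in V\setminus A$. For $S\subseteq V$, $\mathcal{A}(S)$ is the intersection of all $r$-absorbing subsets of $V$ containing $S$. For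 $v\in\Sigma$, $\mathcal{S}(v)=\{i\in V:v(i)>0\}$, and $\Sigma_{abs}=\{v\in\Sigma:\mathcal{S}(v)\text{ is }r\text{-absorbing}\}$. The $(\lambda,\mathcal{D}_V)$-problem: let $C^1(\Sigma,\mathbb{R})$ be the set of real $C^1$ functions defined on some open set of $\mathbb{R}^V$ containing $\Sigma$. For $f\in C^1(\Sigma,\mathbb{R})$ and $w\in\mathbb{R}^V$, $w(f)(u)$ is the derivative of $f$ at $u\in\Sigma$ in direction $w$. Let $\boldsymbol{v}_i=\sum_{k\in V}r(i,k)(1_{\{k\}}-1_{\{i\}})$, $i\in V$. $\mathcal{D}_V$ is the set of $f\in C^1(\Sigma,\mathbb{R})$ such that for every $i\in V$, $\boldsymbol{v}_i(f)(u)=0$ for all $u\in\Sigma$ with $u(i)=0$. A path $\zeta\in C([0,\infty),\Sigma)$ solves the $(\lambda,\mathcal{D}_V)$-problem if (A) for every $f\in\mathcal{D}_V$, $f(\zeta_t)=f(\zeta_0)+\int_0^t\lambda(f)(\zeta_s)\,ds$ for all $t\ge0$; and (B) $\inf\{t\ge0:\zeta_t\in\Sigma_{abs}\}=0$. Oblique reflection problem (ORP): let $p(i,j)=r(i,j)/r(i)$ with $r(i)=\sum_{j\in V}r(i,j)$ (implicitly positive), and $\boldsymbol{w}_i=\sum_{j\in V}p(i,j)(1_{\{i\}}-1_{\{j\}})$. Given a right-continuous path $\xi:[0,\infty)\to\mathbb{R}^V$ with left limits, a pair $(\zeta,\rho)$ of such paths solves the ORP with input $\xi$ if (i) for each $i\in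 V$, $t\mapsto\rho_t(i)$ is nondecreasing and $\rho_t(i)=\int_0^t 1_{\{\zeta_s(i)=0\}}\,d\rho_s(i)$ for all $t\ge0$ (so $\rho_0(i)=0$); (ii) for all $t\ge0$, $\zeta_t=\xi_t+\sum_{i\in V}\rho_t(i)\boldsymbol{w}_i$ and $\zeta_t\in[0,\infty)^V$. It is known (Chen–Mandelbaum) that for each $u\in\Sigma$ there is a unique solution $(\zeta^{\lambda,u},\rho^{\lambda,u})$ of the ORP with input $\xi^u_t=u+t\lambda$, that $\zeta^{\lambda,u}\in C([0,\infty),\Sigma)$, and that $u\mapsto\zeta^{\lambda,u}$ is continuous for the topology of uniform convergence on compact time sets. The path $\zeta^u$: for $v\in\Sigma$ let $\mathcal{A}(v)=\mathcal{A}(\mathcal{S}(v))$, and let $\lambda^v\in\mathbb{R}^V$ be given by $\lambda^v(i)=\lambda^{\mathcal{A}(v)}(i)$ for $i\in\mathcal{A}(v)$ and $\lambda^v(i)=0$ otherwise. Let $\mathcal{S}_\downarrow(v)=\{i\in\mathcal{S}(v):\lambda^v(i)<0\}$; this set is nonempty whenever $\lambda^v\neq 0$. Given $u\in\Sigma$, set $(T_0,v_0)=(0,u)$. Given $(T_k,v_k)$: if $\lambda^{v_k}=0$, stop and set $f=k$; otherwise put $T^{v_k}=\min\{-v_k(i)/\lambda^{v_k}(i): i\in\mathcal{S}_\downarrow(v_k)\}\in(0,\infty)$, $v_{k+1}=v_k+T^{v_k}\lambda^{v_k}$, $T_{k+1}=T_k+T^{v_k}$. The procedure stops after finitely many steps.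 Then $\zeta^u_t=v_k+(t-T_k)\lambda^{v_k}$ for $T_k\le t<T_{k+1}$, $k<f$, and $\zeta^u_t=v_f$ for $t\ge T_f$. *)

theory Defs
  imports "HOL-Probability.Probability"
begin

text \<open>
  The finite nonempty set V is the universe of a type of class finite, and a family of rates is a
  function r :: 'v => 'v => real. Paths on the half line are total functions that are
  extensional on {0..} (equal to undefined at negative times), so that equality of functions is
  equality of paths.
\<close>

definition irreducible_rates :: "('v::finite \<Rightarrow> 'v \<Rightarrow> real) \<Rightarrow> bool" where
  "irreducible_rates r \<longleftrightarrow>
     (\<forall>i j. 0 \<le> r i j) \<and> (\<forall>i j. (i, j) \<in> {(a, b). 0 < r a b}\<^sup>*)"

definition prob_simplex :: "(real ^ 'v::finite) set" where
  "prob_simplex = {u. (\<forall>i. 0 \<le> u $ i \<and> u $ i \<le> 1) \<and> (\<Sum>i\<in>UNIV. u $ i) = 1}"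

definition drift :: "('v::finite \<Rightarrow> 'v \<Rightarrow> real) \<Rightarrow> real ^ 'v" where
  "drift r = (\<chi> j. \<Sum>i\<in>UNIV. r i j - r j i)"

definition exit_rate :: "('v::finite \<Rightarrow> 'v \<Rightarrow> real) \<Rightarrow> 'v \<Rightarrow> real" where
  "exit_rate r i = (\<Sum>j\<in>UNIV. r i j)"

definition jump_prob :: "('v::finite \<Rightarrow> 'v \<Rightarrow> real) \<Rightarrow> 'v \<Rightarrow> 'v \<Rightarrow> real" where
  "jump_prob r i j = r i j / exit_rate r i"


section \<open>The continuous-time random walk and its hitting times\<close>

text \<open>
  Jump chain and holding times. A sample point is a sequence of independent pairs: the first
  component of the n-th pair is a random map choosing, for each state i, the target of a jump
  from i with law jump_prob r i; the second is a standard exponential variable, which divided by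
  the exit rate of the current state gives the holding time there. A state with exit rate 0
  (possible for irreducible rates only if V is a singleton) is absorbing.
\<close>

definition jump_pmf :: "('v::finite \<Rightarrow> 'v \<Rightarrow> real) \<Rightarrow> 'v \<Rightarrow> 'v pmf" where
  "jump_pmf r i = (if exit_rate r i = 0 then return_pmf i else embed_pmf (jump_prob r i))"

definition walk_space :: "('v::finite \<Rightarrow> 'v \<Rightarrow> real) \<Rightarrow> (nat \<Rightarrow> ('v \<Rightarrow> 'v) \<times> real) measure" where
  "walk_space r =
     PiM UNIV (\<lambda>_. measure_pmf (Pi_pmf UNIV undefined (jump_pmf r))
                     \<Otimes>\<^sub>M density lborel (\<lambda>x. ennreal (exponential_density 1 x)))"

primrec jump_chain :: "'v::finite \<Rightarrow> (nat \<Rightarrow> ('v \<Rightarrow> 'v) \<times> real) \<Rightarrow> nat \<Rightarrow> 'v" where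
  "jump_chain k \<omega> 0 = k"
| "jump_chain k \<omega> (Suc n) = fst (\<omega> n) (jump_chain k \<omega> n)"

definition holding_time ::
  "('v::finite \<Rightarrow> 'v \<Rightarrow> real) \<Rightarrow> 'v \<Rightarrow> (nat \<Rightarrow> ('v \<Rightarrow> 'v) \<times> real) \<Rightarrow> nat \<Rightarrow> ereal" where
  "holding_time r k \<omega> n =
     (if exit_rate r (jump_chain k \<omega> n) = 0 then \<infinity>
      else ereal (snd (\<omega> n) / exit_rate r (jump_chain k \<omega> n)))"

definition jump_time ::
  "('v::finite \<Rightarrow> 'v \<Rightarrow> real) \<Rightarrow> 'v \<Rightarrow> (nat \<Rightarrow> ('v \<Rightarrow> 'v) \<times> real) \<Rightarrow> nat \<Rightarrow> ereal" where
  "jump_time r k \<omega> n = (\<Sum>m<n. holding_time r k \<omega> m)"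

text \<open>Almost surely the jump times are unbounded, so the least index below exists for all t.\<close>

definition walk ::
  "('v::finite \<Rightarrow> 'v \<Rightarrow> real) \<Rightarrow> 'v \<Rightarrow> real \<Rightarrow> (nat \<Rightarrow> ('v \<Rightarrow> 'v) \<times> real) \<Rightarrow> 'v" where
  "walk r k t \<omega> = jump_chain k \<omega> (LEAST n. ereal t < jump_time r k \<omega> (Suc n))"

definition hitting_time ::
  "('v::finite \<Rightarrow> 'v \<Rightarrow> real) \<Rightarrow> 'v \<Rightarrow> 'v set \<Rightarrow> (nat \<Rightarrow> ('v \<Rightarrow> 'v) \<times> real) \<Rightarrow> ereal" where
  "hitting_time r k B \<omega> = Inf (ereal ` {t. 0 \<le> t \<and> walk r k t \<omega> \<in> B})"


section \<open>Trace rates and absorbing sets\<close>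

definition trace_rate ::
  "('v::finite \<Rightarrow> 'v \<Rightarrow> real) \<Rightarrow> 'v set \<Rightarrow> 'v \<Rightarrow> 'v \<Rightarrow> real" where
  "trace_rate r A i j =
     (if i = j then 0
      else r i j + (\<Sum>k\<in>-A. r i k *
             measure (walk_space r)
               {\<omega> \<in> space (walk_space r). hitting_time r k A \<omega> = hitting_time r k {j} \<omega>}))"

definition trace_drift :: "('v::finite \<Rightarrow> 'v \<Rightarrow> real) \<Rightarrow> 'v set \<Rightarrow> 'v \<Rightarrow> real" where
  "trace_drift r A i = (\<Sum>j\<in>A. trace_rate r A j i - trace_rate r A i j)"

definition absorbing :: "('v::finite \<Rightarrow> 'v \<Rightarrow> real) \<Rightarrow> 'v set \<Rightarrow> bool" where
  "absorbing r A \<longleftrightarrow> A = UNIV \<or> (\<forall>j\<in>-A. trace_drift r (A \<union> {j}) j \<le> 0)"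

definition absorbing_hull :: "('v::finite \<Rightarrow> 'v \<Rightarrow> real) \<Rightarrow> 'v set \<Rightarrow> 'v set" where
  "absorbing_hull r S = \<Inter>{A. absorbing r A \<and> S \<subseteq> A}"

definition supp :: "real ^ 'v::finite \<Rightarrow> 'v set" where
  "supp v = {i. 0 < v $ i}"

definition absorbing_simplex :: "('v::finite \<Rightarrow> 'v \<Rightarrow> real) \<Rightarrow> (real ^ 'v) set" where
  "absorbing_simplex r = {v \<in> prob_simplex. absorbing r (supp v)}"


section \<open>The (lambda, D)-problem\<close>

definition C1_simplex :: "(real ^ 'v::finite \<Rightarrow> real) set" where
  "C1_simplex = {f. \<exists>U f'. open U \<and> prob_simplex \<subseteq> U \<and>
       (\<forall>x\<in>U. (f has_derivative blinfun_apply (f' x)) (at x)) \<and> continuous_on U f'}"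

definition dir_deriv :: "real ^ 'v::finite \<Rightarrow> (real ^ 'v \<Rightarrow> real) \<Rightarrow> real ^ 'v \<Rightarrow> real" where
  "dir_deriv w f u = frechet_derivative f (at u) w"

definition jump_vector :: "('v::finite \<Rightarrow> 'v \<Rightarrow> real) \<Rightarrow> 'v \<Rightarrow> real ^ 'v" where
  "jump_vector r i = (\<Sum>k\<in>UNIV. r i k *\<^sub>R (axis k 1 - axis i 1))"

definition test_functions :: "('v::finite \<Rightarrow> 'v \<Rightarrow> real) \<Rightarrow> (real ^ 'v \<Rightarrow> real) set" where
  "test_functions r = {f \<in> C1_simplex.
       \<forall>i. \<forall>u\<in>prob_simplex. u $ i = 0 \<longrightarrow> dir_deriv (jump_vector r i) f u = 0}"

definition simplex_paths :: "(real \<Rightarrow> real ^ 'v::finite) set" where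
  "simplex_paths = {\<zeta> \<in> {0..} \<rightarrow>\<^sub>E prob_simplex. continuous_on {0..} \<zeta>}"

text \<open>The infimum is taken in the extended reals, so that it is infinite for the empty set.\<close>

definition solves_problem ::
  "('v::finite \<Rightarrow> 'v \<Rightarrow> real) \<Rightarrow> (real \<Rightarrow> real ^ 'v) \<Rightarrow> bool" where
  "solves_problem r \<zeta> \<longleftrightarrow>
     \<zeta> \<in> simplex_paths \<and>
     (\<forall>f\<in>test_functions r. \<forall>t\<ge>0.
        f (\<zeta> t) = f (\<zeta> 0) + integral {0..t} (\<lambda>s. dir_deriv (drift r) f (\<zeta> s))) \<and>
     Inf (ereal ` {t. 0 \<le> t \<and> \<zeta> t \<in> absorbing_simplex r}) = 0"


section \<open>The oblique reflection problem\<close>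

definition cadlag_paths :: "(real \<Rightarrow> real ^ 'v::finite) set" where
  "cadlag_paths = {\<xi> \<in> extensional {0..}.
       (\<forall>t\<ge>0. (\<xi> \<longlongrightarrow> \<xi> t) (at_right t)) \<and> (\<forall>t>0. \<exists>l. (\<xi> \<longlongrightarrow> l) (at_left t))}"

definition reflection_vector :: "('v::finite \<Rightarrow> 'v \<Rightarrow> real) \<Rightarrow> 'v \<Rightarrow> real ^ 'v" where
  "reflection_vector r i = (\<Sum>j\<in>UNIV. jump_prob r i j *\<^sub>R (axis i 1 - axis j 1))"

text \<open>
  The Stieltjes integral from 0 to t is over the half-open interval from 0 (excluded) to t
  (included), which is what makes rho vanish at time 0; for the Stieltjes measure, rho is
  extended by its value at 0 to negative times.
\<close>

definition orp_solutions ::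
  "('v::finite \<Rightarrow> 'v \<Rightarrow> real) \<Rightarrow> (real \<Rightarrow> real ^ 'v) \<Rightarrow>
     ((real \<Rightarrow> real ^ 'v) \<times> (real \<Rightarrow> real ^ 'v)) set" where
  "orp_solutions r \<xi> = {(\<zeta>, \<rho>).
     \<zeta> \<in> cadlag_paths \<and> \<rho> \<in> cadlag_paths \<and>
     (\<forall>i. mono_on {0..} (\<lambda>t. \<rho> t $ i) \<and>
        (\<forall>t\<ge>0. \<rho> t $ i =
           (LINT s:{0<..t}|interval_measure (\<lambda>s. \<rho> (max 0 s) $ i). indicator {s. \<zeta> s $ i = 0} s))) \<and>
     (\<forall>t\<ge>0. \<zeta> t = \<xi> t + (\<Sum>i\<in>UNIV. \<rho> t $ i *\<^sub>R reflection_vector r i) \<and>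
        (\<forall>i. 0 \<le> \<zeta> t $ i))}"

definition linear_input :: "('v::finite \<Rightarrow> 'v \<Rightarrow> real) \<Rightarrow> real ^ 'v \<Rightarrow> real \<Rightarrow> real ^ 'v" where
  "linear_input r u = (\<lambda>t\<in>{0..}. u + t *\<^sub>R drift r)"

definition orp_path :: "('v::finite \<Rightarrow> 'v \<Rightarrow> real) \<Rightarrow> real ^ 'v \<Rightarrow> real \<Rightarrow> real ^ 'v" where
  "orp_path r u = fst (THE p. p \<in> orp_solutions r (linear_input r u))"


section \<open>The piecewise linear path\<close>

definition local_drift :: "('v::finite \<Rightarrow> 'v \<Rightarrow> real) \<Rightarrow> real ^ 'v \<Rightarrow> real ^ 'v" where
  "local_drift r v = (\<chi> i. if i \<in> absorbing_hull r (supp v)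
                           then trace_drift r (absorbing_hull r (supp v)) i else 0)"

definition exit_time :: "('v::finite \<Rightarrow> 'v \<Rightarrow> real) \<Rightarrow> real ^ 'v \<Rightarrow> real" where
  "exit_time r v =
     Min ((\<lambda>i. - (v $ i) / local_drift r v $ i) ` {i \<in> supp v. local_drift r v $ i < 0})"

text \<open>
  The pairs of breakpoint times and positions; once the drift vanishes (the procedure has
  stopped) the sequence is continued by a constant.
\<close>

primrec breakpoint :: "('v::finite \<Rightarrow> 'v \<Rightarrow> real) \<Rightarrow> real ^ 'v \<Rightarrow> nat \<Rightarrow> real \<times> (real ^ 'v)" where
  "breakpoint r u 0 = (0, u)"
| "breakpoint r u (Suc k) =
     (let (T, v) = breakpoint r u k in
      if local_drift r v = 0 then (T, v)
      else (T + exit_time r v, v + exit_time r v *\<^sub>R local_drift r v))"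

definition final_step :: "('v::finite \<Rightarrow> 'v \<Rightarrow> real) \<Rightarrow> real ^ 'v \<Rightarrow> nat" where
  "final_step r u = (LEAST k. local_drift r (snd (breakpoint r u k)) = 0)"

definition linear_path :: "('v::finite \<Rightarrow> 'v \<Rightarrow> real) \<Rightarrow> real ^ 'v \<Rightarrow> real \<Rightarrow> real ^ 'v" where
  "linear_path r u = (\<lambda>t\<in>{0..}.
     if fst (breakpoint r u (final_step r u)) \<le> t then snd (breakpoint r u (final_step r u))
     else let k = (THE k. k < final_step r u \<and>
                     fst (breakpoint r u k) \<le> t \<and> t < fst (breakpoint r u (Suc k)));
              (T, v) = breakpoint r u k
          in v + (t - T) *\<^sub>R local_drift r v)"

end

theory Submission
  imports Defs
begin

text \<open>
  Write L for the generator of the walk (\<open>gen r\<close>) and L* for its transpose (\<open>adj r\<close>), so that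
  lambda = L* 1. The trace drift of A is L* a, where a = 1 on A and L* a = 0 off A, and A is
  absorbing iff a \<le> 1. Consequently the drift that the piecewise linear path follows at a point
  with support S is L* a, where a is the unique solution of an obstacle problem: a = 1 on S,
  a \<le> 1, L* a \<ge> 0 off S, and L* a = 0 where a < 1. A continuous path is determined by its
  starting point and by the property that it moves, immediately to the right of every time,
  linearly with this drift; so it suffices to show that all three kinds of path have it.
  For the reflection problem this is a maximum principle for the accumulated reflection.
  For the (lambda, D)-problem, the squared distance to a polar cone is a test function that
  cannot increase near an absorbing face, which keeps the path on that face; supports shrink
  through absorbing sets from then on, and condition (B) takes care of time zero.
\<close>

section \<open>Potential theory of the walk\<close>

text \<open>Probability enters only through hitting probabilities, which are harmonic off A with
  Kronecker boundary values; duality between L and L* turns trace drifts into L* a, and the rest is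
  linear algebra governed by maximum principles for the two operators. The difficulty of the
  (lambda, D)-problem is that a test function must have zero derivative along the jump vector of i
  wherever coordinate i vanishes, so plain coordinates are not admissible. Harmonic extensions of
  the coordinates of A satisfy the condition at all states off A. So does the projection onto the
  cone K of functions vanishing on A and superharmonic off A, by complementarity between the
  constraint L g \<le> 0 and optimality; and elements of K pair nonpositively with lambda as soon as
  a \<le> 1, which is where absorption enters. At the states of A a cutoff restores the condition.
  Condition (B) yields absorbing supports at times tending to zero, possibly without time zero
  itself, so the initial drift is found by extending the motion after time zero back to it.\<close>

definition gen :: "('v::finite \<Rightarrow> 'v \<Rightarrow> real) \<Rightarrow> ('v \<Rightarrow> real) \<Rightarrow> 'v \<Rightarrow> real" where
  "gen r f i = (\<Sum>j\<in>UNIV. r i j * (f j - f i))"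

definition adj :: "('v::finite \<Rightarrow> 'v \<Rightarrow> real) \<Rightarrow> ('v \<Rightarrow> real) \<Rightarrow> 'v \<Rightarrow> real" where
  "adj r y i = (\<Sum>j\<in>UNIV. r j i * y j - r i j * y i)"

lemma sum_neg_nonpos_ex:
  fixes f :: "'b \<Rightarrow> real"
  assumes "finite A" "\<And>x. x \<in> A \<Longrightarrow> f x \<le> 0" "\<exists>x\<in>A. f x < 0"
  shows "sum f A < 0"
  using sum_strict_mono_ex1[of A f "\<lambda>_. 0"] assms by simp

lemma gen_add: "gen r (\<lambda>i. f i + g i) i = gen r f i + gen r g i"
  by (simp add: gen_def algebra_simps sum.distrib sum_subtractf)

lemma gen_diff: "gen r (\<lambda>i. f i - g i) i = gen r f i - gen r g i"
  by (simp add: gen_def algebra_simps sum.distrib sum_subtractf)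

lemma gen_scale: "gen r (\<lambda>i. c * f i) i = c * gen r f i"
  by (simp add: gen_def algebra_simps sum_distrib_left)

lemma gen_const [simp]: "gen r (\<lambda>i. c) i = 0"
  by (simp add: gen_def)

lemma gen_sum: "finite J \<Longrightarrow> gen r (\<lambda>i. \<Sum>j\<in>J. f j i) i = (\<Sum>j\<in>J. gen r (f j) i)"
  by (induction J rule: finite_induct) (simp_all add: gen_add)

lemma adj_add: "adj r (\<lambda>i. f i + g i) i = adj r f i + adj r g i"
  by (simp add: adj_def algebra_simps sum.distrib sum_subtractf)

lemma adj_diff: "adj r (\<lambda>i. f i - g i) i = adj r f i - adj r g i"
  by (simp add: adj_def algebra_simps sum.distrib sum_subtractf)

lemma adj_scale: "adj r (\<lambda>i. c * f i) i = c * adj r f i"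
  by (simp add: adj_def algebra_simps sum_distrib_left)

lemma adj_uminus: "adj r (\<lambda>i. - f i) i = - adj r f i"
  using adj_scale[of r "-1" f i] by simp

lemma adj_zero [simp]: "adj r (\<lambda>i. 0) i = 0"
  by (simp add: adj_def)

text \<open>Relabelling the double sum moves L from f onto y. Every passage between functions
  (hitting probabilities, gradients) and measures (trace profiles, drifts) uses this
  duality.\<close>

lemma sum_mult_gen: "(\<Sum>i\<in>UNIV. y i * gen r f i) = (\<Sum>i\<in>UNIV. adj r y i * f i)"
proof -
  have "(\<Sum>i\<in>UNIV. adj r y i * f i)
      = (\<Sum>i\<in>UNIV. \<Sum>j\<in>UNIV. r j i * y j * f i) - (\<Sum>i\<in>UNIV. \<Sum>j\<in>UNIV. r i j * y i * f i)"
    by (simp add: adj_def sum_subtractf sum_distrib_right left_diff_distrib)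
  also have "(\<Sum>i\<in>UNIV. \<Sum>j\<in>UNIV. r j i * y j * f i) = (\<Sum>i\<in>UNIV. \<Sum>j\<in>UNIV. r i j * y i * f j)"
    by (rule sum.swap)
  finally show ?thesis
    by (simp add: gen_def sum_distrib_left sum_subtractf algebra_simps)
qed

text \<open>L kills constants, so by duality L* y has total mass zero; this keeps the moving points
  in the hyperplane of the simplex.\<close>

lemma sum_adj: "(\<Sum>i\<in>UNIV. adj r y i) = 0"
  using sum_mult_gen[of y r "\<lambda>_. 1"] by simp

lemma drift_eq_adj: "drift r $ i = adj r (\<lambda>_. 1) i"
  by (simp add: drift_def adj_def)

lemma jump_vector_nth: "jump_vector r i $ j = r i j - (if i = j then exit_rate r i else 0)"
  by (auto simp: jump_vector_def sum_component axis_def exit_rate_def right_diff_distrib sum_subtractf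
      if_distrib [of "\<lambda>x. _ * x"] cong: if_cong)

lemma jump_vector_inner: "jump_vector r i \<bullet> g = gen r (($) g) i"
proof -
  have "jump_vector r i \<bullet> g = (\<Sum>k\<in>UNIV. r i k * (axis k 1 \<bullet> g - axis i 1 \<bullet> g))"
    by (simp add: jump_vector_def inner_sum_left inner_diff_left)
  then show ?thesis
    by (simp add: gen_def inner_axis')
qed

text \<open>Expresses drifts in the directions along which test functions have vanishing
  derivatives, and along which reflection pushes.\<close>

lemma adj_eq_sum_jump_vector: "adj r y j = (\<Sum>i\<in>UNIV. y i *\<^sub>R jump_vector r i) $ j"
proof -
  have "(\<Sum>i\<in>UNIV. y i *\<^sub>R jump_vector r i) $ j
      = (\<Sum>i\<in>UNIV. y i * r i j) - (\<Sum>i\<in>UNIV. if i = j then y i * exit_rate r i else 0)"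
    by (simp add: sum_component jump_vector_nth right_diff_distrib sum_subtractf
        if_distrib [of "\<lambda>x. _ * x"] cong: if_cong)
  then show ?thesis
    by (simp add: adj_def exit_rate_def sum_subtractf sum_distrib_left mult.commute)
qed

lemma reflection_vector_eq: "reflection_vector r i = - (jump_vector r i /\<^sub>R exit_rate r i)"
proof -
  have "reflection_vector r i = (\<Sum>j\<in>UNIV. - ((r i j *\<^sub>R (axis j 1 - axis i 1)) /\<^sub>R exit_rate r i))"
    unfolding reflection_vector_def jump_prob_def
    by (rule sum.cong) (auto simp: divide_inverse algebra_simps)
  then show ?thesis
    by (simp add: jump_vector_def sum_negf scaleR_sum_right)
qed

text \<open>Values on A together with T off A form a square linear system, so uniqueness for zero
  data gives solvability for all data. T is kept abstract so as to serve both L and L*.\<close>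

lemma boundary_problem_exists:
  fixes T :: "('v::finite \<Rightarrow> real) \<Rightarrow> 'v \<Rightarrow> real"
  assumes add: "\<And>f g i. T (\<lambda>i. f i + g i) i = T f i + T g i"
    and scale: "\<And>c f i. T (\<lambda>i. c * f i) i = c * T f i"
    and unique: "\<And>f i. (\<And>i. i \<in> A \<Longrightarrow> f i = 0) \<Longrightarrow> (\<And>i. i \<notin> A \<Longrightarrow> T f i = 0) \<Longrightarrow> f i = 0"
  obtains f where "\<And>i. i \<in> A \<Longrightarrow> f i = b i" "\<And>i. i \<notin> A \<Longrightarrow> T f i = b i"
proof -
  define M :: "real ^ 'v \<Rightarrow> real ^ 'v" where
    "M x = (\<chi> i. if i \<in> A then x $ i else T (($) x) i)" for x
  have M_nth: "M x $ i = (if i \<in> A then x $ i else T (($) x) i)" for x i by (simp add: M_def)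
  have lin: "linear M"
  proof (rule linearI)
    show "M (x + y) = M x + M y" for x y
    proof -
      have "($) (x + y) = (\<lambda>i. x $ i + y $ i)" by (simp add: fun_eq_iff)
      then show ?thesis by (simp add: vec_eq_iff M_nth add)
    qed
    show "M (c *\<^sub>R x) = c *\<^sub>R M x" for c x
    proof -
      have "($) (c *\<^sub>R x) = (\<lambda>i. c * x $ i)" by (simp add: fun_eq_iff)
      then show ?thesis by (simp add: vec_eq_iff M_nth scale)
    qed
  qed
  have "x = 0" if "M x = 0" for x
  proof -
    have h: "(if i \<in> A then x $ i else T (($) x) i) = 0" for i
      unfolding M_nth[symmetric] using that by simp
    have "x $ i = 0" for i by (rule unique[of "($) x"]) (use h in metis)+
    then show ?thesis by (simp add: vec_eq_iff)
  qed
  then have "inj M" using lin by (simp add: linear_injective_0)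
  with lin have "surj M" by (rule linear_injective_imp_surjective) simp
  then obtain x where "M x = (\<chi> i. b i)" by (metis surj_def)
  then have h: "(if i \<in> A then x $ i else T (($) x) i) = b i" for i
    unfolding M_nth[symmetric] by simp
  show thesis by (rule that[of "($) x"]) (use h in metis)+
qed

section \<open>Maximum principles and boundary value problems for the generator and its
  transpose\<close>

locale irreducible_walk =
  fixes r :: "'v::finite \<Rightarrow> 'v \<Rightarrow> real"
  assumes irreducible: "irreducible_rates r"
begin

lemma rate_nonneg: "0 \<le> r i j"
  using irreducible by (simp add: irreducible_rates_def)

text \<open>A set that no positive rate leaves contains everything reachable from it. Reachability
  is used only here.\<close>

lemma rate_across_cut:
  assumes "P \<noteq> {}" "P \<noteq> UNIV"
  obtains i j where "i \<in> P" "j \<notin> P" "0 < r i j"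
proof -
  obtain i j where ij: "i \<in> P" "j \<notin> P" using assms by auto
  have "\<exists>i\<in>P. \<exists>j\<in>-P. 0 < r i j"
  proof (rule ccontr)
    assume no: "\<not> ?thesis"
    have "(i, j) \<in> {(a, b). 0 < r a b}\<^sup>*" using irreducible by (simp add: irreducible_rates_def)
    then have "j \<in> P" using no by (induction rule: rtrancl_induct) (use ij in auto)
    with ij show False by simp
  qed
  then show thesis using that by auto
qed

text \<open>A positive maximum is attained only inside B. Some positive rate leaves the set where it
  is attained, and at the state it leaves from L f is strictly negative.\<close>

lemma gen_max_principle:
  assumes "B \<noteq> UNIV" and off: "\<And>i. i \<notin> B \<Longrightarrow> f i \<le> 0" and sub: "\<And>i. i \<in> B \<Longrightarrow> 0 \<le> gen r f i"
  shows "f i \<le> 0"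
proof (rule ccontr)
  assume "\<not> f i \<le> 0"
  define M where "M = Max (range f)"
  have M: "f j \<le> M" for j by (simp add: M_def)
  have "0 < M" using \<open>\<not> f i \<le> 0\<close> M[of i] by linarith
  define P where "P = {j. f j = M}"
  have "M \<in> range f" unfolding M_def by (rule Max_in) auto
  then have "P \<noteq> {}" by (auto simp: P_def)
  have PB: "P \<subseteq> B"
  proof
    fix j assume "j \<in> P"
    then have "f j = M" by (simp add: P_def)
    with off[of j] \<open>0 < M\<close> show "j \<in> B" by linarith
  qed
  then have "P \<noteq> UNIV" using \<open>B \<noteq> UNIV\<close> by auto
  then obtain j k where jk: "j \<in> P" "k \<notin> P" "0 < r j k"
    using rate_across_cut[OF \<open>P \<noteq> {}\<close>] by blast
  have "f k < M" using jk(2) M[of k] by (auto simp: P_def less_le)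
  have "gen r f j < 0" unfolding gen_def
  proof (rule sum_neg_nonpos_ex)
    show "\<exists>k\<in>UNIV. r j k * (f k - f j) < 0"
      using jk \<open>f k < M\<close> by (intro bexI[of _ k]) (auto simp: P_def intro: mult_pos_neg)
  qed (use jk M in \<open>auto simp: P_def rate_nonneg mult_nonneg_nonpos\<close>)
  with sub[of j] jk PB show False by auto
qed

text \<open>L* does not average, so there is no argument at a maximum point. Instead y is tested
  against the indicator e of {y > 0}: every term y(i) (L e)(i) is nonpositive and one is negative,
  while the dual sum of (L* y)(i) e(i) is nonnegative.\<close>

lemma adj_max_principle:
  assumes "B \<noteq> UNIV" and off: "\<And>i. i \<notin> B \<Longrightarrow> y i \<le> 0" and sub: "\<And>i. i \<in> B \<Longrightarrow> 0 \<le> adj r y i"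
  shows "y i \<le> 0"
proof (rule ccontr)
  assume "\<not> y i \<le> 0"
  define P where "P = {j. 0 < y j}"
  have "P \<noteq> {}" using \<open>\<not> y i \<le> 0\<close> by (auto simp: P_def not_le)
  have PB: "P \<subseteq> B" using off by (force simp: P_def)
  then have "P \<noteq> UNIV" using \<open>B \<noteq> UNIV\<close> by auto
  then obtain j k where jk: "j \<in> P" "k \<notin> P" "0 < r j k"
    using rate_across_cut[OF \<open>P \<noteq> {}\<close>] by blast
  let ?e = "indicat_real P"
  have le: "y i * gen r ?e i \<le> 0" for i
  proof (cases "i \<in> P")
    case True
    have "gen r ?e i \<le> 0" unfolding gen_def
      using True by (intro sum_nonpos) (auto simp: rate_nonneg indicator_def)
    then show ?thesis using True by (simp add: P_def mult_nonneg_nonpos)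
  next
    case False
    have "gen r ?e i \<ge> 0" unfolding gen_def
      using False by (intro sum_nonneg) (auto simp: rate_nonneg indicator_def)
    then show ?thesis using False by (simp add: P_def mult_nonpos_nonneg not_less)
  qed
  have "gen r ?e j < 0" unfolding gen_def
  proof (rule sum_neg_nonpos_ex)
    show "\<exists>k\<in>UNIV. r j k * (?e k - ?e j) < 0"
      using jk by (intro bexI[of _ k]) auto
  qed (use jk in \<open>auto simp: rate_nonneg indicator_def\<close>)
  then have "y j * gen r ?e j < 0" using jk by (simp add: P_def mult_pos_neg)
  then have "(\<Sum>i\<in>UNIV. y i * gen r ?e i) < 0"
    by (intro sum_neg_nonpos_ex) (use le in auto)
  moreover have "0 \<le> (\<Sum>i\<in>UNIV. adj r y i * ?e i)"
    using sub PB by (intro sum_nonneg) (auto simp: indicator_def)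
  ultimately show False by (simp add: sum_mult_gen)
qed

lemma gen_boundary_unique:
  assumes "A \<noteq> {}" "\<And>i. i \<in> A \<Longrightarrow> f i = g i" "\<And>i. i \<notin> A \<Longrightarrow> gen r f i = gen r g i"
  shows "f i = g i"
proof -
  have "f i - g i \<le> 0"
    by (rule gen_max_principle[of "-A" "\<lambda>i. f i - g i"]) (use assms in \<open>auto simp: gen_diff\<close>)
  moreover have "g i - f i \<le> 0"
    by (rule gen_max_principle[of "-A" "\<lambda>i. g i - f i"]) (use assms in \<open>auto simp: gen_diff\<close>)
  ultimately show ?thesis by simp
qed

lemma adj_boundary_unique:
  assumes "A \<noteq> {}" "\<And>i. i \<in> A \<Longrightarrow> f i = g i" "\<And>i. i \<notin> A \<Longrightarrow> adj r f i = adj r g i"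
  shows "f i = g i"
proof -
  have "f i - g i \<le> 0"
    by (rule adj_max_principle[of "-A" "\<lambda>i. f i - g i"]) (use assms in \<open>auto simp: adj_diff\<close>)
  moreover have "g i - f i \<le> 0"
    by (rule adj_max_principle[of "-A" "\<lambda>i. g i - f i"]) (use assms in \<open>auto simp: adj_diff\<close>)
  ultimately show ?thesis by simp
qed

lemma gen_boundary_exists:
  assumes "A \<noteq> {}"
  obtains f where "\<And>i. i \<in> A \<Longrightarrow> f i = b i" "\<And>i. i \<notin> A \<Longrightarrow> gen r f i = b i"
proof (rule boundary_problem_exists[where T = "gen r" and A = A and b = b])
  show "f i = 0" if "\<And>i. i \<in> A \<Longrightarrow> f i = 0" "\<And>i. i \<notin> A \<Longrightarrow> gen r f i = 0" for f i
    by (rule gen_boundary_unique[OF assms, of f "\<lambda>_. 0"]) (use that in auto)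
qed (use that in \<open>auto simp: gen_add gen_scale\<close>)

lemma adj_boundary_exists:
  assumes "A \<noteq> {}"
  obtains f where "\<And>i. i \<in> A \<Longrightarrow> f i = b i" "\<And>i. i \<notin> A \<Longrightarrow> adj r f i = b i"
proof (rule boundary_problem_exists[where T = "adj r" and A = A and b = b])
  show "f i = 0" if "\<And>i. i \<in> A \<Longrightarrow> f i = 0" "\<And>i. i \<notin> A \<Longrightarrow> adj r f i = 0" for f i
    by (rule adj_boundary_unique[OF assms, of f "\<lambda>_. 0"]) (use that in auto)
qed (use that in \<open>auto simp: adj_add adj_scale\<close>)

text \<open>As a measure it is counting measure on A, extended so that inflow equals outflow at each
  state off A. For nonempty A it is unique by \<open>adj_boundary_unique\<close>, so the choice is
  harmless.\<close>

definition trace_profile :: "'v set \<Rightarrow> 'v \<Rightarrow> real" where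
  "trace_profile A = (SOME a. (\<forall>i\<in>A. a i = 1) \<and> (\<forall>i\<in>-A. adj r a i = 0))"

lemma
  assumes "A \<noteq> {}"
  shows trace_profile_on: "i \<in> A \<Longrightarrow> trace_profile A i = 1"
    and adj_trace_profile_off: "i \<notin> A \<Longrightarrow> adj r (trace_profile A) i = 0"
proof -
  obtain f where "\<And>i. i \<in> A \<Longrightarrow> f i = (if i \<in> A then 1 else 0)"
    "\<And>i. i \<notin> A \<Longrightarrow> adj r f i = (if i \<in> A then 1 else 0)"
    using adj_boundary_exists[OF assms, of "\<lambda>i. if i \<in> A then 1 else 0"] by metis
  then have "\<exists>a. (\<forall>i\<in>A. a i = 1) \<and> (\<forall>i\<in>-A. adj r a i = 0)" by auto
  from someI_ex[OF this] show "i \<in> A \<Longrightarrow> trace_profile A i = 1" "i \<notin> A \<Longrightarrow> adj r (trace_profile A) i = 0"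
    unfolding trace_profile_def by auto
qed

end

section \<open>Hitting probabilities and trace rates\<close>

definition step_law :: "('v::finite \<Rightarrow> 'v \<Rightarrow> real) \<Rightarrow> (('v \<Rightarrow> 'v) \<times> real) measure" where
  "step_law r = measure_pmf (Pi_pmf UNIV undefined (jump_pmf r))
     \<Otimes>\<^sub>M density lborel (\<lambda>x. ennreal (exponential_density 1 x))"

lemma walk_space_eq: "walk_space r = PiM UNIV (\<lambda>_. step_law r)"
  by (simp add: walk_space_def step_law_def)

lemma prob_space_exponential: "prob_space (density lborel (\<lambda>x. ennreal (exponential_density 1 x)))"
  by (rule prob_space_exponential_density) simp

lemma prob_space_step_law: "prob_space (step_law r)"
proof -
  interpret E: prob_space "density lborel (\<lambda>x. ennreal (exponential_density 1 x))"
    by (rule prob_space_exponential)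
  interpret pair_prob_space "measure_pmf (Pi_pmf UNIV undefined (jump_pmf r))"
    "density lborel (\<lambda>x. ennreal (exponential_density 1 x))" ..
  show ?thesis unfolding step_law_def by (rule P.prob_space_axioms)
qed

interpretation walk_space: sequence_space "step_law r"
  by (simp add: sequence_space_def product_prob_space_def product_prob_space_axioms_def
      product_sigma_finite_def prob_space_step_law prob_space_imp_sigma_finite)

section \<open>Measurability of the walk and of its hitting times\<close>

lemma measurable_jump_target [measurable]:
  "(\<lambda>s. fst s i) \<in> step_law r \<rightarrow>\<^sub>M count_space UNIV"
proof -
  have "(\<lambda>s. (\<lambda>f. f i) (fst s)) \<in> step_law r \<rightarrow>\<^sub>M count_space UNIV"
    unfolding step_law_def by (rule measurable_compose[OF measurable_fst]) simp
  then show ?thesis by simp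
qed

lemma measurable_step_snd [measurable]: "snd \<in> step_law r \<rightarrow>\<^sub>M borel"
  unfolding step_law_def by measurable

lemma measurable_step_component [measurable]: "(\<lambda>\<omega>. \<omega> n) \<in> walk_space r \<rightarrow>\<^sub>M step_law r"
  unfolding walk_space_eq by measurable

lemma measurable_jump_chain:
  "(\<lambda>\<omega>. jump_chain k \<omega> n) \<in> walk_space r \<rightarrow>\<^sub>M count_space UNIV"
proof (induction n)
  case (Suc n)
  have "(\<lambda>\<omega>. (\<lambda>i \<omega>. fst (\<omega> n) i) (jump_chain k \<omega> n) \<omega>) \<in> walk_space r \<rightarrow>\<^sub>M count_space UNIV"
  proof (rule measurable_compose_countable[OF _ Suc])
    show "(\<lambda>\<omega>. fst (\<omega> n) i) \<in> walk_space r \<rightarrow>\<^sub>M count_space UNIV" for i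
      by (rule measurable_compose[OF measurable_step_component measurable_jump_target])
  qed
  then show ?case by simp
qed simp

lemma measurable_jump_time:
  "(\<lambda>\<omega>. jump_time r k \<omega> n) \<in> borel_measurable (walk_space r)"
proof -
  have [measurable]: "(\<lambda>\<omega>. snd (\<omega> m)) \<in> borel_measurable (walk_space r)" for m
    by (rule measurable_compose[OF measurable_step_component measurable_step_snd])
  have [measurable]: "(\<lambda>\<omega>. exit_rate r (jump_chain k \<omega> m)) \<in> borel_measurable (walk_space r)" for m
    by (rule measurable_compose[OF measurable_jump_chain]) simp
  show ?thesis unfolding jump_time_def holding_time_def by measurable
qed

lemma measurable_walk:
  "(\<lambda>\<omega>. walk r k t \<omega>) \<in> walk_space r \<rightarrow>\<^sub>M count_space UNIV"
  unfolding walk_def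
proof (rule measurable_compose_countable[where f = "\<lambda>n \<omega>. jump_chain k \<omega> n"])
  show "(\<lambda>\<omega>. LEAST n. ereal t < jump_time r k \<omega> (Suc n)) \<in> walk_space r \<rightarrow>\<^sub>M count_space UNIV"
  proof (rule measurable_Least)
    show "Measurable.pred (walk_space r) (\<lambda>\<omega>. ereal t < jump_time r k \<omega> (Suc n))" for n
      unfolding pred_def by (intro borel_measurable_less measurable_const measurable_jump_time) simp
  qed
qed (rule measurable_jump_chain)

text \<open>The jump index at t stays the least one until the next jump time. Beyond all jump times
  no index exists, and \<open>LEAST\<close> has the same default at all later times, so the
  statement holds for every sample point and not just almost every one.\<close>

lemma walk_right_constant: "\<exists>e>0. \<forall>s. t \<le> s \<and> s < t + e \<longrightarrow> walk r k s \<omega> = walk r k t \<omega>"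
proof (cases "\<exists>n. ereal t < jump_time r k \<omega> (Suc n)")
  case True
  define n where "n = (LEAST n. ereal t < jump_time r k \<omega> (Suc n))"
  have n: "ereal t < jump_time r k \<omega> (Suc n)" unfolding n_def by (rule LeastI_ex[OF True])
  then obtain u where u: "ereal t < ereal u" "ereal u < jump_time r k \<omega> (Suc n)"
    using ereal_dense2[OF n] by blast
  have least: "(LEAST m. ereal s < jump_time r k \<omega> (Suc m)) = n" if "t \<le> s" "s < u" for s
  proof (rule Least_equality)
    show "ereal s < jump_time r k \<omega> (Suc n)" by (rule less_trans[OF _ u(2)]) (use that in simp)
    fix m assume "ereal s < jump_time r k \<omega> (Suc m)"
    then have "ereal t < jump_time r k \<omega> (Suc m)"
      by (rule le_less_trans[rotated]) (use that in simp)
    then show "n \<le> m" unfolding n_def by (rule Least_le)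
  qed
  have "walk r k s \<omega> = walk r k t \<omega>" if "t \<le> s" "s < u" for s
    unfolding walk_def least[OF that] by (simp only: n_def)
  moreover have "0 < u - t" using u(1) by simp
  ultimately show ?thesis by (metis add_diff_cancel_left' add_diff_eq)
next
  case False
  have no: "\<not> ereal s < jump_time r k \<omega> (Suc n)" if "t \<le> s" for s n
  proof
    assume "ereal s < jump_time r k \<omega> (Suc n)"
    then have "ereal t < jump_time r k \<omega> (Suc n)"
      by (rule le_less_trans[rotated]) (use that in simp)
    with False show False by blast
  qed
  have "walk r k s \<omega> = walk r k t \<omega>" if "t \<le> s" for s
    unfolding walk_def by (simp only: no[OF that] no[OF order_refl])
  then show ?thesis using zero_less_one by blast
qed

text \<open>Right-constancy lets a slightly later rational time replace any time spent in B, so the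
  infimum becomes countable, which gives measurability.\<close>

lemma hitting_time_eq_rational:
  "hitting_time r k B \<omega> = (INF t\<in>\<rat> \<inter> {0..}. if walk r k t \<omega> \<in> B then ereal t else \<infinity>)" (is "?l = ?r")
proof (rule antisym)
  have "hitting_time r k B \<omega> \<le> ereal t" if "0 \<le> t" "walk r k t \<omega> \<in> B" for t
    unfolding hitting_time_def by (rule INF_lower) (use that in simp)
  then show "?l \<le> ?r" by (intro INF_greatest) simp
  show "?r \<le> ?l" unfolding hitting_time_def
  proof (rule INF_greatest, clarify)
    fix t assume t: "0 \<le> t" "walk r k t \<omega> \<in> B"
    obtain e where e: "0 < e" "\<And>s. t \<le> s \<Longrightarrow> s < t + e \<Longrightarrow> walk r k s \<omega> = walk r k t \<omega>"
      using walk_right_constant[of t r k \<omega>] by auto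
    show "?r \<le> ereal t"
    proof (rule ereal_le_epsilon2)
      fix d :: real assume "0 < d"
      obtain q where q: "q \<in> \<rat>" "t < q" "q < t + min d e"
        using Rats_dense_in_real[of t "t + min d e"] e(1) \<open>0 < d\<close> by auto
      have "?r \<le> (if walk r k q \<omega> \<in> B then ereal q else \<infinity>)"
        by (rule INF_lower) (use q t in auto)
      also have "\<dots> = ereal q" using e(2)[of q] q t by simp
      also have "\<dots> \<le> ereal t + ereal d" using q by simp
      finally show "?r \<le> ereal t + ereal d" .
    qed
  qed
qed

lemma measurable_hitting_time:
  "(\<lambda>\<omega>. hitting_time r k B \<omega>) \<in> borel_measurable (walk_space r)"
proof -
  have "countable (\<rat> \<inter> {0::real..})" by (intro countable_Int1 countable_rat)
  moreover have "(\<lambda>\<omega>. if walk r k t \<omega> \<in> B then ereal t else \<infinity>) \<in> borel_measurable (walk_space r)" for t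
    by (rule measurable_compose[OF measurable_walk, of "\<lambda>x. if x \<in> B then ereal t else \<infinity>"]) simp
  ultimately show ?thesis unfolding hitting_time_eq_rational by (intro borel_measurable_INF)
qed

text \<open>Vacuously true along sequences that avoid A: for j in A both hitting times are then
  infinite, so such paths belong to the equality event in \<open>trace_rate\<close>.\<close>

definition first_hit_at :: "'v set \<Rightarrow> 'v \<Rightarrow> (nat \<Rightarrow> 'v) \<Rightarrow> bool" where
  "first_hit_at A j x \<longleftrightarrow> (\<forall>n. x n \<in> A \<and> (\<forall>m<n. x m \<notin> A) \<longrightarrow> x n = j)"

lemma measurable_first_hit_at:
  "Measurable.pred (walk_space r) (\<lambda>\<omega>. first_hit_at A j (jump_chain k \<omega>))"
proof -
  have *: "Measurable.pred (walk_space r) (\<lambda>\<omega>. P (jump_chain k \<omega> n))" for P n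
    by (rule measurable_compose[OF measurable_jump_chain]) simp
  show ?thesis unfolding first_hit_at_def
    by (intro pred_intros_countable(1) pred_intros_logic(2-) pred_intros_imp' *)
qed

section \<open>Almost sure properties of the holding times and absence of explosion\<close>

lemma prob_step_snd_le:
  assumes "0 \<le> a"
  shows "measure (step_law r) {s \<in> space (step_law r). snd s \<le> a} = 1 - exp (- a)"
proof -
  let ?E = "density lborel (\<lambda>x. ennreal (exponential_density 1 x))"
  let ?P = "measure_pmf (Pi_pmf UNIV undefined (jump_pmf r))"
  interpret E: prob_space ?E by (rule prob_space_exponential)
  have D: "distributed ?E lborel (\<lambda>x. x) (exponential_density 1)"
    unfolding distributed_def by (auto intro!: distr_id2)
  have "{s \<in> space (step_law r). snd s \<le> a} = space ?P \<times> {..a}"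
    by (auto simp: step_law_def space_pair_measure)
  then have "emeasure (step_law r) {s \<in> space (step_law r). snd s \<le> a} = emeasure ?E {..a}"
    by (simp add: step_law_def E.emeasure_pair_measure_Times measure_pmf.emeasure_space_1
        del: space_measure_pmf)
  then show ?thesis
    using E.exponential_distributedD_le[OF D, of a] assms by (simp add: measure_def atMost_def)
qed

lemma AE_holding_pos: "AE \<omega> in walk_space r. \<forall>n. 0 < snd (\<omega> n)"
proof (subst AE_all_countable, rule allI)
  fix n
  have "AE s in step_law r. 0 < snd s"
  proof (rule AE_I)
    show "emeasure (step_law r) {s \<in> space (step_law r). snd s \<le> 0} = 0"
      using prob_step_snd_le[of 0 r] by (simp add: walk_space.M.emeasure_eq_measure)
  qed auto
  then show "AE \<omega> in walk_space r. 0 < snd (\<omega> n)"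
    unfolding walk_space_eq by (intro AE_PiM_component prob_space_step_law) auto
qed

text \<open>Each variable is at most 1 with probability q = 1 - exp (- 1) < 1. The event that this
  happens from N on lies in a product set, whose measure is the limit of powers of q.\<close>

lemma AE_holding_gt_one: "AE \<omega> in walk_space r. \<forall>N. \<exists>n\<ge>N. 1 < snd (\<omega> n)"
proof (subst AE_all_countable, rule allI)
  fix N
  define E where "E n = (if n < N then space (step_law r) else {s \<in> space (step_law r). snd s \<le> 1})" for n :: nat
  define q :: real where "q = 1 - exp (- 1)"
  have E: "E n \<in> sets (step_law r)" for n by (auto simp: E_def)
  have "(\<Prod>i\<le>n. measure (step_law r) (E i)) = q ^ (Suc n - N)" for n
  proof (induction n)
    case 0 then show ?case by (cases "N = 0") (auto simp: E_def q_def prob_step_snd_le walk_space.M.prob_space)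
  next
    case (Suc n)
    then show ?case by (auto simp: E_def q_def prob_step_snd_le walk_space.M.prob_space Suc_diff_le)
  qed
  with walk_space.measure_PiM_countable[of E, OF E]
  have lim: "(\<lambda>n. q ^ (Suc n - N)) \<longlonglongrightarrow> measure (walk_space r) (Pi UNIV E)"
    by (simp add: walk_space_eq)
  have "(\<lambda>n. q ^ (Suc n - N)) \<longlonglongrightarrow> 0"
  proof (rule LIMSEQ_offset[of _ N])
    have "(\<lambda>n. q ^ Suc n) \<longlonglongrightarrow> 0"
      by (rule LIMSEQ_Suc) (auto intro!: LIMSEQ_power_zero simp: q_def)
    then show "(\<lambda>n. q ^ (Suc (n + N) - N)) \<longlonglongrightarrow> 0" by (simp add: Suc_diff_le)
  qed
  then have 0: "measure (walk_space r) (Pi UNIV E) = 0" using lim LIMSEQ_unique by blast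
  show "AE \<omega> in walk_space r. \<exists>n\<ge>N. 1 < snd (\<omega> n)"
  proof (rule AE_I)
    show "emeasure (walk_space r) (Pi UNIV E) = 0"
      using 0 walk_space.P.emeasure_eq_measure[of r "Pi UNIV E"] by (simp add: walk_space_eq)
    show "Pi UNIV E \<in> sets (walk_space r)"
      using walk_space.infprod_in_sets[of E, OF E] by (simp add: walk_space_eq)
    show "{\<omega> \<in> space (walk_space r). \<not> (\<exists>n\<ge>N. 1 < snd (\<omega> n))} \<subseteq> Pi UNIV E"
      by (auto simp: walk_space_eq space_PiM E_def not_less PiE_iff)
  qed
qed


lemma step_times_unbounded:
  fixes H :: "nat \<Rightarrow> real"
  assumes H: "\<And>n. 0 < H n" and inf: "\<And>N. \<exists>n\<ge>N. c < H n" and "0 < c"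
  shows "\<exists>n. t < (\<Sum>m<n. H m)"
proof (rule ccontr)
  assume "\<not> ?thesis"
  then have le: "(\<Sum>m<n. H m) \<le> t" for n by (simp add: not_less)
  have "summable H"
    by (rule summableI_nonneg_bounded[where x = t]) (use H le in \<open>auto intro: less_imp_le\<close>)
  then have "H \<longlonglongrightarrow> 0" by (rule summable_LIMSEQ_zero)
  then have "eventually (\<lambda>n. H n < c) sequentially" using \<open>0 < c\<close> by (rule order_tendstoD)
  then obtain N where "\<And>n. n \<ge> N \<Longrightarrow> H n < c" by (auto simp: eventually_sequentially)
  with inf[of N] show False by (meson less_asym)
qed

text \<open>Infinitely many holding times exceed a fixed bound, so the jump times exhaust the half
  line and entry into B happens at the jump time of the first visit of the chain. The same J serves
  all B, which reduces comparing hitting times to comparing indices.\<close>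

lemma hitting_time_eq_jump_time:
  fixes r :: "'v::finite \<Rightarrow> 'v \<Rightarrow> real"
  assumes rate: "\<And>i. 0 < exit_rate r i"
    and pos: "\<And>n. 0 < snd (\<omega> n)" and big: "\<And>N. \<exists>n\<ge>N. 1 < snd (\<omega> n)"
  obtains J :: "nat \<Rightarrow> real" where "strict_mono J"
    "\<And>B. hitting_time r k B \<omega> =
       (if \<exists>n. jump_chain k \<omega> n \<in> B then ereal (J (LEAST n. jump_chain k \<omega> n \<in> B)) else \<infinity>)"
proof -
  define X where "X = jump_chain k \<omega>"
  define H where "H n = snd (\<omega> n) / exit_rate r (X n)" for n
  define J where "J n = (\<Sum>m<n. H m)" for n
  have H: "0 < H n" for n using rate pos by (simp add: H_def)
  have JT: "jump_time r k \<omega> n = ereal (J n)" for n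
    using rate by (simp add: jump_time_def holding_time_def J_def H_def X_def less_imp_neq[symmetric])
  have mono: "strict_mono J"
    by (rule strict_monoI_Suc) (use H in \<open>simp add: J_def\<close>)
  define R where "R = Max (range (exit_rate r))"
  have R: "exit_rate r i \<le> R" for i by (simp add: R_def)
  have "0 < R" using rate R less_le_trans by blast
  have "\<exists>n\<ge>N. 1 / R < H n" for N
  proof -
    obtain n where n: "n \<ge> N" "1 < snd (\<omega> n)" using big by blast
    have "1 / R \<le> 1 / exit_rate r (X n)" using R rate by (intro divide_left_mono) (auto simp: \<open>0 < R\<close>)
    also have "\<dots> < H n" unfolding H_def using n rate by (intro divide_strict_right_mono)
    finally show ?thesis using n by blast
  qed
  then have unbounded: "\<exists>n. t < J n" for t
    unfolding J_def by (intro step_times_unbounded[OF H, of "1 / R"]) (use \<open>0 < R\<close> in auto)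
  have walk: "walk r k t \<omega> = X n" if "J n \<le> t" "t < J (Suc n)" for n t
  proof -
    have "(LEAST m. ereal t < jump_time r k \<omega> (Suc m)) = n"
    proof (rule Least_equality)
      show "ereal t < jump_time r k \<omega> (Suc n)" using that by (simp add: JT)
      fix m assume "ereal t < jump_time r k \<omega> (Suc m)"
      then have "J n < J (Suc m)" using that by (simp add: JT)
      then show "n \<le> m" using mono by (simp add: strict_mono_less)
    qed
    then show ?thesis by (simp add: walk_def X_def)
  qed
  have interval: "\<exists>n. J n \<le> t \<and> t < J (Suc n)" if "0 \<le> t" for t
  proof -
    define n where "n = (LEAST n. t < J n)"
    have n: "t < J n" unfolding n_def using unbounded by (rule LeastI_ex)
    have "n \<noteq> 0" using n that by (cases n) (auto simp: J_def)
    then obtain m where m: "n = Suc m" by (cases n) auto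
    have "\<not> t < J m" using not_less_Least[of m "\<lambda>n. t < J n"] m by (simp add: n_def)
    then show ?thesis using n m by (intro exI[of _ m]) simp
  qed
  have J0: "0 \<le> J n" for n unfolding J_def by (intro sum_nonneg) (use H in \<open>auto intro: less_imp_le\<close>)
  have "hitting_time r k B \<omega> = (if \<exists>n. X n \<in> B then ereal (J (LEAST n. X n \<in> B)) else \<infinity>)" for B
  proof (cases "\<exists>n. X n \<in> B")
    case True
    define n where "n = (LEAST n. X n \<in> B)"
    have n: "X n \<in> B" unfolding n_def using True by (rule LeastI_ex)
    have "hitting_time r k B \<omega> = ereal (J n)" unfolding hitting_time_def
    proof (rule antisym)
      show "Inf (ereal ` {t. 0 \<le> t \<and> walk r k t \<omega> \<in> B}) \<le> ereal (J n)"
        by (rule INF_lower) (use n J0 mono walk[of n "J n"] in \<open>auto simp: strict_mono_less\<close>)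
      show "ereal (J n) \<le> Inf (ereal ` {t. 0 \<le> t \<and> walk r k t \<omega> \<in> B})"
      proof (rule INF_greatest, clarify)
        fix t assume t: "0 \<le> t" "walk r k t \<omega> \<in> B"
        obtain m where m: "J m \<le> t" "t < J (Suc m)" using interval t by blast
        then have "n \<le> m" unfolding n_def using t walk by (intro Least_le) simp
        then have "J n \<le> J m" using mono by (simp add: strict_mono_less_eq)
        then show "ereal (J n) \<le> ereal t" using m by simp
      qed
    qed
    then show ?thesis using True by (simp add: n_def)
  next
    case False
    have e: "{t. 0 \<le> t \<and> walk r k t \<omega> \<in> B} = {}" using False interval walk by force
    show ?thesis unfolding hitting_time_def e using False by (simp add: top_ereal_def)
  qed
  with mono show thesis unfolding X_def by (rule that)
qed

lemma hitting_time_eq_iff: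
  fixes r :: "'v::finite \<Rightarrow> 'v \<Rightarrow> real"
  assumes "\<And>i. 0 < exit_rate r i"
    and "\<And>n. 0 < snd (\<omega> n)" and "\<And>N. \<exists>n\<ge>N. 1 < snd (\<omega> n)" and "j \<in> A"
  shows "hitting_time r k A \<omega> = hitting_time r k {j} \<omega> \<longleftrightarrow> first_hit_at A j (jump_chain k \<omega>)"
proof -
  define X where "X = jump_chain k \<omega>"
  obtain J :: "nat \<Rightarrow> real" where J: "strict_mono J" and
    hit: "\<And>B. hitting_time r k B \<omega> = (if \<exists>n. X n \<in> B then ereal (J (LEAST n. X n \<in> B)) else \<infinity>)"
    unfolding X_def using hitting_time_eq_jump_time[OF assms(1-3)] by metis
  have "hitting_time r k A \<omega> = hitting_time r k {j} \<omega> \<longleftrightarrow> first_hit_at A j X"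
  proof (cases "\<exists>n. X n \<in> A")
    case False
    then have "\<not> (\<exists>n. X n \<in> {j})" using \<open>j \<in> A\<close> by auto
    with False show ?thesis by (auto simp: hit first_hit_at_def)
  next
    case True
    define n where "n = (LEAST n. X n \<in> A)"
    have n: "X n \<in> A" unfolding n_def using True by (rule LeastI_ex)
    have n': "X m \<notin> A" if "m < n" for m using not_less_Least that unfolding n_def by blast
    have "first_hit_at A j X \<longleftrightarrow> X n = j"
      unfolding first_hit_at_def using n n' by (metis linorder_neqE_nat)
    moreover have "hitting_time r k A \<omega> = ereal (J n)" using True by (simp add: hit n_def)
    moreover have "hitting_time r k {j} \<omega> = ereal (J n) \<longleftrightarrow> X n = j"
    proof
      assume "X n = j"
      have "(LEAST n. X n \<in> {j}) = n"
      proof (rule Least_equality)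
        show "X n \<in> {j}" using \<open>X n = j\<close> by simp
        show "n \<le> m" if "X m \<in> {j}" for m
          using n'[of m] that \<open>j \<in> A\<close> by (auto simp: not_less[symmetric])
      qed
      then show "hitting_time r k {j} \<omega> = ereal (J n)" using \<open>X n = j\<close> by (auto simp: hit)
    next
      assume eq: "hitting_time r k {j} \<omega> = ereal (J n)"
      then have ex: "\<exists>n. X n \<in> {j}" by (auto simp: hit split: if_splits)
      then have "J (LEAST n. X n \<in> {j}) = J n" using eq by (simp add: hit)
      then have "(LEAST n. X n \<in> {j}) = n" using J by (simp add: strict_mono_eq)
      with LeastI_ex[OF ex] show "X n = j" by simp
    qed
    ultimately show ?thesis by auto
  qed
  then show ?thesis by (simp add: X_def)
qed

lemma AE_hitting_time_eq_iff:
  assumes "\<And>i. 0 < exit_rate r i" "j \<in> A"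
  shows "AE \<omega> in walk_space r.
    hitting_time r k A \<omega> = hitting_time r k {j} \<omega> \<longleftrightarrow> first_hit_at A j (jump_chain k \<omega>)"
  using AE_holding_pos AE_holding_gt_one
  by eventually_elim (use hitting_time_eq_iff[OF assms(1) _ _ assms(2)] in blast)

lemma measure_hitting_time_eq:
  assumes "\<And>i. 0 < exit_rate r i" "j \<in> A"
  shows "\<P>(\<omega> in walk_space r. hitting_time r k A \<omega> = hitting_time r k {j} \<omega>)
    = \<P>(\<omega> in walk_space r. first_hit_at A j (jump_chain k \<omega>))"
proof (rule measure_eq_AE)
  show "AE \<omega> in walk_space r.
    (\<omega> \<in> {\<omega> \<in> space (walk_space r). hitting_time r k A \<omega> = hitting_time r k {j} \<omega>}) =
    (\<omega> \<in> {\<omega> \<in> space (walk_space r). first_hit_at A j (jump_chain k \<omega>)})"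
    using AE_hitting_time_eq_iff[OF assms] by eventually_elim auto
  show "{\<omega> \<in> space (walk_space r). hitting_time r k A \<omega> = hitting_time r k {j} \<omega>} \<in> sets (walk_space r)"
    using measurable_hitting_time by (intro borel_measurable_eq) auto
  show "{\<omega> \<in> space (walk_space r). first_hit_at A j (jump_chain k \<omega>)} \<in> sets (walk_space r)"
    using measurable_first_hit_at by (rule predE)
qed

section \<open>First-step analysis and the trace drift in terms of harmonic functions\<close>

lemma jump_chain_Cons: "jump_chain k (case_nat s \<omega>) (Suc n) = jump_chain (fst s k) \<omega> n"
  by (induction n) auto

lemma first_hit_at_Cons:
  assumes "k \<notin> A"
  shows "first_hit_at A j (jump_chain k (case_nat s \<omega>)) \<longleftrightarrow> first_hit_at A j (jump_chain (fst s k) \<omega>)"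
    (is "?l \<longleftrightarrow> ?r")
proof
  assume l: ?l
  show ?r unfolding first_hit_at_def
  proof (intro allI impI)
    fix n assume n: "jump_chain (fst s k) \<omega> n \<in> A \<and> (\<forall>m<n. jump_chain (fst s k) \<omega> m \<notin> A)"
    have "jump_chain k (case_nat s \<omega>) m \<notin> A" if "m < Suc n" for m
    proof (cases m)
      case 0
      then show ?thesis using \<open>k \<notin> A\<close> by simp
    next
      case (Suc m')
      then show ?thesis using n that unfolding Suc jump_chain_Cons by simp
    qed
    with l n show "jump_chain (fst s k) \<omega> n = j"
      unfolding first_hit_at_def by (metis jump_chain_Cons)
  qed
next
  assume r: ?r
  show ?l unfolding first_hit_at_def
  proof (intro allI impI)
    fix n assume n: "jump_chain k (case_nat s \<omega>) n \<in> A \<and> (\<forall>m<n. jump_chain k (case_nat s \<omega>) m \<notin> A)"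
    with \<open>k \<notin> A\<close> obtain n' where n': "n = Suc n'" by (cases n) auto
    with n have "jump_chain (fst s k) \<omega> n' \<in> A \<and> (\<forall>m<n'. jump_chain (fst s k) \<omega> m \<notin> A)"
      by (metis Suc_less_eq jump_chain_Cons)
    with r show "jump_chain k (case_nat s \<omega>) n = j"
      unfolding first_hit_at_def n' jump_chain_Cons by blast
  qed
qed

lemma first_hit_at_start:
  assumes "k \<in> A"
  shows "first_hit_at A j (jump_chain k \<omega>) \<longleftrightarrow> k = j"
  unfolding first_hit_at_def using assms by (metis jump_chain.simps(1) neq0_conv not_less_zero)

lemma pmf_jump_pmf:
  assumes "\<And>j. 0 \<le> r i j" "0 < exit_rate r i"
  shows "pmf (jump_pmf r i) j = jump_prob r i j"
proof -
  have "(\<integral>\<^sup>+ x. ennreal (jump_prob r i x) \<partial>count_space UNIV) = ennreal (\<Sum>x\<in>UNIV. jump_prob r i x)"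
    using assms by (simp add: nn_integral_count_space_finite sum_ennreal jump_prob_def)
  also have "(\<Sum>x\<in>UNIV. jump_prob r i x) = 1"
    using assms by (simp add: jump_prob_def sum_divide_distrib[symmetric] exit_rate_def)
  finally show ?thesis
    unfolding jump_pmf_def using assms by (simp add: jump_prob_def pmf_embed_pmf)
qed

lemma prob_jump_target:
  "measure (step_law r) {s \<in> space (step_law r). fst s k = l} = pmf (jump_pmf r k) l"
proof -
  let ?E = "density lborel (\<lambda>x. ennreal (exponential_density 1 x))"
  let ?P = "measure_pmf (Pi_pmf UNIV undefined (jump_pmf r))"
  interpret E: prob_space ?E by (rule prob_space_exponential)
  have "{s \<in> space (step_law r). fst s k = l} = {f. f k = l} \<times> UNIV"
    by (auto simp: step_law_def space_pair_measure)
  moreover have "emeasure ?E UNIV = 1" using E.emeasure_space_1 by simp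
  ultimately have "emeasure (step_law r) {s \<in> space (step_law r). fst s k = l} = emeasure ?P {f. f k = l}"
    by (simp add: step_law_def E.emeasure_pair_measure_Times)
  then have "measure (step_law r) {s \<in> space (step_law r). fst s k = l} = measure ?P {f. f k = l}"
    by (simp add: measure_def)
  also have "\<dots> = pmf (map_pmf (\<lambda>f. f k) (Pi_pmf UNIV undefined (jump_pmf r))) l"
    by (simp add: pmf_map vimage_def)
  also have "\<dots> = pmf (jump_pmf r k) l" by (simp add: Pi_pmf_component)
  finally show ?thesis .
qed

text \<open>Splitting off the first coordinate of the sample sequence leaves an independent copy of
  the whole sequence. Since k is not in A, the event sees that coordinate only through the target it
  chooses for k.\<close>

lemma first_step_analysis:
  assumes "k \<notin> A"
  shows "\<P>(\<omega> in walk_space r. first_hit_at A j (jump_chain k \<omega>))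
    = (\<Sum>l\<in>UNIV. pmf (jump_pmf r k) l *
        \<P>(\<omega> in walk_space r. first_hit_at A j (jump_chain l \<omega>)))"
proof -
  let ?W = "walk_space r" and ?M = "step_law r"
  define G where "G l = {\<omega> \<in> space ?W. first_hit_at A j (jump_chain l \<omega>)}" for l
  define D where "D l = {s \<in> space ?M. fst s k = l}" for l
  have G: "G l \<in> sets ?W" for l unfolding G_def using measurable_first_hit_at by (rule predE)
  have D: "D l \<in> sets ?M" for l
    using measurable_sets[OF measurable_jump_target, of "{l}" k r]
    by (simp add: D_def vimage_def Int_def conj_commute)
  interpret W: prob_space ?W unfolding walk_space_eq by (rule walk_space.P.prob_space_axioms)
  interpret MW: pair_prob_space ?M ?W
    by (simp add: pair_prob_space_def pair_sigma_finite_def walk_space.M.prob_space_axioms W.prob_space_axioms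
        prob_space_imp_sigma_finite)
  have W: "distr (?M \<Otimes>\<^sub>M ?W) ?W (\<lambda>(s, \<omega>). case_nat s \<omega>) = ?W"
    unfolding walk_space_eq by (rule walk_space.PiM_iter)
  have m: "(\<lambda>(s, \<omega>). case_nat s \<omega>) \<in> ?M \<Otimes>\<^sub>M ?W \<rightarrow>\<^sub>M ?W"
    unfolding walk_space_eq by (simp add: split_beta')
  have "measure ?W (G k) = measure (?M \<Otimes>\<^sub>M ?W) ((\<lambda>(s, \<omega>). case_nat s \<omega>) -` G k \<inter> space (?M \<Otimes>\<^sub>M ?W))"
    by (subst W[symmetric]) (rule measure_distr[OF m G])
  also have "(\<lambda>(s, \<omega>). case_nat s \<omega>) -` G k \<inter> space (?M \<Otimes>\<^sub>M ?W) = (\<Union>l\<in>UNIV. D l \<times> G l)"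
    using measurable_space[OF m]
    by (auto simp: G_def D_def space_pair_measure first_hit_at_Cons[OF assms])
  also have "measure (?M \<Otimes>\<^sub>M ?W) \<dots> = (\<Sum>l\<in>UNIV. measure (?M \<Otimes>\<^sub>M ?W) (D l \<times> G l))"
    by (intro MW.P.finite_measure_finite_Union) (auto simp: disjoint_family_on_def D_def intro: D G)
  also have "\<dots> = (\<Sum>l\<in>UNIV. measure ?M (D l) * measure ?W (G l))"
    by (intro sum.cong refl) (simp add: measure_def W.emeasure_pair_measure_Times D G enn2real_mult)
  finally show ?thesis by (simp add: G_def D_def prob_jump_target)
qed


context irreducible_walk
begin

text \<open>A nonempty set and a point outside it witness that V has two states; irreducibility then
  provides a way out of every state i.\<close>

lemma exit_rate_pos:
  fixes A :: "'v set"
  assumes "A \<noteq> {}" "k \<notin> A"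
  shows "0 < exit_rate r i"
proof -
  have "{i} \<noteq> UNIV"
  proof
    assume "{i} = UNIV"
    then have all: "x = i" for x by (metis UNIV_I singletonD)
    obtain a where "a \<in> A" using assms(1) by blast
    with assms(2) all[of a] all[of k] show False by simp
  qed
  then obtain j where "0 < r i j" using rate_across_cut[of "{i}"] by auto
  also have "r i j \<le> exit_rate r i" unfolding exit_rate_def
    by (rule member_le_sum) (auto simp: rate_nonneg)
  finally show ?thesis .
qed

text \<open>The values on A are set by hand to the boundary data of a Dirichlet problem, so that
  \<open>gen\<close> can act across A; off A they are the probabilities in
  \<open>trace_rate\<close>.\<close>

definition hit_prob :: "'v set \<Rightarrow> 'v \<Rightarrow> 'v \<Rightarrow> real" where
  "hit_prob A j k = (if k \<in> A then of_bool (k = j) else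
     \<P>(\<omega> in walk_space r. hitting_time r k A \<omega> = hitting_time r k {j} \<omega>))"

lemma gen_hit_prob:
  assumes "j \<in> A" "k \<notin> A"
  shows "gen r (hit_prob A j) k = 0"
proof -
  have "A \<noteq> {}" using assms by auto
  note rate = exit_rate_pos[OF this assms(2)]
  define h where "h l = \<P>(\<omega> in walk_space r. first_hit_at A j (jump_chain l \<omega>))" for l
  interpret W: prob_space "walk_space r" unfolding walk_space_eq by (rule walk_space.P.prob_space_axioms)
  have h: "hit_prob A j l = h l" for l
  proof (cases "l \<in> A")
    case True
    then show ?thesis by (simp add: hit_prob_def h_def first_hit_at_start W.prob_space)
  next
    case False
    then show ?thesis by (simp add: hit_prob_def h_def measure_hitting_time_eq[OF rate assms(1)])
  qed
  have "h k = (\<Sum>l\<in>UNIV. jump_prob r k l * h l)"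
    using first_step_analysis[OF assms(2), of r j] unfolding h_def
    by (simp add: pmf_jump_pmf rate_nonneg rate)
  then have "exit_rate r k * h k = (\<Sum>l\<in>UNIV. exit_rate r k * (jump_prob r k l * h l))"
    by (simp add: sum_distrib_left[symmetric])
  also have "\<dots> = (\<Sum>l\<in>UNIV. r k l * h l)"
    using rate[of k] by (intro sum.cong refl) (simp add: jump_prob_def)
  finally show ?thesis
    by (simp add: gen_def h right_diff_distrib sum_subtractf exit_rate_def sum_distrib_right)
qed

text \<open>Paths that never meet A belong to all of the equality events, so these are not visibly a
  partition; the identity comes from uniqueness for the Dirichlet problem with boundary value
  1.\<close>

lemma sum_hit_prob:
  assumes "A \<noteq> {}"
  shows "(\<Sum>j\<in>A. hit_prob A j k) = 1"
proof (rule gen_boundary_unique[OF assms, of "\<lambda>k. \<Sum>j\<in>A. hit_prob A j k" "\<lambda>_. 1"])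
  show "(\<Sum>j\<in>A. hit_prob A j i) = 1" if "i \<in> A" for i
    using that by (simp add: hit_prob_def of_bool_def)
  show "gen r (\<lambda>k. \<Sum>j\<in>A. hit_prob A j k) i = gen r (\<lambda>_. 1) i" if "i \<notin> A" for i
    using that by (simp add: gen_sum gen_hit_prob)
qed

lemma trace_rate_eq:
  assumes "i \<in> A" "j \<in> A" "i \<noteq> j"
  shows "trace_rate r A i j = gen r (hit_prob A j) i"
proof -
  have "gen r (hit_prob A j) i = (\<Sum>k\<in>UNIV. r i k * hit_prob A j k)"
    using assms by (simp add: gen_def hit_prob_def)
  also have "\<dots> = (\<Sum>k\<in>A. r i k * hit_prob A j k) + (\<Sum>k\<in>-A. r i k * hit_prob A j k)"
    by (subst sum.union_disjoint[symmetric]) (auto simp: Un_commute)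
  also have "(\<Sum>k\<in>A. r i k * hit_prob A j k) = (\<Sum>k\<in>A. if k = j then r i j else 0)"
    by (intro sum.cong) (auto simp: hit_prob_def)
  also have "\<dots> = r i j" using assms by simp
  also have "(\<Sum>k\<in>-A. r i k * hit_prob A j k) = (\<Sum>k\<in>-A. r i k * \<P>(\<omega> in walk_space r. hitting_time r k A \<omega> = hitting_time r k {j} \<omega>))"
    by (intro sum.cong) (auto simp: hit_prob_def)
  finally show ?thesis using assms by (simp add: trace_rate_def)
qed

text \<open>With h the hitting probability of i, the outgoing trace rates at i sum to - (L h)(i)
  because hitting probabilities sum to 1, so the trace drift is the sum of L h over A. Weights equal
  to the profile extend this sum to V, since L h = 0 off A; duality then moves L onto the profile,
  where only the term i survives.\<close>

lemma trace_drift_eq_adj_trace_profile: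
  assumes "i \<in> A"
  shows "trace_drift r A i = adj r (trace_profile A) i"
proof -
  have "A \<noteq> {}" using assms by auto
  have diag: "trace_rate r A i i = 0" by (simp add: trace_rate_def)
  have "(\<Sum>j\<in>A. trace_rate r A i j) = (\<Sum>j\<in>A-{i}. trace_rate r A i j)"
    using assms by (simp add: diag sum.remove[of A i])
  also have "\<dots> = (\<Sum>j\<in>A-{i}. gen r (hit_prob A j) i)"
    using assms by (intro sum.cong refl trace_rate_eq) auto
  also have "\<dots> = gen r (\<lambda>k. \<Sum>j\<in>A. hit_prob A j k) i - gen r (hit_prob A i) i"
    using assms by (simp add: gen_sum) (simp add: sum.remove[of A i])
  also have "\<dots> = - gen r (hit_prob A i) i"
    by (simp add: sum_hit_prob[OF \<open>A \<noteq> {}\<close>])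
  finally have out: "(\<Sum>j\<in>A. trace_rate r A i j) = - gen r (hit_prob A i) i" .
  have "(\<Sum>j\<in>A. trace_rate r A j i) = (\<Sum>j\<in>A-{i}. trace_rate r A j i)"
    using assms by (simp add: diag sum.remove[of A i])
  also have "\<dots> = (\<Sum>j\<in>A-{i}. gen r (hit_prob A i) j)"
    using assms by (intro sum.cong refl trace_rate_eq) auto
  finally have "trace_drift r A i = (\<Sum>j\<in>A-{i}. gen r (hit_prob A i) j) + gen r (hit_prob A i) i"
    by (simp add: trace_drift_def sum_subtractf out)
  also have "\<dots> = (\<Sum>j\<in>A. gen r (hit_prob A i) j)"
    using assms by (simp add: sum.remove[of A i])
  also have "\<dots> = (\<Sum>j\<in>UNIV. trace_profile A j * gen r (hit_prob A i) j)"
    using assms \<open>A \<noteq> {}\<close> by (intro sum.mono_neutral_cong_left) (auto simp: trace_profile_on gen_hit_prob)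
  also have "\<dots> = (\<Sum>j\<in>UNIV. adj r (trace_profile A) j * hit_prob A i j)" by (rule sum_mult_gen)
  also have "\<dots> = (\<Sum>j\<in>UNIV. if j = i then adj r (trace_profile A) i else 0)"
    using assms \<open>A \<noteq> {}\<close> by (intro sum.cong) (auto simp: adj_trace_profile_off hit_prob_def)
  finally show ?thesis by simp
qed

end

section \<open>Absorbing sets and the obstacle problem\<close>

context irreducible_walk
begin

text \<open>Adding j to A changes the profile by a function d that vanishes on A and is balanced off
  A and j. At j, d is 1 - a(j) and L* d is the trace drift in question; by the maximum principle the
  two have opposite signs.\<close>

lemma absorbing_iff_trace_profile_le:
  assumes "A \<noteq> {}"
  shows "absorbing r A \<longleftrightarrow> (\<forall>i. trace_profile A i \<le> 1)"
proof -
  have "trace_drift r (A \<union> {j}) j \<le> 0 \<longleftrightarrow> trace_profile A j \<le> 1" if "j \<notin> A" for j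
  proof -
    define d where "d i = trace_profile (A \<union> {j}) i - trace_profile A i" for i
    have d_on: "d i = 0" if "i \<in> A" for i using that assms by (simp add: d_def trace_profile_on)
    have d_j: "d j = 1 - trace_profile A j" by (simp add: d_def trace_profile_on)
    have adj_d: "adj r d i = 0" if "i \<notin> A" "i \<noteq> j" for i
      using that assms unfolding d_def by (simp add: adj_diff adj_trace_profile_off)
    have adj_dj: "adj r d j = trace_drift r (A \<union> {j}) j"
      using \<open>j \<notin> A\<close> assms unfolding d_def by (simp add: adj_diff adj_trace_profile_off trace_drift_eq_adj_trace_profile)
    show ?thesis
    proof
      assume "trace_drift r (A \<union> {j}) j \<le> 0"
      then have adj_d': "adj r d i \<le> 0" if "i \<notin> A" for i
        using adj_d[of i] adj_dj that by (cases "i = j") auto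
      have "- d j \<le> 0"
        by (rule adj_max_principle[of "-A" "\<lambda>i. - d i"])
          (use assms d_on adj_d' adj_dj in \<open>auto simp: adj_uminus\<close>)
      then show "trace_profile A j \<le> 1" using d_j by simp
    next
      assume le: "trace_profile A j \<le> 1"
      show "trace_drift r (A \<union> {j}) j \<le> 0"
      proof (rule ccontr)
        assume "\<not> ?thesis"
        then have pos: "0 < adj r d j" using adj_dj by simp
        then have adj_d': "0 \<le> adj r d i" if "i \<notin> A" for i
          using adj_d[of i] that by (cases "i = j") auto
        have "d j \<le> 0"
          by (rule adj_max_principle[of "-A" d]) (use assms d_on adj_d' in auto)
        then have "d j = 0" using d_j le by linarith
        have "d i = 0" for i
          by (rule adj_boundary_unique[of "A \<union> {j}" d "\<lambda>_. 0"]) (use \<open>d j = 0\<close> d_on adj_d in auto)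
        then have "d = (\<lambda>_. 0)" by auto
        then show False using pos by simp
      qed
    qed
  qed
  then have "(\<forall>j\<in>-A. trace_drift r (A \<union> {j}) j \<le> 0) \<longleftrightarrow> (\<forall>j\<in>-A. trace_profile A j \<le> 1)" by simp
  moreover have "trace_profile A i \<le> 1" if "i \<in> A" for i using trace_profile_on[OF assms that] by simp
  ultimately show ?thesis unfolding absorbing_def by (cases "A = UNIV") (simp_all, blast)
qed

text \<open>Maximum principle for the difference. It turns any such m into a certificate: if m is at
  most 1 everywhere, A is absorbing.\<close>

lemma trace_profile_le_superharmonic:
  assumes "A \<noteq> {}" "\<And>i. i \<in> A \<Longrightarrow> 1 \<le> m i" "\<And>i. i \<notin> A \<Longrightarrow> adj r m i \<le> 0"
  shows "trace_profile A i \<le> m i"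
proof -
  have "trace_profile A i - m i \<le> 0"
    by (rule adj_max_principle[of "-A" "\<lambda>i. trace_profile A i - m i"])
      (use assms in \<open>auto simp: adj_diff adj_trace_profile_off trace_profile_on\<close>)
  then show ?thesis by simp
qed

text \<open>The value at i enters L* with nonpositive weight and all others with nonnegative ones,
  so touching from below at i orders L* there.\<close>

lemma adj_min_le:
  assumes "m i = y i" "\<And>j. m j \<le> y j"
  shows "adj r m i \<le> adj r y i"
  unfolding adj_def using assms by (intro sum_mono) (simp add: mult_left_mono rate_nonneg)

text \<open>Superharmonicity for L* survives minima, so the minimum of the two profiles is a
  certificate for the intersection.\<close>

lemma absorbing_Int:
  assumes "absorbing r A" "absorbing r B" "A \<inter> B \<noteq> {}"
  shows "absorbing r (A \<inter> B)"
proof -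
  have ne: "A \<noteq> {}" "B \<noteq> {}" using assms(3) by auto
  have A: "trace_profile A i \<le> 1" and B: "trace_profile B i \<le> 1" for i
    using assms(1,2) absorbing_iff_trace_profile_le[OF ne(1)] absorbing_iff_trace_profile_le[OF ne(2)] by blast+
  define m where "m i = min (trace_profile A i) (trace_profile B i)" for i
  have "trace_profile (A \<inter> B) i \<le> m i" for i
  proof (rule trace_profile_le_superharmonic[OF assms(3)])
    show "1 \<le> m i" if "i \<in> A \<inter> B" for i
      using that ne by (simp add: m_def trace_profile_on)
    show "adj r m i \<le> 0" if "i \<notin> A \<inter> B" for i
    \<comment> \<open>The comparison at i needs a profile that attains the minimum at i and whose
      set omits i. If i lies in B, the profile of B is 1 there, and the bound by 1 makes that of A
      minimal.\<close>
    proof (cases "i \<notin> A \<and> (trace_profile A i \<le> trace_profile B i \<or> i \<in> B)")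
      case True
      then have "m i = trace_profile A i" using trace_profile_on[OF ne(2), of i] A[of i] by (auto simp: m_def)
      then have "adj r m i \<le> adj r (trace_profile A) i" by (intro adj_min_le) (auto simp: m_def)
      then show ?thesis using True adj_trace_profile_off[OF ne(1)] by simp
    next
      case False
      then have "i \<notin> B" "m i = trace_profile B i"
        using that trace_profile_on[OF ne(1), of i] B[of i] by (auto simp: m_def)
      moreover from this have "adj r m i \<le> adj r (trace_profile B) i" by (intro adj_min_le) (auto simp: m_def)
      ultimately show ?thesis using adj_trace_profile_off[OF ne(2)] by simp
    qed
  qed
  then have "trace_profile (A \<inter> B) i \<le> 1" for i
    using order_trans[of "trace_profile (A \<inter> B) i" "m i" 1] A[of i] by (simp add: m_def min_def split: if_splits)
  then show ?thesis by (simp add: absorbing_iff_trace_profile_le[OF assms(3)])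
qed

lemma absorbing_UNIV: "absorbing r UNIV"
  by (simp add: absorbing_def)

lemma absorbing_Inter:
  assumes "finite F" "S \<noteq> {}" "\<And>A. A \<in> F \<Longrightarrow> absorbing r A \<and> S \<subseteq> A"
  shows "absorbing r (\<Inter>F)"
proof -
  have "absorbing r (\<Inter>F) \<and> S \<subseteq> \<Inter>F"
    using assms(1,3)
  proof (induction F rule: finite_induct)
    case (insert A F)
    then have "absorbing r A" "absorbing r (\<Inter>F)" "S \<subseteq> A \<inter> \<Inter>F" by auto
    moreover from this have "A \<inter> \<Inter>F \<noteq> {}" using \<open>S \<noteq> {}\<close> by blast
    ultimately show ?case using absorbing_Int by simp
  qed (simp add: absorbing_UNIV)
  then show ?thesis ..
qed

lemma
  assumes "S \<noteq> {}"
  shows absorbing_absorbing_hull: "absorbing r (absorbing_hull r S)"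
    and absorbing_hull_superset: "S \<subseteq> absorbing_hull r S"
    and absorbing_hull_least: "absorbing r A \<Longrightarrow> S \<subseteq> A \<Longrightarrow> absorbing_hull r S \<subseteq> A"
proof -
  show "absorbing r (absorbing_hull r S)"
    unfolding absorbing_hull_def by (rule absorbing_Inter[OF _ assms]) auto
qed (auto simp: absorbing_hull_def)

lemma absorbing_hull_absorbing:
  assumes "S \<noteq> {}" "absorbing r S"
  shows "absorbing_hull r S = S"
  using absorbing_hull_superset[OF assms(1)] absorbing_hull_least[OF assms order_refl] by simp

text \<open>The profile of A remains a certificate for the smaller set, because L* of it is
  nonpositive at the points removed.\<close>

lemma absorbing_Diff:
  assumes "absorbing r A" "A - I \<noteq> {}" "\<And>i. i \<in> A \<inter> I \<Longrightarrow> adj r (trace_profile A) i \<le> 0"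
  shows "absorbing r (A - I)"
proof -
  have "A \<noteq> {}" using assms(2) by auto
  have "trace_profile (A - I) i \<le> trace_profile A i" for i
  proof (rule trace_profile_le_superharmonic[OF assms(2)])
    show "1 \<le> trace_profile A i" if "i \<in> A - I" for i using that by (simp add: trace_profile_on[OF \<open>A \<noteq> {}\<close>])
    show "adj r (trace_profile A) i \<le> 0" if "i \<notin> A - I" for i
      using that assms(3) adj_trace_profile_off[OF \<open>A \<noteq> {}\<close>] by (cases "i \<in> A") auto
  qed
  moreover have "trace_profile A i \<le> 1" for i
    using assms(1) absorbing_iff_trace_profile_le[OF \<open>A \<noteq> {}\<close>] by blast
  ultimately have "trace_profile (A - I) i \<le> 1" for i by (meson order_trans)
  then show ?thesis by (simp add: absorbing_iff_trace_profile_le[OF assms(2)])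
qed

text \<open>Otherwise \<open>absorbing_Diff\<close> removes i and leaves a smaller absorbing set
  around S. The strict sign makes coordinates of the hull that start at 0 positive at once.\<close>

lemma adj_trace_profile_hull_pos:
  assumes "S \<noteq> {}" "i \<in> absorbing_hull r S" "i \<notin> S"
  shows "0 < adj r (trace_profile (absorbing_hull r S)) i"
proof (rule ccontr)
  let ?A = "absorbing_hull r S"
  assume "\<not> ?thesis"
  then have le: "adj r (trace_profile ?A) i \<le> 0" by simp
  have "?A - {i} \<noteq> {}" using assms absorbing_hull_superset[OF assms(1)] by blast
  then have "absorbing r (?A - {i})"
    by (rule absorbing_Diff[OF absorbing_absorbing_hull[OF assms(1)]]) (use le in auto)
  then have "?A \<subseteq> ?A - {i}"
    by (rule absorbing_hull_least[OF assms(1)]) (use absorbing_hull_superset[OF assms(1)] assms in auto)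
  with assms show False by blast
qed

text \<open>The discrete obstacle problem that determines the reflected drift from the support of
  the current position.\<close>
definition obstacle :: "'v set \<Rightarrow> ('v \<Rightarrow> real) \<Rightarrow> bool" where
  "obstacle S a \<longleftrightarrow> (\<forall>i\<in>S. a i = 1) \<and> (\<forall>i. a i \<le> 1) \<and> (\<forall>i\<in>-S. 0 \<le> adj r a i) \<and>
     (\<forall>i. a i < 1 \<longrightarrow> adj r a i = 0)"

text \<open>Compare on {a < 1}, where L* a = 0; elsewhere a = 1 \<ge> m. Nonempty S keeps that set
  from being all of V. So a is the largest competitor, which yields uniqueness and also bounds for
  functions only known to be subsolutions.\<close>

lemma obstacle_greatest:
  assumes "S \<noteq> {}" "obstacle S a" "\<And>i. m i \<le> 1" "\<And>i. i \<notin> S \<Longrightarrow> 0 \<le> adj r m i"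
  shows "m i \<le> a i"
proof -
  have "m i - a i \<le> 0"
  proof (rule adj_max_principle[of "{i. a i < 1}" "\<lambda>i. m i - a i"])
    obtain s where "s \<in> S" using assms(1) by blast
    then have "a s = 1" using assms(2) by (simp add: obstacle_def)
    then have "s \<notin> {i. a i < 1}" by simp
    then show "{i. a i < 1} \<noteq> UNIV" by blast
    show "m i - a i \<le> 0" if "i \<notin> {i. a i < 1}" for i
      using that assms(3)[of i] by simp
    show "0 \<le> adj r (\<lambda>i. m i - a i) i" if "i \<in> {i. a i < 1}" for i
    proof -
      have "adj r a i = 0" "i \<notin> S" using that assms(2) by (auto simp: obstacle_def)
      then show ?thesis using assms(4)[of i] by (simp add: adj_diff)
    qed
  qed
  then show ?thesis by simp
qed

lemma obstacle_unique:
  assumes "S \<noteq> {}" "obstacle S a" "obstacle S b"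
  shows "a = b"
proof (rule ext, rule antisym)
  show "a i \<le> b i" for i
    by (rule obstacle_greatest[OF assms(1,3)]) (use assms(2) in \<open>auto simp: obstacle_def\<close>)
  show "b i \<le> a i" for i
    by (rule obstacle_greatest[OF assms(1,2)]) (use assms(3) in \<open>auto simp: obstacle_def\<close>)
qed

definition hull_profile :: "'v set \<Rightarrow> 'v \<Rightarrow> real" where
  "hull_profile S = trace_profile (absorbing_hull r S)"

text \<open>The profile is below 1 only off the hull, where it is balanced. Minimality of the hull
  gives the sign of L* on the hull minus S, and its absorption gives the bound by 1.\<close>

lemma obstacle_hull_profile:
  assumes "S \<noteq> {}"
  shows "obstacle S (hull_profile S)"
proof -
  let ?A = "absorbing_hull r S"
  have ne: "?A \<noteq> {}" and sub: "S \<subseteq> ?A" using absorbing_hull_superset[OF assms] assms by auto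
  have "adj r (trace_profile ?A) i = 0" if "trace_profile ?A i < 1" for i
    using that trace_profile_on[OF ne, of i] adj_trace_profile_off[OF ne, of i] by (cases "i \<in> ?A") auto
  moreover have "0 \<le> adj r (trace_profile ?A) i" if "i \<notin> S" for i
    using adj_trace_profile_hull_pos[OF assms _ that] adj_trace_profile_off[OF ne, of i]
    by (cases "i \<in> ?A") auto
  ultimately show ?thesis
    using absorbing_absorbing_hull[OF assms] ne sub
    unfolding obstacle_def hull_profile_def
    by (metis ComplD absorbing_iff_trace_profile_le trace_profile_on subsetD)
qed

lemma simplex_supp_nonempty:
  fixes v :: "real ^ 'v"
  assumes "v \<in> prob_simplex"
  shows "supp v \<noteq> {}"
proof
  assume "supp v = {}"
  then have "v $ i = 0" for i using assms by (auto simp: supp_def prob_simplex_def not_less intro: antisym)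
  then show False using assms by (simp add: prob_simplex_def)
qed

lemma local_drift_nth:
  assumes "supp v \<noteq> {}"
  shows "local_drift r v $ i = adj r (hull_profile (supp v)) i"
proof -
  have "absorbing_hull r (supp v) \<noteq> {}" using absorbing_hull_superset[OF assms] assms by auto
  then show ?thesis
    by (auto simp: local_drift_def hull_profile_def trace_drift_eq_adj_trace_profile adj_trace_profile_off)
qed

lemma local_drift_off_hull:
  "i \<notin> absorbing_hull r (supp v) \<Longrightarrow> local_drift r v $ i = 0"
  by (simp add: local_drift_def)

lemma local_drift_pos:
  assumes "supp v \<noteq> {}" "i \<in> absorbing_hull r (supp v)" "i \<notin> supp v"
  shows "0 < local_drift r v $ i"
  using assms by (simp add: local_drift_nth adj_trace_profile_hull_pos hull_profile_def)

lemma sum_local_drift: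
  assumes "supp v \<noteq> {}"
  shows "(\<Sum>i\<in>UNIV. local_drift r v $ i) = 0"
  by (simp add: local_drift_nth[OF assms] sum_adj)

lemma local_drift_cong:
  "absorbing_hull r (supp v) = absorbing_hull r (supp w) \<Longrightarrow> local_drift r v = local_drift r w"
  by (simp only: local_drift_def)

end

section \<open>The piecewise linear path\<close>

text \<open>Real induction: were P to fail somewhere, the infimum of the failures would satisfy P by
  \<open>base\<close> or \<open>closed\<close>, and \<open>right\<close> would push that infimum
  further to the right.\<close>

lemma right_local_induct:
  fixes a t :: real
  assumes "a \<le> t" and base: "P a"
    and closed: "\<And>t. a < t \<Longrightarrow> (\<And>s. a \<le> s \<Longrightarrow> s < t \<Longrightarrow> P s) \<Longrightarrow> P t"
    and right: "\<And>t. a \<le> t \<Longrightarrow> P t \<Longrightarrow> \<exists>e>0. \<forall>s. t < s \<and> s < t + e \<longrightarrow> P s"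
  shows "P t"
proof (rule ccontr)
  assume "\<not> P t"
  define T where "T = {s. a \<le> s \<and> \<not> P s}"
  have "t \<in> T" using \<open>\<not> P t\<close> \<open>a \<le> t\<close> by (simp add: T_def)
  have bdd: "bdd_below T" by (auto simp: T_def bdd_below_def)
  define i where "i = Inf T"
  have "a \<le> i" unfolding i_def using \<open>t \<in> T\<close> by (intro cInf_greatest) (auto simp: T_def)
  have below: "P s" if "a \<le> s" "s < i" for s
    using cInf_lower[OF _ bdd, of s] that unfolding i_def T_def by (auto simp: not_le[symmetric])
  have "P i"
  proof (cases "a = i")
    case True
    with base show ?thesis by simp
  next
    case False
    then show ?thesis using \<open>a \<le> i\<close> below closed[of i] by simp
  qed
  then obtain e where e: "0 < e" "\<And>s. i < s \<Longrightarrow> s < i + e \<Longrightarrow> P s"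
    using right[OF \<open>a \<le> i\<close>] by blast
  have "i + e \<le> s" if "s \<in> T" for s
  proof (rule ccontr)
    assume "\<not> i + e \<le> s"
    moreover have "i \<le> s" unfolding i_def using that bdd by (rule cInf_lower)
    ultimately have "P s" using e(2)[of s] \<open>P i\<close> by (cases "s = i") auto
    with that show False by (simp add: T_def)
  qed
  then have "i + e \<le> Inf T" using \<open>t \<in> T\<close> by (intro cInf_greatest) auto
  with e(1) show False by (simp add: i_def)
qed

text \<open>Continuity supplies the closedness step of \<open>right_local_induct\<close>; the
  uniqueness statements for paths all rest on this.\<close>

lemma eq_of_right_local_eq:
  fixes f g :: "real \<Rightarrow> 'a::t2_space"
  assumes "continuous_on {a..} f" "continuous_on {a..} g" "f a = g a" "a \<le> t"
    and right: "\<And>t. a \<le> t \<Longrightarrow> f t = g t \<Longrightarrow> \<exists>e>0. \<forall>s. t < s \<and> s < t + e \<longrightarrow> f s = g s"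
  shows "f t = g t"
  using \<open>a \<le> t\<close>
proof (rule right_local_induct)
  fix t assume t: "a < t" and eq: "\<And>s. a \<le> s \<Longrightarrow> s < t \<Longrightarrow> f s = g s"
  let ?F = "at t within {a..<t}"
  have lim: "(f \<longlongrightarrow> f t) ?F" "(g \<longlongrightarrow> g t) ?F"
    by (rule tendsto_within_subset[of _ _ _ "{a..}"]; use assms(1,2) t in \<open>auto simp: continuous_on_def\<close>)+
  have "t islimpt {a..<t}" using t islimpt_greaterThanLessThan2[of a t]
    by (meson greaterThanLessThan_subseteq_atLeastLessThan_iff islimpt_subset order_refl)
  then have "?F \<noteq> bot" by (simp add: trivial_limit_within)
  moreover have "(g \<longlongrightarrow> f t) ?F"
    by (rule Lim_transform_eventually[OF lim(1)]) (use eq in \<open>auto simp: eventually_at_filter\<close>)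
  ultimately show "f t = g t" using lim(2) by (rule tendsto_unique)
qed (use assms(3) right in auto)

lemma prob_simplex_iff: "v \<in> prob_simplex \<longleftrightarrow> (\<forall>i. 0 \<le> v $ i) \<and> (\<Sum>i\<in>UNIV. v $ i) = 1"
proof
  assume v: "(\<forall>i. 0 \<le> v $ i) \<and> (\<Sum>i\<in>UNIV. v $ i) = 1"
  have "v $ i \<le> (\<Sum>i\<in>UNIV. v $ i)" for i
    using v by (intro member_le_sum) auto
  with v show "v \<in> prob_simplex" by (simp add: prob_simplex_def)
qed (auto simp: prob_simplex_def)

section \<open>Paths that follow the local drift\<close>

context irreducible_walk
begin

text \<open>The length \<open>e\<close> may depend on t, so this form does not exclude breakpoints
  accumulating from the left; continuity handles such times in
  \<open>eq_of_right_local_eq\<close>.\<close>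

definition follows_drift :: "real \<Rightarrow> (real \<Rightarrow> real ^ 'v) \<Rightarrow> bool" where
  "follows_drift a \<zeta> \<longleftrightarrow> continuous_on {a..} \<zeta> \<and>
     (\<forall>t\<ge>a. \<exists>e>0. \<forall>s. t \<le> s \<and> s < t + e \<longrightarrow> \<zeta> s = \<zeta> t + (s - t) *\<^sub>R local_drift r (\<zeta> t))"

lemma follows_drift_continuous: "follows_drift a \<zeta> \<Longrightarrow> continuous_on {a..} \<zeta>"
  by (simp only: follows_drift_def)

lemma follows_drift_right:
  assumes "follows_drift a \<zeta>" "a \<le> t"
  obtains e where "0 < e"
    "\<And>s. t \<le> s \<Longrightarrow> s < t + e \<Longrightarrow> \<zeta> s = \<zeta> t + (s - t) *\<^sub>R local_drift r (\<zeta> t)"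
  using assms unfolding follows_drift_def by metis

lemma follows_drift_unique:
  assumes \<zeta>: "follows_drift a \<zeta>" and \<xi>: "follows_drift a \<xi>" and "\<zeta> a = \<xi> a" "a \<le> t"
  shows "\<zeta> t = \<xi> t"
proof (rule eq_of_right_local_eq[of a])
  fix t assume t: "a \<le> t" "\<zeta> t = \<xi> t"
  obtain e where e: "0 < e"
    "\<And>s. t \<le> s \<Longrightarrow> s < t + e \<Longrightarrow> \<zeta> s = \<zeta> t + (s - t) *\<^sub>R local_drift r (\<zeta> t)"
    using follows_drift_right[OF \<zeta> t(1)] by metis
  obtain d where d: "0 < d"
    "\<And>s. t \<le> s \<Longrightarrow> s < t + d \<Longrightarrow> \<xi> s = \<xi> t + (s - t) *\<^sub>R local_drift r (\<xi> t)"
    using follows_drift_right[OF \<xi> t(1)] by metis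
  show "\<exists>e>0. \<forall>s. t < s \<and> s < t + e \<longrightarrow> \<zeta> s = \<xi> s"
  proof (intro exI[of _ "min e d"] conjI allI impI)
    show "0 < min e d" using e(1) d(1) by simp
    fix s assume s: "t < s \<and> s < t + min e d"
    have "\<zeta> s = \<zeta> t + (s - t) *\<^sub>R local_drift r (\<zeta> t)" by (rule e(2)) (use s in auto)
    also have "\<dots> = \<xi> s" unfolding t(2) by (rule d(2)[symmetric]) (use s in auto)
    finally show "\<zeta> s = \<xi> s" .
  qed
next
  show "continuous_on {a..} \<zeta>" "continuous_on {a..} \<xi>"
    using \<zeta> \<xi> by (auto intro: follows_drift_continuous)
qed (use assms(3,4) in auto)

lemma follows_drift_shift:
  assumes "follows_drift 0 \<zeta>"
  shows "follows_drift a (\<lambda>t. \<zeta> (t - a))"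
  unfolding follows_drift_def
proof (intro conjI allI impI)
  show "continuous_on {a..} (\<lambda>t. \<zeta> (t - a))"
    by (rule continuous_on_compose2[OF follows_drift_continuous[OF assms]]) (auto intro!: continuous_intros)
  fix t assume "a \<le> t"
  then obtain e where e: "0 < e" "\<And>s. t - a \<le> s \<Longrightarrow> s < t - a + e \<Longrightarrow>
      \<zeta> s = \<zeta> (t - a) + (s - (t - a)) *\<^sub>R local_drift r (\<zeta> (t - a))"
    using follows_drift_right[OF assms, of "t - a"] by (metis diff_ge_0_iff_ge)
  have "\<zeta> (s - a) = \<zeta> (t - a) + (s - t) *\<^sub>R local_drift r (\<zeta> (t - a))" if "t \<le> s" "s < t + e" for s
    using e(2)[of "s - a"] that by simp
  with e(1) show "\<exists>e>0. \<forall>s. t \<le> s \<and> s < t + e \<longrightarrow>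
      \<zeta> (s - a) = \<zeta> (t - a) + (s - t) *\<^sub>R local_drift r (\<zeta> (t - a))" by blast
qed

lemma supp_zero: "i \<notin> supp v \<Longrightarrow> v \<in> prob_simplex \<Longrightarrow> v $ i = 0"
  by (auto simp: supp_def prob_simplex_def not_less intro: antisym)

lemma local_drift_zero_absorbing:
  assumes "v \<in> prob_simplex" "local_drift r v = 0"
  shows "absorbing r (supp v)"
proof -
  note ne = simplex_supp_nonempty[OF assms(1)]
  have "absorbing_hull r (supp v) = supp v"
    using local_drift_pos[OF ne] assms(2) absorbing_hull_superset[OF ne] by fastforce
  with absorbing_absorbing_hull[OF ne] show ?thesis by simp
qed

text \<open>Coordinates off the hull stay 0, those in the hull but off the support grow at once, and
  those in the support stay positive before the exit time. A coordinate of the hull that vanishes at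
  the exit time has nonpositive drift, so \<open>absorbing_Diff\<close> applies to the new
  support.\<close>

lemma
  assumes v: "v \<in> prob_simplex" and nz: "local_drift r v \<noteq> 0"
  shows exit_time_pos: "0 < exit_time r v"
    and drift_step_simplex: "0 \<le> t \<Longrightarrow> t \<le> exit_time r v \<Longrightarrow> v + t *\<^sub>R local_drift r v \<in> prob_simplex"
    and supp_drift_step: "0 < t \<Longrightarrow> t < exit_time r v \<Longrightarrow>
      supp (v + t *\<^sub>R local_drift r v) = absorbing_hull r (supp v)"
    and supp_drift_exit: "supp (v + exit_time r v *\<^sub>R local_drift r v) \<subset> absorbing_hull r (supp v)"
    and absorbing_drift_exit: "absorbing r (supp (v + exit_time r v *\<^sub>R local_drift r v))"
proof -
  define b where "b = local_drift r v"
  define S where "S = supp v"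
  define A where "A = absorbing_hull r S"
  define T where "T = exit_time r v"
  define D where "D = {i \<in> S. b $ i < 0}"
  have ne: "S \<noteq> {}" unfolding S_def using v by (rule simplex_supp_nonempty)
  have sub: "S \<subseteq> A" unfolding A_def using ne by (rule absorbing_hull_superset)
  have b_off: "b $ i = 0" if "i \<notin> A" for i
    using that unfolding A_def S_def b_def by (rule local_drift_off_hull)
  have b_pos: "0 < b $ i" if "i \<in> A" "i \<notin> S" for i
    using that ne unfolding A_def S_def b_def by (intro local_drift_pos)
  have sum_b: "(\<Sum>i\<in>UNIV. b $ i) = 0" using ne unfolding S_def b_def by (rule sum_local_drift)
  have v0: "v $ i = 0" if "i \<notin> S" for i using that v unfolding S_def by (rule supp_zero)
  have vpos: "0 < v $ i" if "i \<in> S" for i using that by (simp add: S_def supp_def)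
  \<comment> \<open>The drift sums to zero, so a nonzero drift has a negative coordinate, and off S
    all coordinates of the drift are nonnegative.\<close>
  have "D \<noteq> {}"
  proof
    assume "D = {}"
    then have nn: "0 \<le> b $ i" for i
      using b_off[of i] b_pos[of i] by (force simp: D_def not_less)
    then have "b $ i = 0" for i using sum_b by (simp add: sum_nonneg_eq_0_iff)
    then have "b = 0" by (simp add: vec_eq_iff)
    with nz show False by (simp add: b_def)
  qed
  define R where "R = (\<lambda>i. - (v $ i) / b $ i) ` D"
  have T: "T = Min R" by (simp add: T_def exit_time_def R_def D_def S_def b_def)
  have R: "finite R" "R \<noteq> {}" using \<open>D \<noteq> {}\<close> by (auto simp: R_def)
  have "T \<in> R" unfolding T using R by (rule Min_in)
  then obtain m where m: "m \<in> D" "T = - (v $ m) / b $ m" by (auto simp: R_def)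
  show T_pos: "0 < exit_time r v"
    using m vpos[of m] unfolding T_def[symmetric] by (simp add: D_def divide_pos_neg)
  have T_le: "T \<le> - (v $ i) / b $ i" if "i \<in> D" for i
    unfolding T using R that by (intro Min_le) (auto simp: R_def)
  have nonneg: "0 \<le> v $ i + t * b $ i" if t: "0 \<le> t" "t \<le> T" for i t
  proof (cases "i \<in> D")
    case True
    then have "t \<le> - (v $ i) / b $ i" "b $ i < 0" using T_le[of i] t by (auto simp: D_def)
    then show ?thesis by (simp add: field_simps)
  next
    case False
    then have "0 \<le> b $ i" using b_off[of i] b_pos[of i] by (force simp: D_def not_less)
    moreover have "0 \<le> v $ i" using v0[of i] vpos[of i] by force
    ultimately show ?thesis using t by simp
  qed
  have simplex: "v + t *\<^sub>R b \<in> prob_simplex" if "0 \<le> t" "t \<le> T" for t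
    using nonneg[OF that] v sum_b
    by (simp add: prob_simplex_iff sum.distrib sum_distrib_left[symmetric])
  then show "0 \<le> t \<Longrightarrow> t \<le> exit_time r v \<Longrightarrow> v + t *\<^sub>R local_drift r v \<in> prob_simplex"
    by (simp add: T_def b_def)
  have pos: "0 < v $ i + t * b $ i" if t: "0 < t" "t < T" and "i \<in> A" for i t
  proof (cases "i \<in> D")
    case True
    then have "t < - (v $ i) / b $ i" "b $ i < 0" using T_le[of i] t by (auto simp: D_def)
    then show ?thesis by (simp add: field_simps)
  next
    case False
    show ?thesis
    proof (cases "i \<in> S")
      case True
      then have "0 \<le> b $ i" "0 < v $ i" using False vpos by (auto simp: D_def)
      then show ?thesis using t by (simp add: add_pos_nonneg)
    next
      case False
      then show ?thesis using b_pos[OF \<open>i \<in> A\<close>] v0 t by simp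
    qed
  qed
  show "supp (v + t *\<^sub>R local_drift r v) = absorbing_hull r (supp v)" if "0 < t" "t < exit_time r v"
  proof -
    have "0 < v $ i + t * b $ i \<longleftrightarrow> i \<in> A" for i
    proof (cases "i \<in> A")
      case False
      then have "i \<notin> S" using sub by blast
      then show ?thesis using False b_off[of i] v0[of i] by simp
    qed (use pos[of t i] that in \<open>simp add: T_def\<close>)
    then have "supp (v + t *\<^sub>R b) = A" by (simp add: supp_def)
    then show ?thesis by (simp add: A_def S_def b_def)
  qed
  define I where "I = {i \<in> A. v $ i + T * b $ i = 0}"
  have "0 < v $ i + T * b $ i \<longleftrightarrow> i \<in> A - I" for i
  proof (cases "i \<in> A")
    case False
    then have "i \<notin> S" using sub by blast
    then show ?thesis using False b_off[of i] v0[of i] by simp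
  qed (use nonneg[of T i] T_pos in \<open>auto simp: T_def I_def\<close>)
  then have supp: "supp (v + T *\<^sub>R b) = A - I" by (auto simp: supp_def)
  have "m \<in> I" using m sub by (auto simp: I_def D_def field_simps)
  moreover have "m \<in> A" using m sub by (auto simp: D_def)
  ultimately have "A - I \<subset> A" by blast
  then show "supp (v + exit_time r v *\<^sub>R local_drift r v) \<subset> absorbing_hull r (supp v)"
    using supp by (simp add: T_def b_def A_def S_def)
  have "v + T *\<^sub>R b \<in> prob_simplex" using simplex[of T] T_pos by (simp add: T_def)
  then have "A - I \<noteq> {}" using simplex_supp_nonempty supp by metis
  moreover have "absorbing r A" unfolding A_def using ne by (rule absorbing_absorbing_hull)
  moreover have "adj r (trace_profile A) i \<le> 0" if "i \<in> A \<inter> I" for i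
  proof -
    have "b $ i = adj r (trace_profile A) i"
      using local_drift_nth[of v i] ne by (simp add: b_def S_def A_def hull_profile_def)
    moreover have "b $ i \<le> 0"
    proof (rule ccontr)
      assume "\<not> b $ i \<le> 0"
      then have "0 < T * b $ i" using T_pos by (simp add: T_def)
      moreover have "0 \<le> v $ i" using v0[of i] vpos[of i] by force
      ultimately show False using that by (simp add: I_def)
    qed
    ultimately show ?thesis by simp
  qed
  ultimately have "absorbing r (A - I)" using absorbing_Diff by blast
  then show "absorbing r (supp (v + exit_time r v *\<^sub>R local_drift r v))"
    using supp by (simp add: T_def b_def)
qed


section \<open>Breakpoints and segments of the piecewise linear path\<close>

abbreviation bp_time :: "real ^ 'v \<Rightarrow> nat \<Rightarrow> real" where
  "bp_time u k \<equiv> fst (breakpoint r u k)"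

abbreviation bp_pos :: "real ^ 'v \<Rightarrow> nat \<Rightarrow> real ^ 'v" where
  "bp_pos u k \<equiv> snd (breakpoint r u k)"

declare breakpoint.simps(2) [simp del]

lemma bp_Suc:
  assumes "local_drift r (bp_pos u k) \<noteq> 0"
  shows "bp_time u (Suc k) = bp_time u k + exit_time r (bp_pos u k)"
    and "bp_pos u (Suc k) = bp_pos u k + exit_time r (bp_pos u k) *\<^sub>R local_drift r (bp_pos u k)"
  using assms by (simp_all add: breakpoint.simps(2) case_prod_beta)

lemma bp_Suc_stopped:
  assumes "local_drift r (bp_pos u k) = 0"
  shows "bp_pos u (Suc k) = bp_pos u k"
  using assms by (simp add: breakpoint.simps(2) case_prod_beta)

lemma bp_pos_simplex:
  assumes "u \<in> prob_simplex"
  shows "bp_pos u k \<in> prob_simplex"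
proof (induction k)
  case (Suc k)
  show ?case
  proof (cases "local_drift r (bp_pos u k) = 0")
    case True
    then show ?thesis using Suc bp_Suc_stopped by metis
  next
    case False
    then show ?thesis
      unfolding bp_Suc[OF False]
      by (intro drift_step_simplex[OF Suc False] less_imp_le[OF exit_time_pos[OF Suc False]] order_refl)
  qed
qed (use assms in simp)

text \<open>The support at each later breakpoint is absorbing, hence its own hull, and a proper
  subset of the preceding hull; so the cardinality of the hull drops at every step.\<close>

lemma bp_stops:
  assumes "u \<in> prob_simplex"
  shows "\<exists>k. local_drift r (bp_pos u k) = 0"
proof (rule ccontr)
  assume "\<not> ?thesis"
  then have nz: "local_drift r (bp_pos u k) \<noteq> 0" for k by blast
  define N where "N k = card (absorbing_hull r (supp (bp_pos u k)))" for k
  have dec: "N (Suc k) < N k" for k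
  proof -
    note sx = bp_pos_simplex[OF assms]
    have "absorbing_hull r (supp (bp_pos u (Suc k))) = supp (bp_pos u (Suc k))"
      by (rule absorbing_hull_absorbing[OF simplex_supp_nonempty[OF sx]])
        (simp only: bp_Suc(2)[OF nz] absorbing_drift_exit[OF sx nz])
    then have "absorbing_hull r (supp (bp_pos u (Suc k))) \<subset> absorbing_hull r (supp (bp_pos u k))"
      using supp_drift_exit[OF sx[of k] nz] by (simp only: bp_Suc(2)[OF nz])
    then show ?thesis unfolding N_def by (rule psubset_card_mono[rotated]) simp
  qed
  have "N k + k \<le> N 0" for k
  proof (induction k)
    case (Suc k)
    then show ?case using dec[of k] by linarith
  qed simp
  from this[of "Suc (N 0)"] show False by simp
qed

lemma
  assumes "u \<in> prob_simplex"
  shows final_step_stopped: "local_drift r (bp_pos u (final_step r u)) = 0"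
    and before_final_step: "k < final_step r u \<Longrightarrow> local_drift r (bp_pos u k) \<noteq> 0"
  unfolding final_step_def using LeastI_ex[OF bp_stops[OF assms]] not_less_Least by auto

lemma bp_time_less_Suc:
  assumes "u \<in> prob_simplex" "k < final_step r u"
  shows "bp_time u k < bp_time u (Suc k)"
  unfolding bp_Suc[OF before_final_step[OF assms]]
  using exit_time_pos[OF bp_pos_simplex[OF assms(1)] before_final_step[OF assms]] by simp

lemma bp_time_mono:
  assumes "u \<in> prob_simplex" "l \<le> final_step r u" "k \<le> l"
  shows "bp_time u k \<le> bp_time u l"
  using assms(3,2)
proof (induction l rule: dec_induct)
  case (step l)
  then show ?case using bp_time_less_Suc[OF assms(1), of l] by simp
qed simp

lemma bp_time_nonneg:
  assumes "u \<in> prob_simplex" "k \<le> final_step r u"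
  shows "0 \<le> bp_time u k"
  using bp_time_mono[OF assms, of 0] by simp

lemma linear_path_after:
  assumes "u \<in> prob_simplex" "bp_time u (final_step r u) \<le> t"
  shows "linear_path r u t = bp_pos u (final_step r u)"
  using assms bp_time_nonneg[OF assms(1) order_refl] by (simp add: linear_path_def)

lemma linear_path_segment:
  assumes u: "u \<in> prob_simplex" and k: "k < final_step r u" and t: "bp_time u k \<le> t" "t < bp_time u (Suc k)"
  shows "linear_path r u t = bp_pos u k + (t - bp_time u k) *\<^sub>R local_drift r (bp_pos u k)"
proof -
  have "bp_time u (Suc k) \<le> bp_time u (final_step r u)"
    using k by (intro bp_time_mono[OF u]) auto
  then have nt: "\<not> bp_time u (final_step r u) \<le> t" using t by linarith
  have t0: "0 \<le> t" using bp_time_nonneg[OF u, of k] k t by linarith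
  have the: "(THE k. k < final_step r u \<and> bp_time u k \<le> t \<and> t < bp_time u (Suc k)) = k"
  proof (rule the_equality)
    fix l assume l: "l < final_step r u \<and> bp_time u l \<le> t \<and> t < bp_time u (Suc l)"
    show "l = k"
    proof (rule linorder_cases[of l k])
      assume "l < k"
      then have "bp_time u (Suc l) \<le> bp_time u k" using k by (intro bp_time_mono[OF u]) auto
      with l t show ?thesis by linarith
    next
      assume "k < l"
      then have "bp_time u (Suc k) \<le> bp_time u l" using l by (intro bp_time_mono[OF u]) auto
      with l t show ?thesis by linarith
    qed
  qed (use k t in simp)
  show ?thesis
    using nt t0 unfolding linear_path_def by (simp only: the Let_def case_prod_beta restrict_apply atLeast_iff if_True if_False)
qed

lemma linear_path_closed_segment:
  assumes u: "u \<in> prob_simplex" and k: "k < final_step r u" and t: "bp_time u k \<le> t" "t \<le> bp_time u (Suc k)"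
  shows "linear_path r u t = bp_pos u k + (t - bp_time u k) *\<^sub>R local_drift r (bp_pos u k)"
proof (cases "t = bp_time u (Suc k)")
  case False
  then show ?thesis using linear_path_segment[OF u k] t by simp
next
  case True
  have "linear_path r u (bp_time u (Suc k)) = bp_pos u (Suc k)"
  proof (cases "Suc k = final_step r u")
    case True
    then show ?thesis using linear_path_after[OF u] by simp
  next
    case False
    then have "Suc k < final_step r u" using k by simp
    then show ?thesis using linear_path_segment[OF u, of "Suc k" "bp_time u (Suc k)"] bp_time_less_Suc[OF u] by simp
  qed
  then show ?thesis unfolding True using bp_Suc[OF before_final_step[OF u k]] by simp
qed

lemma linear_path_cases:
  assumes "u \<in> prob_simplex" "0 \<le> t"
  obtains (after) "bp_time u (final_step r u) \<le> t"
    | (segment) k where "k < final_step r u" "bp_time u k \<le> t" "t < bp_time u (Suc k)"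
proof (cases "bp_time u (final_step r u) \<le> t")
  case True
  then show thesis by (rule after)
next
  case False
  define P where "P n \<longleftrightarrow> t < bp_time u n" for n
  have "P (final_step r u)" using False by (simp add: P_def)
  then obtain n where n: "n \<le> final_step r u" "P n" "\<And>m. m < n \<Longrightarrow> \<not> P m"
    by (metis LeastI Least_le not_less_Least)
  have "n \<noteq> 0" using n(2) assms(2) by (auto simp: P_def intro: ccontr)
  then obtain k where k: "n = Suc k" by (cases n) auto
  have "bp_time u k \<le> t" using n(3)[of k] k by (simp add: P_def)
  then show thesis using n(1,2) k unfolding P_def by (intro segment[of k]) auto
qed

lemma linear_path_0:
  assumes "u \<in> prob_simplex"
  shows "linear_path r u 0 = u"
proof (cases "final_step r u = 0")
  case True
  then show ?thesis using linear_path_after[OF assms, of 0] by simp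
next
  case False
  then show ?thesis
    using linear_path_segment[OF assms, of 0 0] bp_time_less_Suc[OF assms, of 0] by simp
qed

lemma linear_path_continuous:
  assumes u: "u \<in> prob_simplex"
  shows "continuous_on {0..} (linear_path r u)"
proof -
  have "continuous_on {0..bp_time u k} (linear_path r u)" if "k \<le> final_step r u" for k
    using that
  proof (induction k)
    case (Suc k)
    have "continuous_on {bp_time u k..bp_time u (Suc k)}
        (\<lambda>t. bp_pos u k + (t - bp_time u k) *\<^sub>R local_drift r (bp_pos u k))"
      by (intro continuous_intros)
    then have "continuous_on {bp_time u k..bp_time u (Suc k)} (linear_path r u)"
      by (rule continuous_on_eq) (use linear_path_closed_segment[OF u, of k] Suc in auto)
    with Suc have "continuous_on ({0..bp_time u k} \<union> {bp_time u k..bp_time u (Suc k)}) (linear_path r u)"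
      by (intro continuous_on_closed_Un) auto
    moreover have "{0..bp_time u k} \<union> {bp_time u k..bp_time u (Suc k)} = {0..bp_time u (Suc k)}"
      using bp_time_less_Suc[OF u, of k] bp_time_nonneg[OF u, of k] Suc by auto
    ultimately show ?case by simp
  qed simp
  moreover have "continuous_on {bp_time u (final_step r u)..} (linear_path r u)"
    by (rule continuous_on_eq[OF continuous_on_const]) (use linear_path_after[OF u] in auto)
  ultimately have "continuous_on ({0..bp_time u (final_step r u)} \<union> {bp_time u (final_step r u)..}) (linear_path r u)"
    by (intro continuous_on_closed_Un) auto
  moreover have "{0..bp_time u (final_step r u)} \<union> {bp_time u (final_step r u)..} = {0..}"
    using bp_time_nonneg[OF u order_refl] by auto
  ultimately show ?thesis by simp
qed

lemma linear_path_simplex: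
  assumes u: "u \<in> prob_simplex" and "0 \<le> t"
  shows "linear_path r u t \<in> prob_simplex"
  using assms
proof (cases rule: linear_path_cases)
  case after
  then show ?thesis using linear_path_after[OF u] bp_pos_simplex[OF u] by simp
next
  case (segment k)
  note nz = before_final_step[OF u segment(1)]
  show ?thesis
    unfolding linear_path_segment[OF u segment]
    by (rule drift_step_simplex[OF bp_pos_simplex[OF u] nz]) (use segment bp_Suc(1)[OF nz] in auto)
qed

text \<open>Inside a segment the support is the hull of the support at its left end, and at a later
  breakpoint \<open>absorbing_drift_exit\<close> applies. Only at time zero must absorption be
  assumed.\<close>

lemma linear_path_absorbing:
  assumes u: "u \<in> prob_simplex" and "0 \<le> t" "0 < t \<or> absorbing r (supp u)"
  shows "absorbing r (supp (linear_path r u t))"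
  using assms(1,2)
proof (cases rule: linear_path_cases)
  case after
  then show ?thesis
    using linear_path_after[OF u] local_drift_zero_absorbing[OF bp_pos_simplex[OF u] final_step_stopped[OF u]] by simp
next
  case (segment k)
  note nz = before_final_step[OF u segment(1)]
  note sx = bp_pos_simplex[OF u, of k]
  show ?thesis
  proof (cases "t = bp_time u k")
    case False
    then have "supp (linear_path r u t) = absorbing_hull r (supp (bp_pos u k))"
      unfolding linear_path_segment[OF u segment]
      using segment bp_Suc(1)[OF nz] by (intro supp_drift_step[OF sx nz]) auto
    then show ?thesis using absorbing_absorbing_hull[OF simplex_supp_nonempty[OF sx]] by simp
  next
    case True
    then have eq: "linear_path r u t = bp_pos u k" using linear_path_segment[OF u segment] by simp
    show ?thesis
    proof (cases k)
      case 0
      then show ?thesis using eq True assms(3) by simp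
    next
      case (Suc l)
      then have "local_drift r (bp_pos u l) \<noteq> 0" using before_final_step[OF u, of l] segment by simp
      from absorbing_drift_exit[OF bp_pos_simplex[OF u] this] bp_Suc(2)[OF this]
      show ?thesis unfolding eq Suc by (simp only:)
    qed
  qed
qed

text \<open>Just after a breakpoint the support jumps up to its hull. As the hull is idempotent, the
  drift prescribed there is still that of the segment.\<close>

lemma linear_path_follows_drift:
  assumes u: "u \<in> prob_simplex"
  shows "follows_drift 0 (linear_path r u)"
  unfolding follows_drift_def
proof (intro conjI allI impI)
  show "continuous_on {0..} (linear_path r u)" using u by (rule linear_path_continuous)
  fix t :: real assume "0 \<le> t"
  show "\<exists>e>0. \<forall>s. t \<le> s \<and> s < t + e \<longrightarrow>
    linear_path r u s = linear_path r u t + (s - t) *\<^sub>R local_drift r (linear_path r u t)"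
    using u \<open>0 \<le> t\<close>
  proof (cases rule: linear_path_cases)
    case after
    then have "linear_path r u s = bp_pos u (final_step r u)" if "t \<le> s" for s
      using linear_path_after[OF u] that by simp
    then show ?thesis
      using final_step_stopped[OF u] by (intro exI[of _ 1]) auto
  next
    case (segment k)
    note nz = before_final_step[OF u segment(1)]
    note sx = bp_pos_simplex[OF u, of k]
    let ?v = "bp_pos u k" and ?T = "bp_time u k"
    have drift: "local_drift r (linear_path r u t) = local_drift r ?v"
    proof (cases "t = ?T")
      case True
      then show ?thesis using linear_path_segment[OF u segment] by simp
    next
      case False
      then have supp: "supp (linear_path r u t) = absorbing_hull r (supp ?v)"
        unfolding linear_path_segment[OF u segment]
        using segment bp_Suc(1)[OF nz] by (intro supp_drift_step[OF sx nz]) auto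
      have "absorbing_hull r (absorbing_hull r (supp ?v)) = absorbing_hull r (supp ?v)"
        using absorbing_absorbing_hull[OF simplex_supp_nonempty[OF sx]]
          absorbing_hull_superset[OF simplex_supp_nonempty[OF sx]] simplex_supp_nonempty[OF sx]
        by (intro absorbing_hull_absorbing) auto
      then show ?thesis using supp by (intro local_drift_cong) simp
    qed
    have path: "linear_path r u s = ?v + (s - ?T) *\<^sub>R local_drift r ?v" if "t \<le> s" "s < bp_time u (Suc k)" for s
      by (rule linear_path_segment[OF u segment(1)]) (use segment that in auto)
    have "linear_path r u s = linear_path r u t + (s - t) *\<^sub>R local_drift r (linear_path r u t)"
      if "t \<le> s" "s < bp_time u (Suc k)" for s
    proof -
      have "linear_path r u t + (s - t) *\<^sub>R local_drift r ?v = ?v + (s - ?T) *\<^sub>R local_drift r ?v"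
        unfolding path[OF order_refl segment(3)] by (simp add: algebra_simps)
      also have "\<dots> = linear_path r u s" by (rule path[OF that, symmetric])
      finally show ?thesis unfolding drift by (rule sym)
    qed
    moreover have "0 < bp_time u (Suc k) - t" using segment by simp
    ultimately show ?thesis by (metis add.commute diff_add_cancel)
  qed
qed

end

section \<open>The oblique reflection problem\<close>

lemma continuous_on_Ici_I:
  fixes f :: "real \<Rightarrow> 'a::topological_space"
  assumes "\<And>t. a \<le> t \<Longrightarrow> (f \<longlongrightarrow> f t) (at_right t)" "\<And>t. a < t \<Longrightarrow> (f \<longlongrightarrow> f t) (at_left t)"
  shows "continuous_on {a..} f"
  unfolding continuous_on_def
proof
  fix t assume "t \<in> {a..}"
  show "(f \<longlongrightarrow> f t) (at t within {a..})"
  proof (cases "t = a")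
    case True
    then show ?thesis using assms(1)[of a] by (simp add: at_within_Ici_at_right)
  next
    case False
    then have "t \<in> interior {a..}" using \<open>t \<in> {a..}\<close> by simp
    then have "at t within {a..} = at t" by (rule at_within_interior)
    then show ?thesis using assms[of t] False \<open>t \<in> {a..}\<close> by (simp add: filterlim_at_split)
  qed
qed

lemma stieltjes_measure_Ioc:
  fixes F :: "real \<Rightarrow> real"
  assumes mono: "mono_on {0..} F" and right: "\<And>t. 0 \<le> t \<Longrightarrow> (F \<longlongrightarrow> F t) (at_right t)"
    and "0 \<le> a" "a \<le> b"
  shows "emeasure (interval_measure (\<lambda>s. F (max 0 s))) {a<..b} = ennreal (F b - F a)"
proof -
  have "emeasure (interval_measure (\<lambda>s. F (max 0 s))) {a<..b} = ennreal (F (max 0 b) - F (max 0 a))"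
  proof (rule emeasure_interval_measure_Ioc[OF \<open>a \<le> b\<close>])
    show "F (max 0 x) \<le> F (max 0 y)" if "x \<le> y" for x y
      using that by (intro mono_onD[OF mono]) auto
    show "continuous (at_right x) (\<lambda>s. F (max 0 s))" for x
    proof (cases "0 \<le> x")
      case True
      have "((\<lambda>s. F (max 0 s)) \<longlongrightarrow> F x) (at_right x)"
        by (rule Lim_transform_eventually[OF right[OF True]])
          (use True in \<open>auto simp: eventually_at_filter max_def\<close>)
      then show ?thesis using True by (simp add: continuous_within max_def)
    next
      case False
      have "((\<lambda>s. F (max 0 s)) \<longlongrightarrow> F 0) (at_right x)"
      proof (rule Lim_transform_eventually[OF tendsto_const])
        show "\<forall>\<^sub>F s in at_right x. F 0 = F (max 0 s)"
          using eventually_at_right_less[of x] eventually_at_right[of x 0] False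
          unfolding eventually_at_right_field by (intro exI[of _ 0]) auto
      qed
      then show ?thesis using False by (simp add: continuous_within max_def)
    qed
  qed
  then show ?thesis using assms by simp
qed

text \<open>The two integrands coincide as functions, so the equality holds for arbitrary Z and even
  when the integrals take their default value.\<close>

lemma stieltjes_indicator_eq:
  fixes F :: "real \<Rightarrow> real"
  assumes F: "\<And>t. 0 \<le> t \<Longrightarrow> F t = (LINT s:{0<..t}|M. indicator Z s)"
    and "0 \<le> s" "s \<le> t" "\<And>x. s < x \<Longrightarrow> x \<le> t \<Longrightarrow> x \<notin> Z"
  shows "F t = F s"
proof -
  have "(\<lambda>x. indicat_real {0<..t} x *\<^sub>R indicat_real Z x) = (\<lambda>x. indicat_real {0<..s} x *\<^sub>R indicat_real Z x)"
  proof
    fix x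
    have "x \<le> s \<or> t < x \<or> x \<notin> Z" using assms(4)[of x] by linarith
    then show "indicat_real {0<..t} x *\<^sub>R indicat_real Z x = indicat_real {0<..s} x *\<^sub>R indicat_real Z x"
      using assms(3) by (auto simp: indicator_def)
  qed
  then show ?thesis using assms(2,3) by (simp add: F set_lebesgue_integral_def)
qed

text \<open>By the integral equation, F t is the mass of the part of Z up to t. As t is not in Z,
  this part lies in the union of the intervals {0<..x n} with x n < t, whose mass is at most the
  left limit.\<close>

lemma stieltjes_no_jump:
  fixes F :: "real \<Rightarrow> real"
  assumes mono: "mono_on {0..} F" and right: "\<And>t. 0 \<le> t \<Longrightarrow> (F \<longlongrightarrow> F t) (at_right t)"
    and F: "\<And>t. 0 \<le> t \<Longrightarrow> F t = (LINT s:{0<..t}|interval_measure (\<lambda>s. F (max 0 s)). indicator Z s)"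
    and t: "0 < t" "t \<notin> Z" and l: "(F \<longlongrightarrow> l) (at_left t)"
  shows "F t = l"
proof -
  let ?M = "interval_measure (\<lambda>s. F (max 0 s))"
  have F0: "F 0 = 0" using F[of 0] by (simp add: set_lebesgue_integral_def)
  \<comment> \<open>The shift by 2 keeps every \<open>x n\<close> strictly between 0 and t.\<close>
  define x where "x n = t * (1 - 1 / real (n + 2))" for n
  have "0 < 1 / real (n + 2)" "1 / real (n + 2) < 1" for n by (auto simp: field_simps)
  then have x: "0 < x n" "x n < t" for n using t mult_strict_left_mono[of "1 - 1 / real (n + 2)" 1 t]
    by (auto simp: x_def)
  have "(\<lambda>n. t * (1 - 1 / real (n + 2))) \<longlonglongrightarrow> t * (1 - 0)"
    by (intro tendsto_intros LIMSEQ_ignore_initial_segment[OF lim_1_over_n])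
  then have "x \<longlonglongrightarrow> t" by (simp add: x_def[abs_def])
  then have "filterlim x (at_left t) sequentially"
    using x less_imp_neq[OF x(2)] by (auto simp: filterlim_at)
  then have lim: "(\<lambda>n. F (x n)) \<longlonglongrightarrow> l" by (rule filterlim_compose[OF l])
  have le: "F (x n) \<le> F t" for n using x[of n] by (intro mono_onD[OF mono]) auto
  then have "l \<le> F t" using lim by (intro LIMSEQ_le_const2[of _ l]) auto
  have Ft: "F t = measure ?M ({0<..t} \<inter> Z)"
    using t F[of t] by (simp add: set_lebesgue_integral_def indicator_inter_arith[symmetric])
  have "F t \<le> l"
  \<comment> \<open>Z is arbitrary, so the set may fail to be measurable; then
    \<open>measure\<close> has its default value 0, and F t = 0 is below the nonnegative
    limit.\<close>
  proof (cases "{0<..t} \<inter> Z \<in> sets ?M")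
    case False
    then have "F t = 0" using Ft by (simp add: measure_notin_sets)
    moreover have "0 \<le> F (x n)" for n using mono_onD[OF mono, of 0 "x n"] x[of n] F0 by simp
    then have "0 \<le> l" by (intro LIMSEQ_le_const[OF lim]) auto
    ultimately show ?thesis by simp
  next
    case True
    have "({0<..t} \<inter> Z) \<subseteq> (\<Union>n. {0<..x n})"
    proof
      fix y assume y: "y \<in> {0<..t} \<inter> Z"
      then have "y < t" using t by (cases "y = t") auto
      then have "eventually (\<lambda>n. y < x n) sequentially"
        using order_tendstoD(1)[OF \<open>x \<longlonglongrightarrow> t\<close>] by blast
      then obtain n where "y < x n" by (auto simp: eventually_sequentially)
      then show "y \<in> (\<Union>n. {0<..x n})" using y by (auto intro!: exI[of _ n])
    qed
    then have "emeasure ?M ({0<..t} \<inter> Z) \<le> emeasure ?M (\<Union>n. {0<..x n})"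
      by (intro emeasure_mono) auto
    also have "emeasure ?M (\<Union>n. {0<..x n}) \<le> ennreal l"
    proof (rule LIMSEQ_le_const2)
      show "(\<lambda>n. emeasure ?M {0<..x n}) \<longlonglongrightarrow> emeasure ?M (\<Union>n. {0<..x n})"
      proof (rule Lim_emeasure_incseq)
        have "x n \<le> x m" if "n \<le> m" for n m
          using that t by (auto simp: x_def field_simps)
        then show "incseq (\<lambda>n. {0<..x n})" by (fastforce simp: incseq_def intro: order_trans)
      qed auto
      have "F (x n) \<le> l" for n
      proof (rule LIMSEQ_le_const[OF lim])
        have "x n \<le> x m" if "n \<le> m" for m
          using that t by (auto simp: x_def field_simps)
        then have "F (x n) \<le> F (x m)" if "n \<le> m" for m using that x by (intro mono_onD[OF mono]) (auto intro: less_imp_le)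
        then show "\<exists>N. \<forall>m\<ge>N. F (x n) \<le> F (x m)" by blast
      qed
      then show "\<exists>N. \<forall>n\<ge>N. emeasure ?M {0<..x n} \<le> ennreal l"
        using stieltjes_measure_Ioc[OF mono right, of 0] x F0 by (simp add: less_imp_le ennreal_leI)
    qed
    finally have *: "emeasure ?M ({0<..t} \<inter> Z) \<le> ennreal l" .
    have "0 \<le> F (x 0)" using mono_onD[OF mono, of 0 "x 0"] x[of 0] F0 by simp
    also have "F (x 0) \<le> l"
    proof (rule LIMSEQ_le_const[OF lim])
      have "x 0 \<le> x m" for m using t by (auto simp: x_def field_simps)
      then have "F (x 0) \<le> F (x m)" for m using x by (intro mono_onD[OF mono]) (auto intro: less_imp_le)
      then show "\<exists>N. \<forall>m\<ge>N. F (x 0) \<le> F (x m)" by blast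
    qed
    finally have "0 \<le> l" .
    have "measure ?M ({0<..t} \<inter> Z) \<le> l" using * \<open>0 \<le> l\<close> by (simp add: measure_def enn2real_leI)
    then show ?thesis by (simp add: Ft)
  qed
  with \<open>l \<le> F t\<close> show ?thesis by simp
qed

context irreducible_walk
begin

lemma supp_persists:
  fixes \<zeta> :: "real \<Rightarrow> real ^ 'v"
  assumes "continuous_on {a..} \<zeta>" "a \<le> t"
  shows "\<exists>e>0. \<forall>s\<ge>a. \<bar>s - t\<bar> < e \<longrightarrow> supp (\<zeta> t) \<subseteq> supp (\<zeta> s)"
proof -
  have lim: "((\<lambda>s. \<zeta> s $ i) \<longlongrightarrow> \<zeta> t $ i) (at t within {a..})" for i
    using assms by (auto simp: continuous_on_def intro!: tendsto_vec_nth)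
  have "eventually (\<lambda>s. i \<in> supp (\<zeta> s)) (at t within {a..})" if "i \<in> supp (\<zeta> t)" for i
    using order_tendstoD(1)[OF lim, of 0 i] that by (simp add: supp_def)
  then have "eventually (\<lambda>s. \<forall>i\<in>supp (\<zeta> t). i \<in> supp (\<zeta> s)) (at t within {a..})"
    by (simp add: eventually_ball_finite_distrib)
  then obtain e where e: "0 < e" "\<And>s. s \<in> {a..} \<Longrightarrow> s \<noteq> t \<Longrightarrow> dist s t < e \<Longrightarrow> \<forall>i\<in>supp (\<zeta> t). i \<in> supp (\<zeta> s)"
    unfolding eventually_at by blast
  have "supp (\<zeta> t) \<subseteq> supp (\<zeta> s)" if "a \<le> s" "\<bar>s - t\<bar> < e" for s
    using e(2)[of s] that by (cases "s = t") (auto simp: dist_real_def)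
  with e(1) show ?thesis by blast
qed

lemma reflection_sum_nth:
  "(\<Sum>i\<in>UNIV. \<rho> i *\<^sub>R reflection_vector r i) $ j = - adj r (\<lambda>i. \<rho> i / exit_rate r i) j"
  unfolding adj_eq_sum_jump_vector reflection_vector_eq
  by (simp add: sum_component sum_negf divide_inverse mult.assoc)

lemma exit_rate_zero:
  assumes "exit_rate r i = 0"
  shows "k = i"
  using exit_rate_pos[of "{i}" k i] assms by auto

text \<open>The maximum principle is applied to the largest value that the defect
  \<open>h * a - \<alpha> h\<close> attains up to time \<open>h\<close>: at its last time at the
  boundary before the maximum the defect is at least as large.\<close>
lemma local_reflection_unique:
  fixes v :: "real ^ 'v" and \<alpha> :: "real \<Rightarrow> 'v \<Rightarrow> real"
  assumes v: "v \<in> prob_simplex"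
    and cont: "\<And>i. continuous_on {0..<e} (\<lambda>h. \<alpha> h i)"
    and start: "\<And>i. \<alpha> 0 i = 0"
    and nonneg: "\<And>h i. 0 \<le> h \<Longrightarrow> h < e \<Longrightarrow> 0 \<le> v $ i + adj r (\<alpha> h) i"
    and le: "\<And>h i. 0 \<le> h \<Longrightarrow> h < e \<Longrightarrow> \<alpha> h i \<le> h"
    and on_supp: "\<And>h i. 0 \<le> h \<Longrightarrow> h < e \<Longrightarrow> i \<in> supp v \<Longrightarrow> \<alpha> h i = h"
    and compl: "\<And>s t i. 0 \<le> s \<Longrightarrow> s \<le> t \<Longrightarrow> t < e \<Longrightarrow>
       (\<And>x. s < x \<Longrightarrow> x \<le> t \<Longrightarrow> 0 < v $ i + adj r (\<alpha> x) i) \<Longrightarrow> \<alpha> t i - \<alpha> s i = t - s"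
    and h: "0 \<le> h" "h < e"
  shows "\<alpha> h i = h * hull_profile (supp v) i"
proof -
  define S where "S = supp v"
  define a where "a = hull_profile S"
  have ne: "S \<noteq> {}" unfolding S_def using v by (rule simplex_supp_nonempty)
  have obst: "obstacle S a" unfolding a_def using ne by (rule obstacle_hull_profile)
  have v0: "v $ i = 0" if "i \<notin> S" for i using that v unfolding S_def by (rule supp_zero)
  \<comment> \<open>For h > 0 the quotient of \<open>\<alpha> h\<close> by h is at most 1 and has
    nonnegative L* off S because v vanishes there, so it is a competitor in
    \<open>obstacle_greatest\<close>.\<close>
  have upper: "\<alpha> h i \<le> h * a i"
  proof (cases "h = 0")
    case True
    then show ?thesis using start by simp
  next
    case False
    then have "0 < h" using h by simp
    have "1 / h * \<alpha> h i \<le> a i"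
    proof (rule obstacle_greatest[OF ne obst])
      show "1 / h * \<alpha> h i \<le> 1" for i using le[OF h] \<open>0 < h\<close> by simp
      show "0 \<le> adj r (\<lambda>i. 1 / h * \<alpha> h i) i" if "i \<notin> S" for i
        using nonneg[OF h, of i] v0[OF that] \<open>0 < h\<close> by (simp only: adj_scale) simp
    qed
    then show ?thesis using \<open>0 < h\<close> by (simp add: field_simps)
  qed
  define x where "x s i = s * a i - \<alpha> s i" for s i
  have adj_x: "adj r (x s) i = s * adj r a i - adj r (\<alpha> s) i" for s i
    unfolding x_def[abs_def] by (simp add: adj_diff adj_scale)
  have cont_x: "continuous_on {0..h} (\<lambda>s. x s i)" for i
    unfolding x_def using h by (intro continuous_intros continuous_on_subset[OF cont]) auto
  have "\<exists>m\<in>{0..h}. \<forall>s\<in>{0..h}. x s i \<le> x m i" for i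
    using h by (intro continuous_attains_sup cont_x) auto
  then obtain m where m: "\<And>i. m i \<in> {0..h}" "\<And>i s. s \<in> {0..h} \<Longrightarrow> x s i \<le> x (m i) i"
    by metis
  \<comment> \<open>Each coordinate is maximised at its own time \<open>m i\<close>, so y dominates
    every \<open>x s\<close> coordinatewise, and touching it in coordinate i alone is enough to
    compare L* there.\<close>
  define y where "y i = x (m i) i" for i
  have "y i \<le> 0"
  proof (rule adj_max_principle[of "-S"])
    show "- S \<noteq> UNIV" using ne by auto
    show "y i \<le> 0" if "i \<notin> - S" for i
      using that on_supp[of "m i" i] m(1)[of i] h obst by (auto simp: y_def x_def obstacle_def S_def)
    show "0 \<le> adj r y i" if "i \<in> - S" for i
    proof -
      define Z where "Z = {s \<in> {0..m i}. v $ i + adj r (\<alpha> s) i = 0}"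
      have mi: "0 \<le> m i" "m i \<le> h" using m(1)[of i] by auto
      have "continuous_on {0..m i} (\<lambda>s. v $ i + adj r (\<alpha> s) i)"
        unfolding adj_def using mi h by (intro continuous_intros continuous_on_subset[OF cont]) auto
      then have "closed Z"
        unfolding Z_def by (intro continuous_closed_preimage_constant) auto
      moreover have "bounded Z"
        by (rule bounded_subset[OF bounded_closed_interval[of 0 "m i"]]) (auto simp: Z_def)
      ultimately have "compact Z" by (simp add: compact_eq_bounded_closed)
      moreover have "0 \<in> Z" using start mi v0[of i] that by (simp add: Z_def start[abs_def])
      ultimately obtain s where s: "s \<in> Z" "\<And>z. z \<in> Z \<Longrightarrow> z \<le> s"
        using compact_attains_sup[of Z] by auto
      have s0: "0 \<le> s" "s \<le> m i" using s by (auto simp: Z_def)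
      have "0 < v $ i + adj r (\<alpha> z) i" if "s < z" "z \<le> m i" for z
        using nonneg[of z i] s(2)[of z] that s0 mi h by (auto simp: Z_def less_le)
      then have "\<alpha> (m i) i - \<alpha> s i = m i - s"
        using s0 mi h by (intro compl) auto
      then have "x (m i) i - x s i = (m i - s) * (a i - 1)" by (simp add: x_def algebra_simps)
      also have "\<dots> \<le> 0" using s0 obst by (intro mult_nonneg_nonpos) (auto simp: obstacle_def)
      finally have eq: "x s i = y i" using m(2)[of s i] s0 mi by (simp add: y_def)
      \<comment> \<open>At time s both coordinate i of the path and v i vanish, hence so does
        \<open>adj r (\<alpha> s) i\<close>, and L* of the defect reduces to s times the nonnegative
        \<open>adj r a i\<close>. Since \<open>x s\<close> touches y from below at i, L* y inherits
        the sign.\<close>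
      have "0 \<le> s * adj r a i" using s0 obst that by (intro mult_nonneg_nonneg) (auto simp: obstacle_def)
      also have "\<dots> = adj r (x s) i" using s v0[of i] that by (simp add: adj_x Z_def)
      also have "\<dots> \<le> adj r y i"
        by (rule adj_min_le[where m = "x s" and y = y]) (use eq m(2) s0 mi in \<open>auto simp: y_def\<close>)
      finally show ?thesis .
    qed
  qed
  moreover have "x h i \<le> y i" unfolding y_def using m(2)[of h i] h by simp
  ultimately show ?thesis using upper by (simp add: x_def a_def S_def)
qed


lemma linear_input_nth: "0 \<le> t \<Longrightarrow> linear_input r u t $ j = u $ j + t * adj r (\<lambda>_. 1) j"
  by (simp add: linear_input_def drift_eq_adj)

section \<open>Regularity and local form of a given solution of the reflection problem\<close>

context
  fixes u :: "real ^ 'v" and \<zeta> \<rho> :: "real \<Rightarrow> real ^ 'v"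
  assumes u: "u \<in> prob_simplex" and sol: "(\<zeta>, \<rho>) \<in> orp_solutions r (linear_input r u)"
begin

lemma
  shows orp_cadlag: "\<zeta> \<in> cadlag_paths" "\<rho> \<in> cadlag_paths"
    and orp_mono: "mono_on {0..} (\<lambda>t. \<rho> t $ i)"
    and orp_integral: "0 \<le> t \<Longrightarrow> \<rho> t $ i =
      (LINT s:{0<..t}|interval_measure (\<lambda>s. \<rho> (max 0 s) $ i). indicator {s. \<zeta> s $ i = 0} s)"
    and orp_equation: "0 \<le> t \<Longrightarrow>
      \<zeta> t = linear_input r u t + (\<Sum>i\<in>UNIV. \<rho> t $ i *\<^sub>R reflection_vector r i)"
    and orp_nonneg: "0 \<le> t \<Longrightarrow> 0 \<le> \<zeta> t $ i"
  using sol unfolding orp_solutions_def mem_Collect_eq case_prod_conv by blast+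

lemma orp_start: "\<rho> 0 $ i = 0"
  using orp_integral[of 0 i] by (simp add: set_lebesgue_integral_def)

text \<open>Since lambda = L* 1, drift and reflection merge into L* of one function: clock time
  minus the normalised reflection of each state.\<close>

lemma orp_nth:
  assumes "0 \<le> t"
  shows "\<zeta> t $ j = u $ j + adj r (\<lambda>i. t - \<rho> t $ i / exit_rate r i) j"
proof -
  have "\<zeta> t = linear_input r u t + (\<Sum>i\<in>UNIV. \<rho> t $ i *\<^sub>R reflection_vector r i)"
    using assms by (rule orp_equation)
  then have "\<zeta> t $ j = linear_input r u t $ j + (\<Sum>i\<in>UNIV. \<rho> t $ i *\<^sub>R reflection_vector r i) $ j"
    by simp
  also have "\<dots> = u $ j + (adj r (\<lambda>i. t * 1) j - adj r (\<lambda>i. \<rho> t $ i / exit_rate r i) j)"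
    unfolding reflection_sum_nth linear_input_nth[OF assms] adj_scale by simp
  also have "\<dots> = u $ j + adj r (\<lambda>i. t - \<rho> t $ i / exit_rate r i) j"
    by (simp add: adj_diff)
  finally show ?thesis .
qed

lemma orp_simplex:
  assumes "0 \<le> t"
  shows "\<zeta> t \<in> prob_simplex"
proof -
  have "(\<Sum>j\<in>UNIV. \<zeta> t $ j) = 1"
    using u by (simp add: orp_nth[OF assms] sum.distrib sum_adj prob_simplex_iff)
  moreover have "0 \<le> \<zeta> t $ j" for j using assms by (rule orp_nonneg)
  ultimately show ?thesis by (simp add: prob_simplex_iff)
qed

lemma orp_start_path: "\<zeta> 0 = u"
  by (simp add: vec_eq_iff orp_nth orp_start)

lemma orp_right: "0 \<le> t \<Longrightarrow> ((\<lambda>t. \<rho> t $ i) \<longlongrightarrow> \<rho> t $ i) (at_right t)"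
  using orp_cadlag(2) by (auto simp: cadlag_paths_def intro!: tendsto_vec_nth)

lemma orp_flat:
  assumes "0 \<le> s" "s \<le> t" "\<And>x. s < x \<Longrightarrow> x \<le> t \<Longrightarrow> 0 < \<zeta> x $ i"
  shows "\<rho> t $ i = \<rho> s $ i"
proof (rule stieltjes_indicator_eq[OF orp_integral assms(1,2)])
  show "x \<notin> {s. \<zeta> s $ i = 0}" if "s < x" "x \<le> t" for x using assms(3)[OF that] by simp
qed

lemma orp_zero_exit_rate:
  assumes "exit_rate r i = 0" "0 \<le> t"
  shows "\<rho> t $ i = 0"
proof -
  have "0 < \<zeta> x $ i" if x: "0 \<le> x" for x
  proof -
    obtain j where "j \<in> supp (\<zeta> x)" using simplex_supp_nonempty[OF orp_simplex[OF x]] by blast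
    moreover have "j = i" using assms(1) by (rule exit_rate_zero)
    ultimately show ?thesis by (simp add: supp_def)
  qed
  then show ?thesis using orp_flat[of 0 t i] assms(2) orp_start by simp
qed

text \<open>A jump of the reflection term would be a nonnegative subsolution supported on the zero set
  of \<open>\<zeta>\<close>, which the maximum principle excludes.\<close>
lemma orp_left:
  assumes t: "0 < t"
  shows "((\<lambda>t. \<rho> t $ i) \<longlongrightarrow> \<rho> t $ i) (at_left t)"
proof -
  obtain l where l: "(\<rho> \<longlongrightarrow> l) (at_left t)" using orp_cadlag(2) t by (auto simp: cadlag_paths_def)
  then have li: "((\<lambda>t. \<rho> t $ i) \<longlongrightarrow> l $ i) (at_left t)" for i by (rule tendsto_vec_nth)
  have ev: "eventually (\<lambda>s. 0 \<le> s \<and> s < t) (at_left t)"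
    using eventually_at_left_real[OF t] by eventually_elim auto
  have jump: "l $ i \<le> \<rho> t $ i" for i
  proof (rule tendsto_upperbound[OF li])
    show "\<forall>\<^sub>F s in at_left t. \<rho> s $ i \<le> \<rho> t $ i"
      using ev by eventually_elim (use t in \<open>auto intro: mono_onD[OF orp_mono]\<close>)
  qed simp
  have nojump: "\<rho> t $ i = l $ i" if "0 < \<zeta> t $ i" for i
    by (rule stieltjes_no_jump[OF orp_mono orp_right orp_integral t _ li]) (simp_all add: that less_imp_neq[OF that, symmetric])
  define d where "d i = (\<rho> t $ i - l $ i) / exit_rate r i" for i
  have d_nonneg: "0 \<le> d i" for i
    using jump[of i] by (auto simp: d_def exit_rate_def intro!: divide_nonneg_nonneg sum_nonneg rate_nonneg)
  \<comment> \<open>The left limit of the path at t is \<zeta> t + L* d, which is nonnegative; where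
    d > 0 the coordinate of \<zeta> t itself is zero.\<close>
  have adj_nonneg: "0 \<le> adj r d i" if "0 < d i" for i
  proof -
    have "\<zeta> t $ i = 0"
      using nojump[of i] that orp_simplex[of t] t by (force simp: d_def prob_simplex_iff less_le)
    have "((\<lambda>s. u $ i + adj r (\<lambda>k. s - \<rho> s $ k / exit_rate r k) i) \<longlongrightarrow>
        u $ i + adj r (\<lambda>k. t - l $ k / exit_rate r k) i) (at_left t)"
      unfolding adj_def divide_inverse by (intro tendsto_intros li)
    moreover have "eventually (\<lambda>s. 0 \<le> u $ i + adj r (\<lambda>k. s - \<rho> s $ k / exit_rate r k) i) (at_left t)"
      using ev by eventually_elim (use orp_simplex in \<open>simp add: orp_nth[symmetric] prob_simplex_iff\<close>)
    ultimately have "0 \<le> u $ i + adj r (\<lambda>k. t - l $ k / exit_rate r k) i"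
      by (intro tendsto_lowerbound) auto
    also have "(\<lambda>k. t - l $ k / exit_rate r k) = (\<lambda>k. (t - \<rho> t $ k / exit_rate r k) + d k)"
      by (simp add: d_def diff_divide_distrib)
    also have "u $ i + adj r \<dots> i = \<zeta> t $ i + adj r d i"
      using t by (simp add: orp_nth adj_add)
    finally show ?thesis using \<open>\<zeta> t $ i = 0\<close> by simp
  qed
  obtain j where j: "0 < \<zeta> t $ j"
    using simplex_supp_nonempty[OF orp_simplex[of t]] t by (auto simp: supp_def)
  have "d i \<le> 0" for i
  proof (rule adj_max_principle[of "{i. 0 < d i}"])
    have "d j = 0" using nojump[OF j] by (simp add: d_def)
    then show "{i. 0 < d i} \<noteq> UNIV" by (metis UNIV_I less_irrefl mem_Collect_eq)
  qed (use adj_nonneg in auto)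
  then have "d i = 0" using d_nonneg antisym by blast
  have "\<rho> t $ i = l $ i"
  proof (cases "exit_rate r i = 0")
    case False
    then show ?thesis using \<open>d i = 0\<close> by (simp add: d_def)
  next
    case True
    then have "j = i" by (rule exit_rate_zero)
    then show ?thesis using nojump[OF j] by simp
  qed
  then show ?thesis using li by simp
qed

lemma orp_continuous: "continuous_on {0..} (\<lambda>t. \<rho> t $ i)"
  by (rule continuous_on_Ici_I) (auto intro: orp_left orp_right)

lemma orp_path_continuous: "continuous_on {0..} \<zeta>"
proof -
  have "continuous_on {0..} (\<lambda>t. \<chi> j. u $ j + adj r (\<lambda>i. t - \<rho> t $ i / exit_rate r i) j)"
    unfolding adj_def divide_inverse by (intro continuous_on_vec_lambda continuous_intros orp_continuous)
  then show ?thesis by (rule continuous_on_eq) (simp add: vec_eq_iff orp_nth)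
qed

text \<open>With \<alpha> the elapsed time minus the normalised growth of \<rho> after t, the
  solution restarted at t meets the hypotheses of \<open>local_reflection_unique\<close>, on an
  interval so short that the support of \<zeta> t persists.\<close>

lemma orp_right_local:
  assumes t: "0 \<le> t"
  obtains e where "0 < e"
    "\<And>s i. t \<le> s \<Longrightarrow> s < t + e \<Longrightarrow>
       \<rho> s $ i = \<rho> t $ i + (s - t) * (exit_rate r i * (1 - hull_profile (supp (\<zeta> t)) i))"
proof -
  let ?v = "\<zeta> t" and ?e = "exit_rate r"
  note sx = orp_simplex[OF t]
  obtain e where e: "0 < e" "\<And>s. 0 \<le> s \<Longrightarrow> \<bar>s - t\<bar> < e \<Longrightarrow> supp (\<zeta> t) \<subseteq> supp (\<zeta> s)"
    using supp_persists[OF orp_path_continuous t] by blast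
  define \<alpha> where "\<alpha> h i = h - (\<rho> (t + h) $ i / ?e i - \<rho> t $ i / ?e i)" for h i
  have path: "\<zeta> (t + h) $ j = ?v $ j + adj r (\<alpha> h) j" if "0 \<le> h" for h j
  proof -
    have "(\<lambda>i. t + h - \<rho> (t + h) $ i / ?e i) = (\<lambda>i. (t - \<rho> t $ i / ?e i) + \<alpha> h i)"
      by (simp add: \<alpha>_def fun_eq_iff)
    then show ?thesis using t that by (simp add: orp_nth adj_add)
  qed
  have \<alpha>: "\<alpha> h i = h * hull_profile (supp ?v) i" if "0 \<le> h" "h < e" for h i
  proof (rule local_reflection_unique[OF sx, where e = e])
    show "continuous_on {0..<e} (\<lambda>h. \<alpha> h i)" for i
      unfolding \<alpha>_def divide_inverse
      using t by (intro continuous_intros continuous_on_compose2[OF orp_continuous]) auto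
    show "\<alpha> 0 i = 0" for i by (simp add: \<alpha>_def)
    show "0 \<le> ?v $ i + adj r (\<alpha> h) i" if "0 \<le> h" "h < e" for h i
      using orp_simplex[of "t + h"] t that by (simp add: path[symmetric] prob_simplex_iff)
    show "\<alpha> h i \<le> h" if "0 \<le> h" "h < e" for h i
    proof -
      have "\<rho> t $ i \<le> \<rho> (t + h) $ i" using that t by (intro mono_onD[OF orp_mono]) auto
      moreover have "0 \<le> ?e i" unfolding exit_rate_def by (intro sum_nonneg rate_nonneg)
      ultimately show ?thesis unfolding \<alpha>_def using divide_right_mono by fastforce
    qed
    show compl: "\<alpha> t' i - \<alpha> s i = t' - s" if "0 \<le> s" "s \<le> t'" "t' < e"
      "\<And>x. s < x \<Longrightarrow> x \<le> t' \<Longrightarrow> 0 < ?v $ i + adj r (\<alpha> x) i" for s t' i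
    proof -
      have "\<rho> (t + t') $ i = \<rho> (t + s) $ i"
      proof (rule orp_flat)
        fix x assume "t + s < x" "x \<le> t + t'"
        then show "0 < \<zeta> x $ i" using that(4)[of "x - t"] path[of "x - t" i] that(1) by simp
      qed (use t that in auto)
      then show ?thesis by (simp add: \<alpha>_def)
    qed
    show "\<alpha> h i = h" if "0 \<le> h" "h < e" "i \<in> supp ?v" for h i
    proof -
      have "\<alpha> h i - \<alpha> 0 i = h - 0"
      proof (rule compl)
        fix x assume "0 < x" "x \<le> h"
        then show "0 < ?v $ i + adj r (\<alpha> x) i"
          using e(2)[of "t + x"] that t by (auto simp: path[symmetric] supp_def)
      qed (use that in auto)
      then show ?thesis by (simp add: \<alpha>_def)
    qed
  qed (use that in auto)
  have "\<rho> s $ i = \<rho> t $ i + (s - t) * (?e i * (1 - hull_profile (supp ?v) i))" if "t \<le> s" "s < t + e" for s i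
  proof (cases "?e i = 0")
    case True
    then show ?thesis using orp_zero_exit_rate[OF True] t that by simp
  next
    case False
    have "s - t - (\<rho> s $ i / ?e i - \<rho> t $ i / ?e i) = (s - t) * hull_profile (supp ?v) i"
      using \<alpha>[of "s - t" i] that by (simp add: \<alpha>_def)
    then show ?thesis using False by (simp add: field_simps)
  qed
  with e(1) show thesis by (rule that)
qed


lemma orp_follows_drift: "follows_drift 0 \<zeta>"
  unfolding follows_drift_def
proof (intro conjI allI impI)
  show "continuous_on {0..} \<zeta>" by (rule orp_path_continuous)
  fix t :: real assume t: "0 \<le> t"
  obtain e where e: "0 < e" "\<And>s i. t \<le> s \<Longrightarrow> s < t + e \<Longrightarrow>
       \<rho> s $ i = \<rho> t $ i + (s - t) * (exit_rate r i * (1 - hull_profile (supp (\<zeta> t)) i))"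
    using orp_right_local[OF t] by metis
  let ?a = "hull_profile (supp (\<zeta> t))"
  note ne = simplex_supp_nonempty[OF orp_simplex[OF t]]
  have "\<zeta> s = \<zeta> t + (s - t) *\<^sub>R local_drift r (\<zeta> t)" if s: "t \<le> s" "s < t + e" for s
  proof -
    have "s - \<rho> s $ i / exit_rate r i = (t - \<rho> t $ i / exit_rate r i) + (s - t) * ?a i" for i
    proof (cases "exit_rate r i = 0")
      case True
      obtain j where "j \<in> supp (\<zeta> t)" using ne by blast
      moreover have "j = i" using True by (rule exit_rate_zero)
      moreover have "obstacle (supp (\<zeta> t)) ?a" using ne by (rule obstacle_hull_profile)
      ultimately have "?a i = 1" by (simp add: obstacle_def)
      then show ?thesis using True by simp
    next
      case False
      then show ?thesis by (simp add: e(2)[OF s] field_simps)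
    qed
    then have eq: "(\<lambda>i. s - \<rho> s $ i / exit_rate r i) = (\<lambda>i. (t - \<rho> t $ i / exit_rate r i) + (s - t) * ?a i)"
      by blast
    have "\<zeta> s $ j = \<zeta> t $ j + (s - t) * adj r ?a j" for j
      using t s(1) by (simp only: orp_nth[of s] orp_nth[of t] order_trans[OF t s(1)] eq adj_add adj_scale)
    then show ?thesis by (simp add: vec_eq_iff local_drift_nth[OF ne])
  qed
  with e(1) show "\<exists>e>0. \<forall>s. t \<le> s \<and> s < t + e \<longrightarrow> \<zeta> s = \<zeta> t + (s - t) *\<^sub>R local_drift r (\<zeta> t)"
    by blast
qed

end

lemma orp_unique:
  assumes u: "u \<in> prob_simplex"
    and sol: "(\<zeta>, \<rho>) \<in> orp_solutions r (linear_input r u)" "(\<xi>, \<sigma>) \<in> orp_solutions r (linear_input r u)"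
  shows "\<zeta> = \<xi>" "\<rho> = \<sigma>"
proof -
  have eq: "\<zeta> t = \<xi> t" if "0 \<le> t" for t
    using follows_drift_unique[OF orp_follows_drift[OF u sol(1)] orp_follows_drift[OF u sol(2)] _ that]
      orp_start_path[OF u sol(1)] orp_start_path[OF u sol(2)] by simp
  show "\<zeta> = \<xi>"
    by (rule extensionalityI[of _ "{0..}"])
      (use orp_cadlag[OF u sol(1)] orp_cadlag[OF u sol(2)] eq in \<open>auto simp: cadlag_paths_def\<close>)
  have "\<rho> t $ i = \<sigma> t $ i" if "0 \<le> t" for t i
    using that
  proof (rule eq_of_right_local_eq[of 0, rotated 3])
    fix t :: real assume t: "0 \<le> t" "\<rho> t $ i = \<sigma> t $ i"
    let ?c = "exit_rate r i * (1 - hull_profile (supp (\<zeta> t)) i)"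
    obtain e where e: "0 < e" "\<And>s i. t \<le> s \<Longrightarrow> s < t + e \<Longrightarrow>
       \<rho> s $ i = \<rho> t $ i + (s - t) * (exit_rate r i * (1 - hull_profile (supp (\<zeta> t)) i))"
      using orp_right_local[OF u sol(1) t(1)] by metis
    obtain d where d: "0 < d" "\<And>s i. t \<le> s \<Longrightarrow> s < t + d \<Longrightarrow>
       \<sigma> s $ i = \<sigma> t $ i + (s - t) * (exit_rate r i * (1 - hull_profile (supp (\<xi> t)) i))"
      using orp_right_local[OF u sol(2) t(1)] by metis
    have "\<rho> s $ i = \<sigma> s $ i" if s: "t < s" "s < t + min e d" for s
      using e(2)[of s i] d(2)[of s i] s eq[OF t(1)] t(2) by simp
    then show "\<exists>e>0. \<forall>s. t < s \<and> s < t + e \<longrightarrow> \<rho> s $ i = \<sigma> s $ i"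
      using e(1) d(1) by (metis min_less_iff_conj)
  qed (simp_all add: orp_continuous[OF u sol(1)] orp_continuous[OF u sol(2)]
      orp_start[OF u sol(1)] orp_start[OF u sol(2)])
  then have eq': "\<rho> t = \<sigma> t" if "0 \<le> t" for t using that by (simp add: vec_eq_iff)
  show "\<rho> = \<sigma>"
    by (rule extensionalityI[of _ "{0..}"])
      (use orp_cadlag[OF u sol(1)] orp_cadlag[OF u sol(2)] eq' in \<open>auto simp: cadlag_paths_def\<close>)
qed

text \<open>Coordinates in the support persist by continuity. The others start from 0 with slope
  given by the drift, which off the support is positive exactly on the hull.\<close>

lemma follows_drift_supp:
  assumes \<zeta>: "follows_drift a \<zeta>" "a \<le> t" and sx: "\<zeta> t \<in> prob_simplex"
  obtains e where "0 < e" "\<And>s. t < s \<Longrightarrow> s < t + e \<Longrightarrow> supp (\<zeta> s) = absorbing_hull r (supp (\<zeta> t))"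
proof -
  let ?v = "\<zeta> t" and ?b = "local_drift r (\<zeta> t)" and ?A = "absorbing_hull r (supp (\<zeta> t))"
  note ne = simplex_supp_nonempty[OF sx]
  obtain d where d: "0 < d" "\<And>s. t \<le> s \<Longrightarrow> s < t + d \<Longrightarrow> \<zeta> s = ?v + (s - t) *\<^sub>R ?b"
    using follows_drift_right[OF \<zeta>] by metis
  obtain e where e: "0 < e" "\<And>s. a \<le> s \<Longrightarrow> \<bar>s - t\<bar> < e \<Longrightarrow> supp ?v \<subseteq> supp (\<zeta> s)"
    using supp_persists[OF follows_drift_continuous[OF \<zeta>(1)] \<zeta>(2)] by blast
  have "supp (\<zeta> s) = ?A" if "t < s" "s < t + min e d" for s
  proof -
    have s: "t < s" "s < t + e" "s < t + d"
      using that min.cobounded1[of e d] min.cobounded2[of e d] by linarith+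
    have "i \<in> supp (\<zeta> s) \<longleftrightarrow> i \<in> ?A" for i
    proof (cases "i \<in> supp ?v")
      case True
      then have "i \<in> ?A" using absorbing_hull_superset[OF ne] by blast
      moreover have "i \<in> supp (\<zeta> s)" using e(2)[of s] s \<zeta>(2) True by auto
      ultimately show ?thesis by blast
    next
      case False
      then have "\<zeta> s $ i = (s - t) * ?b $ i"
        using d(2)[of s] s supp_zero[OF False sx] by simp
      moreover have "0 < ?b $ i \<longleftrightarrow> i \<in> ?A"
        using local_drift_pos[OF ne _ False] local_drift_off_hull[of i ?v] by (cases "i \<in> ?A") auto
      ultimately show ?thesis using s by (simp add: supp_def zero_less_mult_iff)
    qed
    then show ?thesis by blast
  qed
  then show thesis using e(1) d(1) that[of "min e d"] by simp
qed

lemma absorbing_hull_idem: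
  assumes "S \<noteq> {}"
  shows "absorbing_hull r (absorbing_hull r S) = absorbing_hull r S"
  by (rule absorbing_hull_absorbing)
    (use assms absorbing_hull_superset[OF assms] absorbing_absorbing_hull[OF assms] in auto)

lemma hull_profile_bounds:
  assumes "S \<noteq> {}"
  shows "0 \<le> hull_profile S i" "hull_profile S i \<le> 1" "i \<in> S \<Longrightarrow> hull_profile S i = 1"
proof -
  show "0 \<le> hull_profile S i"
    by (rule obstacle_greatest[OF assms obstacle_hull_profile[OF assms], of "\<lambda>_. 0"]) auto
qed (use obstacle_hull_profile[OF assms] in \<open>auto simp: obstacle_def\<close>)

end

section \<open>Construction of the reflection term for a path that follows the drift\<close>

lemma continuous_on_Ici_bounded:
  fixes f :: "real \<Rightarrow> 'a::topological_space"
  assumes "\<And>b. a \<le> b \<Longrightarrow> continuous_on {a..b} f"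
  shows "continuous_on {a..} f"
  unfolding continuous_on_def
proof
  fix t assume t: "t \<in> {a..}"
  have "at t within {a..} = at t within {a..t + 1}"
    by (rule at_within_nhd[of t "{..<t + 1}"]) (use t in auto)
  then show "(f \<longlongrightarrow> f t) (at t within {a..})"
    using assms[of "t + 1"] t by (auto simp: continuous_on_def)
qed

lemma continuous_imp_cadlag:
  assumes "continuous_on {0..} f" "f \<in> extensional {0..}"
  shows "f \<in> cadlag_paths"
proof -
  have lim: "(f \<longlongrightarrow> f t) (at t within {0..})" if "0 \<le> t" for t
    using assms(1) that by (simp add: continuous_on_def)
  have "(f \<longlongrightarrow> f t) (at_right t)" if "0 \<le> t" for t
    by (rule tendsto_within_subset[OF lim[OF that]]) (use that in auto)
  moreover have "(f \<longlongrightarrow> f t) (at_left t)" if "0 < t" for t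
  proof -
    have "at t within {0..} = at t" using that by (intro at_within_interior) simp
    then show ?thesis using lim[of t] that by (simp add: filterlim_at_split)
  qed
  ultimately show ?thesis using assms(2) by (auto simp: cadlag_paths_def)
qed

context irreducible_walk
begin

context
  fixes \<zeta> :: "real \<Rightarrow> real ^ 'v"
  assumes drift: "follows_drift 0 \<zeta>" and simplex: "\<And>t. 0 \<le> t \<Longrightarrow> \<zeta> t \<in> prob_simplex"
    and ext: "\<zeta> \<in> extensional {0..}"
begin

text \<open>In a solution of the reflection problem, \<open>orp_right_local\<close> forces the
  reflection at i to grow at this rate times the exit rate.\<close>

definition push_rate :: "'v \<Rightarrow> real \<Rightarrow> real" where
  "push_rate i s = 1 - hull_profile (supp (\<zeta> s)) i"

lemma push_rate_bounds: "0 \<le> s \<Longrightarrow> 0 \<le> push_rate i s" "0 \<le> s \<Longrightarrow> push_rate i s \<le> 1"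
  using hull_profile_bounds[OF simplex_supp_nonempty[OF simplex]] by (auto simp: push_rate_def)

lemma push_rate_supp: "0 \<le> s \<Longrightarrow> 0 < \<zeta> s $ i \<Longrightarrow> push_rate i s = 0"
  using hull_profile_bounds(3)[OF simplex_supp_nonempty[OF simplex]] by (auto simp: push_rate_def supp_def)

text \<open>The rate depends on the path only through its support, which takes finitely many values,
  each on a measurable set of times; this bypasses any count of breakpoints.\<close>

lemma push_rate_integrable:
  assumes "0 \<le> a"
  shows "push_rate i integrable_on {a..b}"
proof -
  have "continuous_on {a..b} \<zeta>"
    using follows_drift_continuous[OF drift] by (rule continuous_on_subset) (use assms in auto)
  then have "(\<lambda>s. \<zeta> s $ j) \<in> borel_measurable (lebesgue_on {a..b})" for j
    by (intro continuous_imp_measurable_on_sets_lebesgue continuous_intros) auto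
  then have [measurable]: "Measurable.pred (lebesgue_on {a..b}) (\<lambda>s. 0 < \<zeta> s $ j)" for j
    by measurable
  have [measurable]: "Measurable.pred (lebesgue_on {a..b}) (\<lambda>s. supp (\<zeta> s) = T)" for T
    unfolding supp_def set_eq_iff mem_Collect_eq by measurable
  have eq: "push_rate i = (\<lambda>s. \<Sum>T\<in>UNIV. if supp (\<zeta> s) = T then 1 - hull_profile T i else 0)"
    by (simp add: push_rate_def fun_eq_iff)
  have "push_rate i \<in> borel_measurable (lebesgue_on {a..b})"
    unfolding eq by measurable
  then show ?thesis
    by (rule measurable_bounded_by_integrable_imp_integrable[where g = "\<lambda>_. 1"])
      (use push_rate_bounds assms in \<open>auto simp: integrable_const_ivl\<close>)
qed

definition push :: "'v \<Rightarrow> real \<Rightarrow> real" where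
  "push i t = integral {0..t} (push_rate i)"

lemma push_diff:
  assumes "0 \<le> s" "s \<le> t"
  shows "push i t - push i s = integral {s..t} (push_rate i)"
  using Henstock_Kurzweil_Integration.integral_combine[OF assms push_rate_integrable[OF order_refl, of i t]]
  unfolding push_def by linarith

lemma push_mono:
  assumes "0 \<le> s" "s \<le> t"
  shows "push i s \<le> push i t"
proof -
  have "0 \<le> integral {s..t} (push_rate i)"
    using assms push_rate_bounds by (intro integral_nonneg push_rate_integrable) auto
  then show ?thesis using push_diff[OF assms, of i] by simp
qed

lemma push_continuous: "continuous_on {0..} (push i)"
  unfolding push_def[abs_def]
  by (intro continuous_on_Ici_bounded indefinite_integral_continuous_1 push_rate_integrable) simp

lemma push_flat:
  assumes "0 \<le> s" "s \<le> t" "\<And>x. s < x \<Longrightarrow> x < t \<Longrightarrow> 0 < \<zeta> x $ i"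
  shows "push i t = push i s"
proof -
  have "integral {s..t} (push_rate i) = integral {s..t} (\<lambda>_. 0)"
    by (rule integral_spike[of "{s, t}"]) (use assms push_rate_supp in auto)
  then show ?thesis using push_diff[OF assms(1,2), of i] by simp
qed

lemma push_right_local:
  assumes t: "0 \<le> t"
  obtains e where "0 < e" "\<And>s i. t \<le> s \<Longrightarrow> s < t + e \<Longrightarrow> push i s = push i t + (s - t) * push_rate i t"
proof -
  note ne = simplex_supp_nonempty[OF simplex[OF t]]
  obtain e where e: "0 < e" "\<And>s. t < s \<Longrightarrow> s < t + e \<Longrightarrow> supp (\<zeta> s) = absorbing_hull r (supp (\<zeta> t))"
    using follows_drift_supp[OF drift t simplex[OF t]] by metis
  have rate: "push_rate i x = push_rate i t" if "t \<le> x" "x < t + e" for x i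
  proof (cases "x = t")
    case False
    then have "supp (\<zeta> x) = absorbing_hull r (supp (\<zeta> t))" using that by (intro e(2)) auto
    then show ?thesis by (simp add: push_rate_def hull_profile_def absorbing_hull_idem[OF ne])
  qed simp
  have "push i s = push i t + (s - t) * push_rate i t" if s: "t \<le> s" "s < t + e" for s i
  proof -
    have "integral {t..s} (push_rate i) = integral {t..s} (\<lambda>_. push_rate i t)"
      by (rule Henstock_Kurzweil_Integration.integral_cong) (rule rate, use s in auto)
    then show ?thesis using push_diff[OF t s(1), of i] s(1) by simp
  qed
  with e(1) show thesis by (rule that)
qed

lemma push_zero_exit_rate:
  assumes "exit_rate r i = 0" "0 \<le> t"
  shows "push i t = 0"
proof -
  have "0 < \<zeta> x $ i" if x: "0 \<le> x" for x
  proof -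
    obtain j where "j \<in> supp (\<zeta> x)" using simplex_supp_nonempty[OF simplex[OF x]] by blast
    moreover have "j = i" using assms(1) by (rule exit_rate_zero)
    ultimately show ?thesis by (simp add: supp_def)
  qed
  then have "push i t = push i 0" using assms(2) by (intro push_flat) auto
  then show ?thesis by (simp add: push_def)
qed

text \<open>Both sides have the same right slope at each time of agreement:
  \<open>1 - push_rate i t\<close> is the hull profile, and L* of it is the local drift.\<close>

lemma push_equation:
  assumes "0 \<le> t"
  shows "\<zeta> t $ j = \<zeta> 0 $ j + adj r (\<lambda>i. t - push i t) j"
  using assms
proof (rule eq_of_right_local_eq[of 0, rotated 3])
  show "continuous_on {0..} (\<lambda>t. \<zeta> t $ j)"
    by (intro continuous_intros follows_drift_continuous[OF drift])
  show "continuous_on {0..} (\<lambda>t. \<zeta> 0 $ j + adj r (\<lambda>i. t - push i t) j)"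
    unfolding adj_def by (intro continuous_intros push_continuous)
  show "\<zeta> 0 $ j = \<zeta> 0 $ j + adj r (\<lambda>i. 0 - push i 0) j"
    by (simp add: push_def)
next
  fix t assume t: "0 \<le> t" "\<zeta> t $ j = \<zeta> 0 $ j + adj r (\<lambda>i. t - push i t) j"
  note ne = simplex_supp_nonempty[OF simplex[OF t(1)]]
  obtain d where d: "0 < d" "\<And>s. t \<le> s \<Longrightarrow> s < t + d \<Longrightarrow> \<zeta> s = \<zeta> t + (s - t) *\<^sub>R local_drift r (\<zeta> t)"
    using follows_drift_right[OF drift t(1)] by metis
  obtain e where e: "0 < e" "\<And>s i. t \<le> s \<Longrightarrow> s < t + e \<Longrightarrow> push i s = push i t + (s - t) * push_rate i t"
    using push_right_local[OF t(1)] by metis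
  have "\<zeta> s $ j = \<zeta> 0 $ j + adj r (\<lambda>i. s - push i s) j" if s: "t < s" "s < t + e" "s < t + d" for s
  proof -
    have "(\<lambda>i. s - push i s) = (\<lambda>i. (t - push i t) + (s - t) * hull_profile (supp (\<zeta> t)) i)"
      using e(2)[of s] s by (simp add: fun_eq_iff push_rate_def algebra_simps)
    then have "\<zeta> 0 $ j + adj r (\<lambda>i. s - push i s) j = \<zeta> t $ j + (s - t) * local_drift r (\<zeta> t) $ j"
      by (simp add: t(2) adj_add adj_scale local_drift_nth[OF ne])
    also have "\<dots> = \<zeta> s $ j" using d(2)[of s] s by simp
    finally show ?thesis by simp
  qed
  then show "\<exists>e>0. \<forall>s. t < s \<and> s < t + e \<longrightarrow> \<zeta> s $ j = \<zeta> 0 $ j + adj r (\<lambda>i. s - push i s) j"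
    using e(1) d(1) by (intro exI[of _ "min e d"]) auto
qed

text \<open>The integral condition says that the times at which coordinate i is nonzero form a null
  set for the Stieltjes measure of \<rho>. By continuity they are covered by countably many rational
  intervals on which the push at i is constant.\<close>

lemma follows_drift_orp:
  "(\<zeta>, \<lambda>t\<in>{0..}. \<chi> i. exit_rate r i * push i t) \<in> orp_solutions r (linear_input r (\<zeta> 0))"
proof -
  define \<rho> where "\<rho> = (\<lambda>t\<in>{0..}. \<chi> i. exit_rate r i * push i t)"
  have \<rho>: "\<rho> t $ i = exit_rate r i * push i t" if "0 \<le> t" for t i
    using that by (simp add: \<rho>_def)
  have exit: "0 \<le> exit_rate r i" for i
    unfolding exit_rate_def by (intro sum_nonneg rate_nonneg)
  have cont_i: "continuous_on {0..} (\<lambda>t. \<rho> t $ i)" for i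
    by (rule continuous_on_eq[OF continuous_on_mult_left[OF push_continuous]]) (simp add: \<rho>)
  have cont: "continuous_on {0..} \<rho>"
  proof -
    have "continuous_on {0..} (\<lambda>t. \<chi> i. \<rho> t $ i)" by (intro continuous_on_vec_lambda cont_i)
    then show ?thesis by simp
  qed
  have cadlag: "\<rho> \<in> cadlag_paths"
    by (rule continuous_imp_cadlag[OF cont]) (simp add: \<rho>_def)
  have mono: "mono_on {0..} (\<lambda>t. \<rho> t $ i)" for i
    by (rule mono_onI) (auto simp: \<rho> intro!: mult_left_mono push_mono exit)
  have equation: "\<zeta> t = linear_input r (\<zeta> 0) t + (\<Sum>i\<in>UNIV. \<rho> t $ i *\<^sub>R reflection_vector r i)" if "0 \<le> t" for t
  proof -
    have "\<rho> t $ i / exit_rate r i = push i t" for i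
      using that by (cases "exit_rate r i = 0") (simp_all add: \<rho> push_zero_exit_rate)
    then have "(linear_input r (\<zeta> 0) t + (\<Sum>i\<in>UNIV. \<rho> t $ i *\<^sub>R reflection_vector r i)) $ j
        = \<zeta> 0 $ j + (adj r (\<lambda>i. t * 1) j - adj r (\<lambda>i. push i t) j)" for j
      unfolding vector_add_component reflection_sum_nth linear_input_nth[OF that] adj_scale by simp
    then show ?thesis
      using push_equation[OF that] by (simp add: vec_eq_iff adj_diff)
  qed
  have integral: "\<rho> t $ i = (LINT s:{0<..t}|interval_measure (\<lambda>s. \<rho> (max 0 s) $ i).
      indicator {s. \<zeta> s $ i = 0} s)" if t: "0 \<le> t" for t i
  proof -
    let ?M = "interval_measure (\<lambda>s. \<rho> (max 0 s) $ i)"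
    let ?Z = "{s. \<zeta> s $ i = 0}"
    have right: "((\<lambda>t. \<rho> t $ i) \<longlongrightarrow> \<rho> s $ i) (at_right s)" if "0 \<le> s" for s
      using cadlag that by (auto simp: cadlag_paths_def intro!: tendsto_vec_nth)
    note Ioc = stieltjes_measure_Ioc[OF mono[of i] right]
    define N where "N = {s \<in> {0<..t}. \<zeta> s $ i \<noteq> 0}"
    have "closed {s \<in> {0..}. \<zeta> s $ i = 0}"
      by (intro continuous_closed_preimage_constant continuous_intros follows_drift_continuous[OF drift])
    then have "{0<..t} - {s \<in> {0..}. \<zeta> s $ i = 0} \<in> sets borel" by (intro sets.Diff) auto
    also have "{0<..t} - {s \<in> {0..}. \<zeta> s $ i = 0} = N" by (auto simp: N_def)
    finally have N: "N \<in> sets ?M" by simp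
    \<comment> \<open>Equal values at the endpoints suffice, since the Stieltjes mass of {p<..q} is
      their difference.\<close>
    define Q where "Q = {(p, q). p \<in> \<rat> \<and> q \<in> \<rat> \<and> 0 \<le> p \<and> p \<le> q \<and> \<rho> p $ i = \<rho> q $ i}"
    have "countable Q"
      by (rule countable_subset[of _ "\<rat> \<times> \<rat>"]) (auto simp: Q_def countable_rat)
    have "N \<subseteq> (\<Union>(p, q)\<in>Q. {p<..q})"
    proof
      fix s assume s: "s \<in> N"
      then have s0: "0 < s" "i \<in> supp (\<zeta> s)"
        using simplex[of s] by (auto simp: N_def supp_def prob_simplex_iff less_le)
      obtain e where e: "0 < e" "\<And>x. 0 \<le> x \<Longrightarrow> \<bar>x - s\<bar> < e \<Longrightarrow> supp (\<zeta> s) \<subseteq> supp (\<zeta> x)"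
        using supp_persists[OF follows_drift_continuous[OF drift] less_imp_le[OF s0(1)]] by blast
      obtain p where p: "p \<in> \<rat>" "max 0 (s - e) < p" "p < s"
        using Rats_dense_in_real[of "max 0 (s - e)" s] s0 e(1) by auto
      obtain q where q: "q \<in> \<rat>" "s < q" "q < s + e"
        using Rats_dense_in_real[of s "s + e"] e(1) by auto
      have "push i q = push i p"
      proof (rule push_flat)
        fix x assume "p < x" "x < q"
        then have "supp (\<zeta> s) \<subseteq> supp (\<zeta> x)" using p q by (intro e(2)) (auto simp: abs_less_iff)
        then show "0 < \<zeta> x $ i" using s0 by (auto simp: supp_def)
      qed (use p q in auto)
      then have "(p, q) \<in> Q" using p q by (auto simp: Q_def \<rho>)
      moreover have "s \<in> {p<..q}" using p q by auto
      ultimately show "s \<in> (\<Union>(p, q)\<in>Q. {p<..q})" by blast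
    qed
    moreover have "(\<Union>(p, q)\<in>Q. {p<..q}) \<in> null_sets ?M"
      unfolding case_prod_beta
    proof (rule null_sets_UN'[OF \<open>countable Q\<close>])
      fix x assume "x \<in> Q"
      then show "{fst x<..snd x} \<in> null_sets ?M"
        using Ioc[of "fst x" "snd x"] by (auto simp: Q_def null_sets_def)
    qed
    ultimately have "N \<in> null_sets ?M" using N null_sets_subset by blast
    then have "measure ?M ({0<..t} - N) = measure ?M {0<..t}"
      by (intro measure_Diff_null_set) auto
    also have "\<dots> = \<rho> t $ i"
      using Ioc[of 0 t] t mono_onD[OF mono, of 0 t i] by (simp add: measure_def \<rho> push_def)
    also have "{0<..t} - N = {0<..t} \<inter> ?Z" by (auto simp: N_def)
    finally show ?thesis
      by (simp add: set_lebesgue_integral_def indicator_inter_arith[symmetric])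
  qed
  have "\<zeta> \<in> cadlag_paths"
    using follows_drift_continuous[OF drift] ext by (rule continuous_imp_cadlag)
  moreover have "0 \<le> \<zeta> t $ i" if "0 \<le> t" for t i using simplex[OF that] by (simp add: prob_simplex_iff)
  ultimately show ?thesis
    unfolding orp_solutions_def mem_Collect_eq case_prod_conv \<rho>_def[symmetric]
    using cadlag mono integral equation by blast
qed

end

end

section \<open>Test functions\<close>

lemma has_derivative_quadratic_remainder:
  fixes f :: "'a::real_normed_vector \<Rightarrow> 'b::real_normed_vector"
  assumes L: "bounded_linear L" and rem: "\<And>y. norm (f y - f x - L (y - x)) \<le> (norm (y - x))\<^sup>2"
  shows "(f has_derivative L) (at x)"
proof (rule has_derivativeI[OF L])
  show "((\<lambda>y. ((f y - f x) - L (y - x)) /\<^sub>R norm (y - x)) \<longlongrightarrow> 0) (at x)"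
  proof (rule Lim_null_comparison)
    show "\<forall>\<^sub>F y in at x. norm (((f y - f x) - L (y - x)) /\<^sub>R norm (y - x)) \<le> norm (y - x)"
    proof (rule always_eventually, rule allI)
      fix y
      show "norm (((f y - f x) - L (y - x)) /\<^sub>R norm (y - x)) \<le> norm (y - x)"
      proof -
        have "norm (((f y - f x) - L (y - x)) /\<^sub>R norm (y - x)) = norm (f y - f x - L (y - x)) / norm (y - x)"
          by (simp add: divide_inverse_commute)
        also have "\<dots> \<le> (norm (y - x))\<^sup>2 / norm (y - x)" by (intro divide_right_mono rem) simp
        also have "\<dots> \<le> norm (y - x)" by (cases "y = x") (simp_all add: power2_eq_square)
        finally show ?thesis .
      qed
    qed
    have "((\<lambda>y. norm (y - x)) \<longlongrightarrow> norm (x - x)) (at x)" by (intro tendsto_intros)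
    then show "((\<lambda>y. norm (y - x)) \<longlongrightarrow> 0) (at x)" by simp
  qed
qed

lemma pos_part_square_deriv: "((\<lambda>x. (max 0 x)\<^sup>2) has_real_derivative 2 * max 0 x) (at x)"
proof -
  have "\<bar>(max 0 y)\<^sup>2 - (max 0 x)\<^sup>2 - 2 * max 0 x * (y - x)\<bar> \<le> (y - x)\<^sup>2" for y
  proof (cases "0 \<le> x")
    case True
    show ?thesis
    proof (cases "0 \<le> y")
      case True
      have "y\<^sup>2 - x\<^sup>2 - 2 * x * (y - x) = (y - x)\<^sup>2" by (simp add: power2_eq_square algebra_simps)
      then show ?thesis using True \<open>0 \<le> x\<close> by simp
    next
      case False
      then have "x * y \<le> 0" using True by (intro mult_nonneg_nonpos) auto
      moreover have "(y - x)\<^sup>2 = y\<^sup>2 - 2 * (x * y) + x\<^sup>2"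
        by (simp add: power2_eq_square algebra_simps)
      moreover have "(max 0 y)\<^sup>2 - (max 0 x)\<^sup>2 - 2 * max 0 x * (y - x) = x\<^sup>2 - 2 * (x * y)"
        using True False by (simp add: max_def power2_eq_square algebra_simps)
      ultimately show ?thesis using zero_le_power2[of x] zero_le_power2[of y] by linarith
    qed
  next
    case False
    show ?thesis
    proof (cases "0 \<le> y")
      case True
      then have "y\<^sup>2 \<le> (y - x)\<^sup>2" using False by (intro power_mono) auto
      then show ?thesis using True False by (simp add: max_def)
    next
      case False
      then show ?thesis using \<open>\<not> 0 \<le> x\<close> by (simp add: max_def)
    qed
  qed
  then have "((\<lambda>x. (max 0 x)\<^sup>2) has_derivative (*) (2 * max 0 x)) (at x)"
    by (intro has_derivative_quadratic_remainder bounded_linear_mult_right) simp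
  then show ?thesis by (simp add: has_field_derivative_def)
qed

text \<open>A quotient p / (p + q) of squared positive parts: p vanishes from 2 c on and q up to c,
  and c > 0 prevents both from vanishing at once. Squaring makes the derivatives continuous.\<close>

lemma C1_cutoff_exists:
  assumes "0 < (c::real)"
  obtains \<phi> \<phi>' :: "real \<Rightarrow> real" where "\<And>x. (\<phi> has_real_derivative \<phi>' x) (at x)" "continuous_on UNIV \<phi>'"
    "\<And>x. x \<le> c \<Longrightarrow> \<phi> x = 1 \<and> \<phi>' x = 0" "\<And>x. 2 * c \<le> x \<Longrightarrow> \<phi> x = 0 \<and> \<phi>' x = 0"
proof -
  define p q where "p x = (max 0 (2 * c - x))\<^sup>2" and "q x = (max 0 (x - c))\<^sup>2" for x :: real
  define p' q' where "p' x = - (2 * max 0 (2 * c - x))" and "q' x = 2 * max 0 (x - c)" for x :: real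
  define \<phi> where "\<phi> x = p x / (p x + q x)" for x
  define \<phi>' where "\<phi>' x = (p' x * (p x + q x) - p x * (p' x + q' x)) / (p x + q x)\<^sup>2" for x
  have pq: "0 < p x + q x" for x
  proof (cases "x < 2 * c")
    case True
    then have "0 < p x" by (simp add: p_def)
    moreover have "0 \<le> q x" by (simp add: q_def)
    ultimately show ?thesis by simp
  next
    case False
    then have "0 < q x" using assms by (simp add: q_def)
    moreover have "0 \<le> p x" by (simp add: p_def)
    ultimately show ?thesis by simp
  qed
  have p: "(p has_real_derivative p' x) (at x)" for x
  proof -
    have "((\<lambda>x. 2 * c - x) has_real_derivative - 1) (at x)" by (auto intro!: derivative_eq_intros)
    from DERIV_chain2[OF pos_part_square_deriv this] show ?thesis by (simp add: p_def[abs_def] p'_def)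
  qed
  have q: "(q has_real_derivative q' x) (at x)" for x
  proof -
    have "((\<lambda>x. x - c) has_real_derivative 1) (at x)" by (auto intro!: derivative_eq_intros)
    from DERIV_chain2[OF pos_part_square_deriv this] show ?thesis by (simp add: q_def[abs_def] q'_def)
  qed
  have "(\<phi> has_real_derivative \<phi>' x) (at x)" for x
    unfolding \<phi>_def[abs_def] \<phi>'_def power2_eq_square
    by (rule DERIV_divide[OF p DERIV_add[OF p q]]) (use pq[of x] in simp)
  moreover have "continuous_on UNIV \<phi>'"
  proof -
    have cp: "continuous_on UNIV p" "continuous_on UNIV q" "continuous_on UNIV p'" "continuous_on UNIV q'"
      unfolding p_def[abs_def] q_def[abs_def] p'_def[abs_def] q'_def[abs_def] by (intro continuous_intros)+
    show ?thesis
      unfolding \<phi>'_def[abs_def]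
    proof (intro continuous_on_divide continuous_on_diff continuous_on_mult continuous_on_add continuous_on_power cp)
      have "p x + q x \<noteq> 0" for x using pq[of x] by linarith
      then show "\<forall>x\<in>UNIV. (p x + q x)\<^sup>2 \<noteq> 0" by simp
    qed
  qed
  moreover have "\<phi> x = 1 \<and> \<phi>' x = 0" if "x \<le> c" for x
    using that pq[of x] by (simp add: \<phi>_def \<phi>'_def q_def q'_def max_def)
  moreover have "\<phi> x = 0 \<and> \<phi>' x = 0" if "2 * c \<le> x" for x
    using that by (simp add: \<phi>_def \<phi>'_def p_def p'_def max_def)
  ultimately show thesis by (rule that)
qed

text \<open>The functions built below are C1 everywhere, so gradients are global and the
  neighbourhood in \<open>C1_simplex\<close> can be \<open>UNIV\<close>.\<close>

definition has_grad :: "('a::real_inner \<Rightarrow> real) \<Rightarrow> ('a \<Rightarrow> 'a) \<Rightarrow> bool" where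
  "has_grad f g \<longleftrightarrow> (\<forall>x. (f has_derivative (\<lambda>h. g x \<bullet> h)) (at x)) \<and> continuous_on UNIV g"

lemma has_grad_linear: "has_grad (\<lambda>u. c \<bullet> u) (\<lambda>_. c)"
  unfolding has_grad_def by (auto intro!: derivative_eq_intros)

lemma has_grad_continuous: "has_grad f g \<Longrightarrow> continuous_on UNIV f"
  unfolding has_grad_def by (meson continuous_at_imp_continuous_on has_derivative_continuous)

lemma has_grad_add:
  assumes "has_grad f g" "has_grad f' g'"
  shows "has_grad (\<lambda>x. f x + f' x) (\<lambda>x. g x + g' x)"
  using assms unfolding has_grad_def
  by (auto intro!: continuous_intros has_derivative_eq_rhs[OF has_derivative_add] simp: inner_add_left)

lemma has_grad_zero: "has_grad (\<lambda>_. 0) (\<lambda>_. 0)"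
  unfolding has_grad_def by (auto intro!: derivative_eq_intros)

lemma has_grad_sum:
  assumes "finite I" "\<And>i. i \<in> I \<Longrightarrow> has_grad (f i) (g i)"
  shows "has_grad (\<lambda>x. \<Sum>i\<in>I. f i x) (\<lambda>x. \<Sum>i\<in>I. g i x)"
  using assms
proof (induction I rule: finite_induct)
  case (insert i I)
  then show ?case by (simp add: has_grad_add)
qed (simp add: has_grad_zero)

lemma has_grad_mult:
  assumes "has_grad f g" "has_grad f' g'"
  shows "has_grad (\<lambda>x. f x * f' x) (\<lambda>x. f x *\<^sub>R g' x + f' x *\<^sub>R g x)"
  unfolding has_grad_def
proof
  show "\<forall>x. ((\<lambda>x. f x * f' x) has_derivative (\<lambda>h. (f x *\<^sub>R g' x + f' x *\<^sub>R g x) \<bullet> h)) (at x)"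
    using assms unfolding has_grad_def
    by (auto intro!: has_derivative_eq_rhs[OF has_derivative_mult] simp: inner_add_left fun_eq_iff)
  show "continuous_on UNIV (\<lambda>x. f x *\<^sub>R g' x + f' x *\<^sub>R g x)"
    using assms has_grad_continuous[OF assms(1)] has_grad_continuous[OF assms(2)]
    unfolding has_grad_def by (auto intro!: continuous_intros)
qed

lemma has_grad_compose:
  assumes f: "has_grad f g" and \<phi>: "\<And>x. (\<phi> has_real_derivative \<phi>' x) (at x)" "continuous_on UNIV \<phi>'"
  shows "has_grad (\<lambda>x. \<phi> (f x)) (\<lambda>x. \<phi>' (f x) *\<^sub>R g x)"
  unfolding has_grad_def
proof
  show "\<forall>x. ((\<lambda>x. \<phi> (f x)) has_derivative (\<lambda>h. (\<phi>' (f x) *\<^sub>R g x) \<bullet> h)) (at x)"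
  proof
    fix x
    have "(f has_derivative (\<lambda>h. g x \<bullet> h)) (at x)" using f by (simp add: has_grad_def)
    from has_derivative_compose[OF this \<phi>(1)[of "f x", unfolded has_field_derivative_def]]
    show "((\<lambda>x. \<phi> (f x)) has_derivative (\<lambda>h. (\<phi>' (f x) *\<^sub>R g x) \<bullet> h)) (at x)" by simp
  qed
  have "continuous_on UNIV g" using f by (simp add: has_grad_def)
  then show "continuous_on UNIV (\<lambda>x. \<phi>' (f x) *\<^sub>R g x)"
    by (intro continuous_on_scaleR continuous_on_compose2[OF \<phi>(2) has_grad_continuous[OF f]]) auto
qed

lemma has_grad_dir_deriv: "has_grad f g \<Longrightarrow> dir_deriv w f u = g u \<bullet> w"
  unfolding dir_deriv_def has_grad_def using frechet_derivative_at by metis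

lemma has_grad_C1: "has_grad f g \<Longrightarrow> f \<in> C1_simplex"
  unfolding C1_simplex_def has_grad_def mem_Collect_eq
  by (intro exI[of _ UNIV] exI[of _ "\<lambda>x. blinfun_inner_right (g x)"])
    (auto intro!: bounded_linear.continuous_on[OF bounded_linear_blinfun_inner_right])

lemma has_grad_test_function:
  assumes "has_grad f g" "\<And>i u. u \<in> prob_simplex \<Longrightarrow> u $ i = 0 \<Longrightarrow> gen r (($) (g u)) i = 0"
  shows "f \<in> test_functions r"
  unfolding test_functions_def
  using assms by (auto simp: has_grad_C1 has_grad_dir_deriv inner_commute[of _ "jump_vector r _"] jump_vector_inner)

text \<open>Equal to \<open>((norm u)\<^sup>2 - (dist u (closest_point K u))\<^sup>2) / 2\<close>. Its gradient is the projection onto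
  \<open>K\<close>, which turns boundary conditions on derivatives into constraints on the cone \<open>K\<close>.\<close>
definition envelope :: "'a::euclidean_space set \<Rightarrow> 'a \<Rightarrow> real" where
  "envelope K u = closest_point K u \<bullet> u - (closest_point K u \<bullet> closest_point K u) / 2"

text \<open>Minimality of the distance, rewritten: the envelope is the maximum over g in K of the
  left-hand side, attained at the projection.\<close>

lemma envelope_ge:
  assumes "closed K" "g \<in> K"
  shows "g \<bullet> u - (g \<bullet> g) / 2 \<le> envelope K u"
proof -
  let ?p = "closest_point K u"
  have "norm (u - ?p) \<le> norm (u - g)"
    using closest_point_le[OF assms, of u] by (simp add: dist_norm)
  then have "(u - ?p) \<bullet> (u - ?p) \<le> (u - g) \<bullet> (u - g)" by (simp add: norm_le)
  then show ?thesis by (simp add: envelope_def inner_diff_left inner_diff_right inner_commute)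
qed

text \<open>The maximiser at u bounds the increment from below by its own linear term, and the
  maximiser at y bounds it from above; as the projection is 1-Lipschitz, the gap is at most the
  squared distance.\<close>

lemma has_grad_envelope:
  fixes K :: "'a::euclidean_space set"
  assumes K: "closed K" "convex K" "K \<noteq> {}"
  shows "has_grad (envelope K) (closest_point K)"
  unfolding has_grad_def
proof (intro conjI allI)
  fix u :: 'a
  let ?p = "closest_point K"
  show "(envelope K has_derivative (\<lambda>h. ?p u \<bullet> h)) (at u)"
  proof (rule has_derivative_quadratic_remainder)
    fix y
    have in_K: "?p x \<in> K" for x by (rule closest_point_in_set[OF K(1,3)])
    have lower: "0 \<le> envelope K y - envelope K u - ?p u \<bullet> (y - u)"
      using envelope_ge[OF K(1) in_K[of u], of y] by (simp add: envelope_def[of K u] inner_diff_right)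
    have "envelope K y - envelope K u - ?p u \<bullet> (y - u) \<le> (?p y - ?p u) \<bullet> (y - u)"
      using envelope_ge[OF K(1) in_K[of y], of u]
      by (simp add: envelope_def[of K y] inner_diff_right inner_diff_left)
    also have "\<dots> \<le> norm (?p y - ?p u) * norm (y - u)" by (rule norm_cauchy_schwarz)
    also have "\<dots> \<le> norm (y - u) * norm (y - u)"
      using closest_point_lipschitz[OF K(2,1,3), of y u] by (intro mult_right_mono) (simp_all add: dist_norm)
    finally show "norm (envelope K y - envelope K u - ?p u \<bullet> (y - u)) \<le> (norm (y - u))\<^sup>2"
      using lower by (simp add: power2_eq_square)
  qed (rule bounded_linear_inner_right)
qed (rule continuous_on_closest_point[OF K(2,1,3)])

section \<open>The cone of functions vanishing on a face and superharmonic off it\<close>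

context irreducible_walk
begin

text \<open>For nonempty A its elements are nonnegative, and some are positive everywhere off A.
  Hence a nonnegative u projects to 0 exactly when it has no mass off A.\<close>

definition super_cone :: "'v set \<Rightarrow> (real ^ 'v) set" where
  "super_cone A = {g. (\<forall>i\<in>A. g $ i = 0) \<and> (\<forall>k\<in>-A. gen r (($) g) k \<le> 0)}"

lemma zero_in_super_cone: "0 \<in> super_cone A"
  by (simp add: super_cone_def gen_def)

lemma closed_super_cone: "closed (super_cone A)"
proof -
  have "super_cone A = (\<Inter>i\<in>A. {g. g $ i = 0}) \<inter> (\<Inter>k\<in>-A. {g. gen r (($) g) k \<le> 0})"
    by (auto simp: super_cone_def)
  then show ?thesis
    unfolding gen_def
    by (auto intro!: closed_Int closed_INT closed_Collect_eq closed_Collect_le continuous_intros)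
qed

lemma gen_vec_add: "gen r (($) (x + y)) i = gen r (($) x) i + gen r (($) y) i"
  by (simp add: gen_def algebra_simps sum.distrib sum_subtractf)

lemma gen_vec_scale: "gen r (($) (c *\<^sub>R x)) i = c * gen r (($) x) i"
  by (simp add: gen_def algebra_simps sum_distrib_left)

lemma convex_super_cone: "convex (super_cone A)"
  unfolding convex_def super_cone_def
  by (auto simp: gen_vec_add gen_vec_scale intro!: add_nonpos_nonpos mult_nonneg_nonpos)

lemma super_cone_scale: "g \<in> super_cone A \<Longrightarrow> 0 \<le> c \<Longrightarrow> c *\<^sub>R g \<in> super_cone A"
  unfolding super_cone_def by (auto simp: gen_vec_scale mult_nonneg_nonpos)

lemma super_cone_nonneg:
  assumes "A \<noteq> {}" "g \<in> super_cone A"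
  shows "0 \<le> g $ i"
proof -
  have "- g $ i \<le> 0"
  proof (rule gen_max_principle[of "-A" "\<lambda>i. - g $ i"])
    show "0 \<le> gen r (\<lambda>i. - g $ i) i" if "i \<in> - A" for i
      using gen_scale[of r "-1" "($) g" i] assms(2) that by (simp add: super_cone_def)
  qed (use assms in \<open>auto simp: super_cone_def\<close>)
  then show ?thesis by simp
qed

text \<open>If the projection \<open>g\<close> were strictly superharmonic at \<open>k\<close>, then lowering it at
  \<open>k\<close> alone would stay in the cone, and optimality of \<open>g\<close> forces
  \<open>u $ k \<ge> g $ k > 0\<close>.\<close>
lemma gen_projection_zero:
  assumes "A \<noteq> {}" "k \<notin> A" "u $ k = 0"
  shows "gen r (($) (closest_point (super_cone A) u)) k = 0"
proof (rule ccontr)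
  let ?K = "super_cone A"
  define g where "g = closest_point ?K u"
  have K: "closed ?K" "convex ?K" "?K \<noteq> {}"
    using closed_super_cone convex_super_cone zero_in_super_cone by auto
  have g: "g \<in> ?K" unfolding g_def by (rule closest_point_in_set[OF K(1,3)])
  assume "gen r (($) (closest_point ?K u)) k \<noteq> 0"
  then have neg: "gen r (($) g) k < 0" using g assms(2) by (force simp: super_cone_def g_def less_le)
  note g0 = super_cone_nonneg[OF assms(1) g]
  have "0 < g $ k"
  proof (rule ccontr)
    assume "\<not> 0 < g $ k"
    then have "g $ k = 0" using g0[of k] by simp
    then have "0 \<le> gen r (($) g) k" unfolding gen_def by (auto intro!: sum_nonneg mult_nonneg_nonneg rate_nonneg g0)
    with neg show False by simp
  qed
  \<comment> \<open>Lowering g at k by c raises L g at k by c times the exit rate, which this choice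
    keeps within the slack; at all other states it can only lower L g. The added 1 avoids division
    by zero.\<close>
  define c where "c = - gen r (($) g) k / (exit_rate r k + 1)"
  have exit: "0 \<le> exit_rate r k" unfolding exit_rate_def by (intro sum_nonneg rate_nonneg)
  have c: "0 < c" "c * exit_rate r k \<le> - gen r (($) g) k"
  proof -
    show "0 < c" using neg exit unfolding c_def by (intro divide_pos_pos) auto
    then have "c * exit_rate r k \<le> c * (exit_rate r k + 1)" by simp
    also have "\<dots> = - gen r (($) g) k" using exit by (simp add: c_def)
    finally show "c * exit_rate r k \<le> - gen r (($) g) k" .
  qed
  have gen_axis: "gen r (($) (axis k (1::real))) j = r j k - (if j = k then exit_rate r k else 0)" for j
    using jump_vector_inner[of r j "axis k 1"] jump_vector_nth[of r j k] by (simp add: inner_axis eq_commute)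
  have "g + (- c) *\<^sub>R axis k 1 \<in> ?K"
    unfolding super_cone_def mem_Collect_eq
  proof (intro conjI ballI)
    fix i assume "i \<in> A"
    then show "(g + (- c) *\<^sub>R axis k 1) $ i = 0" using g assms(2) by (auto simp: super_cone_def axis_def)
  next
    fix j assume "j \<in> - A"
    then have "gen r (($) g) j \<le> 0" using g by (simp add: super_cone_def)
    moreover have "0 \<le> c * r j k" using c(1) rate_nonneg by simp
    ultimately show "gen r (($) (g + (- c) *\<^sub>R axis k 1)) j \<le> 0"
      unfolding gen_vec_add gen_vec_scale gen_axis using c(2) by (auto simp: algebra_simps)
  qed
  then have "(u - g) \<bullet> (g + (- c) *\<^sub>R axis k 1 - g) \<le> 0"
    unfolding g_def by (rule closest_point_dot[OF K(2,1)])
  then have "0 \<le> c * (u $ k - g $ k)" by (simp add: inner_axis)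
  then have "0 \<le> u $ k - g $ k" using c(1) by (simp only: zero_le_mult_iff) simp
  with \<open>0 < g $ k\<close> assms(3) show False by simp
qed

text \<open>The expected hitting time of A is such a function: it is 0 on A, and L of it is -1 off
  A. A zero off A would be a minimum, where L is nonnegative.\<close>

lemma strict_superharmonic_exists:
  assumes "A \<noteq> {}"
  obtains \<gamma> :: "real ^ 'v" where "\<gamma> \<in> super_cone A" "\<And>k. k \<notin> A \<Longrightarrow> 0 < \<gamma> $ k"
proof -
  obtain f where f: "\<And>i. i \<in> A \<Longrightarrow> f i = (if i \<in> A then 0 else -1)"
    "\<And>i. i \<notin> A \<Longrightarrow> gen r f i = (if i \<in> A then 0 else -1)"
    using gen_boundary_exists[OF assms, of "\<lambda>i. if i \<in> A then 0 else -1"] by metis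
  define \<gamma> :: "real ^ 'v" where "\<gamma> = (\<chi> i. f i)"
  have \<gamma>: "($) \<gamma> = f" by (simp add: \<gamma>_def fun_eq_iff)
  have K: "\<gamma> \<in> super_cone A" using f by (auto simp: super_cone_def \<gamma>)
  have "0 < \<gamma> $ k" if "k \<notin> A" for k
  proof (rule ccontr)
    assume "\<not> ?thesis"
    then have "\<gamma> $ k = 0" using super_cone_nonneg[OF assms K, of k] by simp
    then have "0 \<le> gen r (($) \<gamma>) k" unfolding gen_def
      by (auto intro!: sum_nonneg mult_nonneg_nonneg rate_nonneg super_cone_nonneg[OF assms K])
    then show False using f(2)[OF that] that by (simp add: \<gamma>)
  qed
  with K show thesis by (rule that)
qed

lemma envelope_super_cone_nonneg: "0 \<le> envelope (super_cone A) u"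
  using envelope_ge[OF closed_super_cone[of A] zero_in_super_cone[of A], of u] by simp

lemma envelope_super_cone_zero:
  assumes "\<And>k. k \<notin> A \<Longrightarrow> u $ k = 0"
  shows "envelope (super_cone A) u = 0"
proof -
  let ?g = "closest_point (super_cone A) u"
  have g: "?g \<in> super_cone A"
    using zero_in_super_cone by (intro closest_point_in_set closed_super_cone) auto
  have "?g \<bullet> u = 0"
    unfolding inner_vec_def using g assms by (intro sum.neutral) (auto simp: super_cone_def)
  then have "envelope (super_cone A) u \<le> 0" by (simp add: envelope_def)
  with envelope_super_cone_nonneg show ?thesis by (simp add: antisym)
qed

lemma drift_inner: "g \<bullet> drift r = (\<Sum>i\<in>UNIV. gen r (($) g) i)"
proof -
  have "g \<bullet> drift r = (\<Sum>i\<in>UNIV. adj r (\<lambda>_. 1) i * g $ i)"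
    by (simp add: inner_vec_def drift_eq_adj mult.commute)
  then show ?thesis using sum_mult_gen[of "\<lambda>_. 1" r "($) g"] by simp
qed

text \<open>The weights 1 in the pairing may be lowered by the trace profile, since duality pairs L*
  of the profile, zero off A, with g, zero on A. What remains has weights 1 - a, nonnegative because
  A is absorbing and zero on A.\<close>

lemma drift_super_cone:
  assumes "A \<noteq> {}" "absorbing r A" "g \<in> super_cone A"
  shows "g \<bullet> drift r \<le> 0"
proof -
  have "(\<Sum>i\<in>UNIV. trace_profile A i * gen r (($) g) i) = (\<Sum>i\<in>UNIV. adj r (trace_profile A) i * g $ i)"
    by (rule sum_mult_gen)
  also have "\<dots> = 0"
    using assms(3) adj_trace_profile_off[OF assms(1)] by (intro sum.neutral) (auto simp: super_cone_def)
  finally have "g \<bullet> drift r = (\<Sum>i\<in>UNIV. (1 - trace_profile A i) * gen r (($) g) i)"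
    by (simp add: drift_inner left_diff_distrib sum_subtractf)
  also have "\<dots> \<le> 0"
  proof (rule sum_nonpos)
    fix i
    have "trace_profile A i \<le> 1" using absorbing_iff_trace_profile_le[OF assms(1)] assms(2) by blast
    then show "(1 - trace_profile A i) * gen r (($) g) i \<le> 0"
      using assms(3) trace_profile_on[OF assms(1), of i]
      by (cases "i \<in> A") (auto simp: super_cone_def intro!: mult_nonneg_nonpos)
  qed
  finally show ?thesis .
qed

end

section \<open>Test functions along paths, and their localisation at a face\<close>

context irreducible_walk
begin

lemma continuous_dir_deriv_path:
  fixes \<zeta> :: "real \<Rightarrow> real ^ 'v"
  assumes "f \<in> C1_simplex" "continuous_on S \<zeta>" "\<And>t. t \<in> S \<Longrightarrow> \<zeta> t \<in> prob_simplex"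
  shows "continuous_on S (\<lambda>s. dir_deriv w f (\<zeta> s))"
proof -
  obtain U f' where U: "open U" "prob_simplex \<subseteq> U"
    "\<And>x. x \<in> U \<Longrightarrow> (f has_derivative blinfun_apply (f' x)) (at x)" "continuous_on U f'"
    using assms(1) by (auto simp: C1_simplex_def)
  have "continuous_on S (\<lambda>s. blinfun_apply (f' (\<zeta> s)) w)"
    by (intro continuous_intros continuous_on_compose2[OF U(4) assms(2)]) (use assms(3) U(2) in auto)
  moreover have "dir_deriv w f (\<zeta> s) = blinfun_apply (f' (\<zeta> s)) w" if "s \<in> S" for s
    unfolding dir_deriv_def using frechet_derivative_at[OF U(3)[of "\<zeta> s"]] assms(3)[OF that] U(2) by auto
  ultimately show ?thesis by (simp cong: continuous_on_cong)
qed

lemma continuous_test_path: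
  fixes \<zeta> :: "real \<Rightarrow> real ^ 'v"
  assumes "f \<in> C1_simplex" "continuous_on S \<zeta>" "\<And>t. t \<in> S \<Longrightarrow> \<zeta> t \<in> prob_simplex"
  shows "continuous_on S (\<lambda>s. f (\<zeta> s))"
proof -
  obtain U f' where U: "open U" "prob_simplex \<subseteq> U"
    "\<And>x. x \<in> U \<Longrightarrow> (f has_derivative blinfun_apply (f' x)) (at x)"
    using assms(1) by (auto simp: C1_simplex_def)
  have "continuous_on U f"
    using U(3) by (intro continuous_at_imp_continuous_on ballI has_derivative_continuous) auto
  then show ?thesis
    by (rule continuous_on_compose2[OF _ assms(2)]) (use assms(3) U(2) in auto)
qed

lemma local_drift_eq_sum:
  assumes "supp v \<noteq> {}"
  shows "local_drift r v = drift r - (\<Sum>i\<in>UNIV. (1 - hull_profile (supp v) i) *\<^sub>R jump_vector r i)"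
  by (simp only: vec_eq_iff vector_minus_component adj_eq_sum_jump_vector[symmetric] adj_diff
      drift_eq_adj local_drift_nth[OF assms]) simp

text \<open>Along a segment of the path only directions \<open>jump_vector r k\<close> with \<open>k\<close> off the
  hull of the support are missing from the drift, and there test functions have derivative zero.\<close>
lemma follows_drift_test_function:
  assumes \<zeta>: "follows_drift 0 \<zeta>" and simplex: "\<And>t. 0 \<le> t \<Longrightarrow> \<zeta> t \<in> prob_simplex"
    and f: "f \<in> test_functions r" and t: "0 \<le> t"
  shows "f (\<zeta> t) = f (\<zeta> 0) + integral {0..t} (\<lambda>s. dir_deriv (drift r) f (\<zeta> s))"
proof -
  let ?h = "\<lambda>s. dir_deriv (drift r) f (\<zeta> s)"
  have C1: "f \<in> C1_simplex" using f by (simp add: test_functions_def)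
  obtain U f' where U: "open U" "prob_simplex \<subseteq> U"
    "\<And>x. x \<in> U \<Longrightarrow> (f has_derivative blinfun_apply (f' x)) (at x)"
    using C1 by (auto simp: C1_simplex_def)
  have dir: "dir_deriv w f v = blinfun_apply (f' v) w" if "v \<in> prob_simplex" for v w
    unfolding dir_deriv_def using frechet_derivative_at[OF U(3)[of v]] that U(2) by auto
  note cont = follows_drift_continuous[OF \<zeta>]
  have cont_h: "continuous_on {0..} ?h"
    using simplex by (intro continuous_dir_deriv_path[OF C1 cont]) auto
  have int_h: "?h integrable_on {a..b}" if "0 \<le> a" for a b
    by (intro integrable_continuous_real continuous_on_subset[OF cont_h]) (use that in auto)
  show ?thesis
    using t
  proof (rule eq_of_right_local_eq[of 0, rotated 3])
    show "continuous_on {0..} (\<lambda>t. f (\<zeta> t))"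
      using simplex by (intro continuous_test_path[OF C1 cont]) auto
    show "continuous_on {0..} (\<lambda>t. f (\<zeta> 0) + integral {0..t} ?h)"
      by (intro continuous_intros continuous_on_Ici_bounded indefinite_integral_continuous_1 int_h) simp
    show "f (\<zeta> 0) = f (\<zeta> 0) + integral {0..0} ?h" by simp
  next
    fix t assume t: "0 \<le> t" "f (\<zeta> t) = f (\<zeta> 0) + integral {0..t} ?h"
    let ?A = "absorbing_hull r (supp (\<zeta> t))" and ?b = "local_drift r (\<zeta> t)"
    let ?a = "hull_profile (supp (\<zeta> t))"
    note ne = simplex_supp_nonempty[OF simplex[OF t(1)]]
    obtain d where d: "0 < d" "\<And>s. t \<le> s \<Longrightarrow> s < t + d \<Longrightarrow> \<zeta> s = \<zeta> t + (s - t) *\<^sub>R ?b"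
      using follows_drift_right[OF \<zeta> t(1)] by metis
    obtain e where e: "0 < e" "\<And>s. t < s \<Longrightarrow> s < t + e \<Longrightarrow> supp (\<zeta> s) = ?A"
      using follows_drift_supp[OF \<zeta> t(1) simplex[OF t(1)]] by metis
    have step: "f (\<zeta> s) = f (\<zeta> 0) + integral {0..s} ?h" if s: "t < s" "s < t + e" "s < t + d" for s
    proof -
      have "(?h has_integral (f (\<zeta> t + (s - t) *\<^sub>R ?b) - f (\<zeta> t + (t - t) *\<^sub>R ?b))) {t..s}"
      proof (rule fundamental_theorem_of_calculus)
        show "t \<le> s" using s by simp
        fix x assume x: "x \<in> {t..s}"
        then have x0: "0 \<le> x" using t(1) by simp
        have path: "\<zeta> x = \<zeta> t + (x - t) *\<^sub>R ?b" using x s by (intro d(2)) auto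
        have "supp (\<zeta> x) \<subseteq> ?A"
          using e(2)[of x] x s absorbing_hull_superset[OF ne] by (cases "x = t") auto
        then have off: "\<zeta> x $ k = 0" if "k \<notin> ?A" for k
          using that by (intro supp_zero simplex x0) auto
        have "(1 - ?a k) * blinfun_apply (f' (\<zeta> x)) (jump_vector r k) = 0" for k
        proof (cases "k \<in> ?A")
          case True
          then have "?a k = 1"
            unfolding hull_profile_def using absorbing_hull_superset[OF ne] ne by (intro trace_profile_on) auto
          then show ?thesis by simp
        next
          case False
          then have "dir_deriv (jump_vector r k) f (\<zeta> x) = 0"
            using f simplex[OF x0] off by (auto simp: test_functions_def)
          then show ?thesis by (simp add: dir simplex x0)
        qed
        then have z: "(\<Sum>k\<in>UNIV. (1 - ?a k) * blinfun_apply (f' (\<zeta> x)) (jump_vector r k)) = 0"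
          by (intro sum.neutral) blast
        have "blinfun_apply (f' (\<zeta> x)) ?b = blinfun_apply (f' (\<zeta> x)) (drift r)"
          by (simp add: local_drift_eq_sum[OF ne] blinfun.diff_right blinfun.sum_right blinfun.scaleR_right z)
        also have "\<dots> = ?h x" by (simp add: dir simplex x0)
        finally have eq: "blinfun_apply (f' (\<zeta> x)) ?b = ?h x" .
        have "((\<lambda>y. \<zeta> t + (y - t) *\<^sub>R ?b) has_derivative (\<lambda>h. h *\<^sub>R ?b)) (at x within {t..s})"
          by (auto intro!: derivative_eq_intros)
        moreover have "(f has_derivative blinfun_apply (f' (\<zeta> x))) (at (\<zeta> t + (x - t) *\<^sub>R ?b))"
          using U(2,3) simplex[OF x0] by (simp add: path[symmetric] subset_iff)
        ultimately have "((\<lambda>y. f (\<zeta> t + (y - t) *\<^sub>R ?b)) has_derivative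
            (\<lambda>h. blinfun_apply (f' (\<zeta> x)) (h *\<^sub>R ?b))) (at x within {t..s})"
          by (rule has_derivative_compose)
        then show "((\<lambda>y. f (\<zeta> t + (y - t) *\<^sub>R ?b)) has_vector_derivative ?h x) (at x within {t..s})"
          by (simp add: has_vector_derivative_def blinfun.scaleR_right eq)
      qed
      then have "integral {t..s} ?h = f (\<zeta> s) - f (\<zeta> t)"
        using d(2)[of s] s by (simp add: integral_unique)
      moreover have "integral {0..t} ?h + integral {t..s} ?h = integral {0..s} ?h"
        using t(1) s by (intro Henstock_Kurzweil_Integration.integral_combine int_h) auto
      ultimately show ?thesis using t(2) by simp
    qed
    show "\<exists>e>0. \<forall>s. t < s \<and> s < t + e \<longrightarrow> f (\<zeta> s) = f (\<zeta> 0) + integral {0..s} ?h"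
    proof (intro exI[of _ "min e d"] conjI allI impI)
      show "f (\<zeta> s) = f (\<zeta> 0) + integral {0..s} ?h" if "t < s \<and> s < t + min e d" for s
        using that by (intro step) auto
    qed (use e(1) d(1) in simp)
  qed
qed

text \<open>Test functions need to be admissible only near a point of the relative interior of the
  face \<open>A\<close>: multiply by a cutoff of the energy of the mass off \<open>A\<close> and of the
  \<open>A\<close>-harmonic coordinates, both of which satisfy the boundary condition off \<open>A\<close>.\<close>
lemma local_test_function:
  fixes \<zeta> :: "real \<Rightarrow> real ^ 'v"
  assumes cont: "continuous_on {0..} \<zeta>" and simplex: "\<And>t. 0 \<le> t \<Longrightarrow> \<zeta> t \<in> prob_simplex"
    and solves: "\<And>f t. f \<in> test_functions r \<Longrightarrow> 0 \<le> t \<Longrightarrow>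
      f (\<zeta> t) = f (\<zeta> 0) + integral {0..t} (\<lambda>s. dir_deriv (drift r) f (\<zeta> s))"
    and s: "0 \<le> s"
    and f: "has_grad f g" "\<And>k u. k \<notin> supp (\<zeta> s) \<Longrightarrow> u \<in> prob_simplex \<Longrightarrow> u $ k = 0 \<Longrightarrow> gen r (($) (g u)) k = 0"
  shows "\<forall>\<^sub>F t in at_right s. f (\<zeta> t) = f (\<zeta> s) + integral {s..t} (\<lambda>x. g (\<zeta> x) \<bullet> drift r)"
proof -
  define A where "A = supp (\<zeta> s)"
  let ?K = "super_cone A"
  have ne: "A \<noteq> {}" unfolding A_def by (rule simplex_supp_nonempty[OF simplex[OF s]])
  have zero_off: "\<zeta> s $ k = 0" if "k \<notin> A" for k
    using that simplex[OF s] unfolding A_def by (intro supp_zero)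
  define h where "h i = (\<chi> k. hit_prob A i k)" for i
  have h_nth: "h i $ k = hit_prob A i k" for i k by (simp add: h_def)
  have gen_h: "gen r (($) (h i)) k = 0" if "i \<in> A" "k \<notin> A" for i k
  proof -
    have "($) (h i) = hit_prob A i" by (simp add: h_def fun_eq_iff)
    then show ?thesis using gen_hit_prob[OF that] by simp
  qed
  \<comment> \<open>2 m is the least positive coordinate of \<zeta> s, so penalties that set in
    below 2 m vanish at \<zeta> s.\<close>
  obtain m where m: "0 < m" "\<And>i. i \<in> A \<Longrightarrow> 2 * m \<le> \<zeta> s $ i"
  proof
    have "Min (($) (\<zeta> s) ` A) \<in> ($) (\<zeta> s) ` A" using ne by (intro Min_in) auto
    then show "0 < Min (($) (\<zeta> s) ` A) / 2" by (auto simp: A_def supp_def)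
    show "2 * (Min (($) (\<zeta> s) ` A) / 2) \<le> \<zeta> s $ i" if "i \<in> A" for i using that by simp
  qed
  obtain \<gamma> where \<gamma>: "\<gamma> \<in> ?K" "\<And>k. k \<notin> A \<Longrightarrow> 0 < \<gamma> $ k"
    using strict_superharmonic_exists[OF ne] by metis
  have \<gamma>0: "0 \<le> \<gamma> $ k" for k using super_cone_nonneg[OF ne \<gamma>(1)] .
  \<comment> \<open>Off A the functions h i are at most 1 and \<gamma> is bounded below, so C times
    the \<gamma>-weighted mass bounds their contribution from there. The summand 1 keeps C positive
    when A is all of V.\<close>
  obtain C where C: "0 < C" "\<And>i k. k \<notin> A \<Longrightarrow> hit_prob A i k \<le> C * \<gamma> $ k"
  proof
    define C where "C = 1 + (\<Sum>k\<in>-A. 1 / \<gamma> $ k)"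
    have "0 \<le> (\<Sum>k\<in>-A. 1 / \<gamma> $ k)" by (intro sum_nonneg) (use \<gamma>0 in auto)
    then show "0 < C" by (simp add: C_def)
    fix i k assume k: "k \<notin> A"
    have "1 / \<gamma> $ k \<le> (\<Sum>k\<in>-A. 1 / \<gamma> $ k)" using k \<gamma>0 by (intro member_le_sum) auto
    then have "1 / \<gamma> $ k \<le> C" by (simp add: C_def)
    then have "1 \<le> C * \<gamma> $ k" using \<gamma>(2)[OF k] by (simp add: field_simps)
    moreover have "hit_prob A i k \<le> 1"
      using k walk_space.P.prob_le_1 by (simp add: hit_prob_def walk_space_eq)
    ultimately show "hit_prob A i k \<le> C * \<gamma> $ k" by linarith
  qed
  \<comment> \<open>The envelope bound at c \<gamma> reads \<gamma> \<bullet> u \<le> envelope / c +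
    c (\<gamma> \<bullet> \<gamma>) / 2. This c makes the last term at most m / (2 C), and the
    second bound in \<kappa> makes 2 \<kappa> / c at most m / (4 C), so the sum stays below m / C.
    The first bound in \<kappa> keeps 2 \<kappa> below \<open>m\<^sup>2\<close>.\<close>
  define c where "c = m / (C * (1 + \<gamma> \<bullet> \<gamma>))"
  have c: "0 < c" unfolding c_def using m C by (intro divide_pos_pos mult_pos_pos) (auto intro: add_pos_nonneg)
  define \<kappa> where "\<kappa> = min (m\<^sup>2 / 4) (c * m / (8 * C))"
  have \<kappa>: "0 < \<kappa>" unfolding \<kappa>_def using m C c by auto
  \<comment> \<open>The envelope detects mass off A, and the squares a harmonic coordinate that
    falls below 2 m; all of them vanish at \<zeta> s.\<close>
  define Q where "Q u = envelope ?K u + (\<Sum>i\<in>A. (max 0 (2 * m - h i \<bullet> u))\<^sup>2)" for u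
  define Q' where "Q' u = closest_point ?K u + (\<Sum>i\<in>A. (- (2 * max 0 (2 * m - h i \<bullet> u))) *\<^sub>R h i)" for u
  have K: "closed ?K" "convex ?K" "?K \<noteq> {}"
    using closed_super_cone convex_super_cone zero_in_super_cone by auto
  have sq: "((\<lambda>x. (max 0 (2 * m - x))\<^sup>2) has_real_derivative - (2 * max 0 (2 * m - x))) (at x)" for x
  proof -
    have "((\<lambda>x. 2 * m - x) has_real_derivative - 1) (at x)" by (auto intro!: derivative_eq_intros)
    from DERIV_chain2[OF pos_part_square_deriv this] show ?thesis by simp
  qed
  have "has_grad Q Q'"
    unfolding Q_def[abs_def] Q'_def[abs_def]
  proof (intro has_grad_add has_grad_envelope K has_grad_sum)
    fix i
    show "has_grad (\<lambda>u. (max 0 (2 * m - h i \<bullet> u))\<^sup>2) (\<lambda>u. (- (2 * max 0 (2 * m - h i \<bullet> u))) *\<^sub>R h i)"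
      by (rule has_grad_compose[OF has_grad_linear sq]) (intro continuous_intros)
  qed auto
  have Q'_off: "gen r (($) (Q' u)) k = 0" if "k \<notin> A" "u $ k = 0" for u k
  proof -
    have "gen r (($) (Q' u)) k = Q' u \<bullet> jump_vector r k"
      by (simp add: jump_vector_inner[symmetric] inner_commute)
    also have "\<dots> = closest_point ?K u \<bullet> jump_vector r k +
        (\<Sum>i\<in>A. - (2 * max 0 (2 * m - h i \<bullet> u)) * (h i \<bullet> jump_vector r k))"
      by (simp add: Q'_def inner_add_left inner_sum_left)
    also have "(\<Sum>i\<in>A. - (2 * max 0 (2 * m - h i \<bullet> u)) * (h i \<bullet> jump_vector r k)) = 0"
      using gen_h that by (intro sum.neutral) (simp add: inner_commute[of "h _"] jump_vector_inner)
    also have "closest_point ?K u \<bullet> jump_vector r k = 0"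
      using gen_projection_zero[OF ne that] by (simp add: inner_commute[of _ "jump_vector r k"] jump_vector_inner)
    finally show ?thesis by simp
  qed
  \<comment> \<open>If coordinate i in A vanishes, only states off A contribute to h i \<bullet> u.
    Either the mass there makes the envelope large, or h i \<bullet> u is below m and penalty i is
    at least \<open>m\<^sup>2\<close>. So the cutoff vanishes wherever a condition at a state of A
    applies.\<close>
  have Q_boundary: "2 * \<kappa> \<le> Q u" if u: "u \<in> prob_simplex" "i \<in> A" "u $ i = 0" for u i
  proof (rule ccontr)
    assume "\<not> 2 * \<kappa> \<le> Q u"
    then have small: "Q u < 2 * \<kappa>" by simp
    have u0: "0 \<le> u $ k" for k using u(1) by (simp add: prob_simplex_iff)
    have nn: "0 \<le> (\<Sum>i\<in>A. (max 0 (2 * m - h i \<bullet> u))\<^sup>2)" by (intro sum_nonneg) simp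
    have "(c *\<^sub>R \<gamma>) \<bullet> u - ((c *\<^sub>R \<gamma>) \<bullet> (c *\<^sub>R \<gamma>)) / 2 \<le> envelope ?K u"
      using c by (intro envelope_ge[OF K(1)] super_cone_scale \<gamma>(1)) simp
    also have "\<dots> < 2 * \<kappa>" using small nn by (simp add: Q_def)
    also have "\<dots> \<le> c * m / (4 * C)" by (simp add: \<kappa>_def)
    finally have "c * (\<gamma> \<bullet> u) < c * (m / (4 * C) + c * (\<gamma> \<bullet> \<gamma>) / 2)" by (simp add: algebra_simps)
    then have "\<gamma> \<bullet> u < m / (4 * C) + c * (\<gamma> \<bullet> \<gamma>) / 2" using c by simp
    also have "c * (\<gamma> \<bullet> \<gamma>) \<le> c * (1 + \<gamma> \<bullet> \<gamma>)" using c by simp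
    also have "c * (1 + \<gamma> \<bullet> \<gamma>) = m / C"
    proof -
      have "1 + \<gamma> \<bullet> \<gamma> \<noteq> 0" by (metis add_pos_nonneg inner_ge_zero less_irrefl zero_less_one)
      then show ?thesis using C by (simp add: c_def)
    qed
    finally have "\<gamma> \<bullet> u < m / C" using m C by (simp add: field_simps)
    then have "C * (\<gamma> \<bullet> u) < m" using C by (simp add: field_simps)
    moreover have "h i \<bullet> u \<le> C * (\<gamma> \<bullet> u)"
      unfolding inner_vec_def sum_distrib_left
    proof (rule sum_mono)
      fix k
      show "h i $ k \<bullet> u $ k \<le> C * (\<gamma> $ k \<bullet> u $ k)"
      proof (cases "k \<in> A")
        case True
        then have "h i $ k * u $ k = 0" using u(3) by (simp add: h_nth hit_prob_def)
        moreover have "0 \<le> C * (\<gamma> $ k * u $ k)" using C \<gamma>0 u0 by (intro mult_nonneg_nonneg) auto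
        ultimately show ?thesis unfolding inner_real_def by linarith
      next
        case False
        have "h i $ k * u $ k \<le> (C * \<gamma> $ k) * u $ k"
          using C(2)[OF False, of i] u0 by (intro mult_right_mono) (auto simp: h_nth)
        then show ?thesis by simp
      qed
    qed
    ultimately have "m \<le> 2 * m - h i \<bullet> u" by simp
    then have "m\<^sup>2 \<le> (max 0 (2 * m - h i \<bullet> u))\<^sup>2" using m by (intro power_mono) auto
    also have "\<dots> \<le> (\<Sum>i\<in>A. (max 0 (2 * m - h i \<bullet> u))\<^sup>2)" using u(2) by (intro member_le_sum) auto
    also have "\<dots> \<le> Q u" using envelope_super_cone_nonneg by (simp add: Q_def)
    also have "\<dots> < m\<^sup>2"
    proof -
      have "\<kappa> \<le> m\<^sup>2 / 4" by (simp add: \<kappa>_def)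
      moreover have "0 < m\<^sup>2" using m by simp
      ultimately show ?thesis using small by linarith
    qed
    finally show False by simp
  qed
  obtain \<phi> \<phi>' where \<phi>: "\<And>x. (\<phi> has_real_derivative \<phi>' x) (at x)" "continuous_on UNIV \<phi>'"
    "\<And>x. x \<le> \<kappa> \<Longrightarrow> \<phi> x = 1 \<and> \<phi>' x = 0" "\<And>x. 2 * \<kappa> \<le> x \<Longrightarrow> \<phi> x = 0 \<and> \<phi>' x = 0"
    using C1_cutoff_exists[OF \<kappa>] by blast
  define F where "F u = f u * \<phi> (Q u)" for u
  define G where "G u = f u *\<^sub>R (\<phi>' (Q u) *\<^sub>R Q' u) + \<phi> (Q u) *\<^sub>R g u" for u
  have FG: "has_grad F G"
    unfolding F_def[abs_def] G_def[abs_def]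
    by (intro has_grad_mult f(1) has_grad_compose[OF \<open>has_grad Q Q'\<close> \<phi>(1,2)])
  have "F \<in> test_functions r"
  proof (rule has_grad_test_function[OF FG])
    fix k and u :: "real ^ 'v" assume u: "u \<in> prob_simplex" "u $ k = 0"
    have "gen r (($) (G u)) k = f u * \<phi>' (Q u) * gen r (($) (Q' u)) k + \<phi> (Q u) * gen r (($) (g u)) k"
      unfolding G_def gen_vec_add gen_vec_scale by simp
    also have "\<dots> = 0"
    proof (cases "k \<in> A")
      case True
      then show ?thesis using \<phi>(4)[OF Q_boundary[OF u(1) True u(2)]] by simp
    next
      case False
      then show ?thesis using Q'_off[OF False u(2)] f(2)[of k u] u by (simp add: A_def)
    qed
    finally show "gen r (($) (G u)) k = 0" .
  qed
  note F_eq = solves[OF this]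
  have cont_G: "continuous_on {0..} (\<lambda>x. G (\<zeta> x) \<bullet> drift r)"
  proof -
    have "continuous_on UNIV G" using FG by (simp add: has_grad_def)
    then have "continuous_on {0..} (\<lambda>x. G (\<zeta> x))" by (rule continuous_on_compose2[OF _ cont]) simp
    then show ?thesis by (intro continuous_on_inner continuous_on_const)
  qed
  have F_incr: "F (\<zeta> t) = F (\<zeta> s) + integral {s..t} (\<lambda>x. G (\<zeta> x) \<bullet> drift r)" if "s \<le> t" for t
  proof -
    have "integral {0..s} (\<lambda>x. G (\<zeta> x) \<bullet> drift r) + integral {s..t} (\<lambda>x. G (\<zeta> x) \<bullet> drift r)
        = integral {0..t} (\<lambda>x. G (\<zeta> x) \<bullet> drift r)"
      using s that
      by (intro Henstock_Kurzweil_Integration.integral_combine integrable_continuous_real continuous_on_subset[OF cont_G]) auto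
    then show ?thesis
      using F_eq[of t] F_eq[of s] s that by (simp add: has_grad_dir_deriv[OF FG])
  qed
  have "h i \<bullet> \<zeta> s = \<zeta> s $ i" if "i \<in> A" for i
  proof -
    have "h i \<bullet> \<zeta> s = (\<Sum>k\<in>UNIV. if k = i then \<zeta> s $ i else 0)"
      unfolding inner_vec_def using that zero_off by (intro sum.cong) (auto simp: h_nth hit_prob_def)
    then show ?thesis by simp
  qed
  then have "(\<Sum>i\<in>A. (max 0 (2 * m - h i \<bullet> \<zeta> s))\<^sup>2) = 0" using m(2) by (intro sum.neutral) simp
  then have Q0: "Q (\<zeta> s) = 0" using envelope_super_cone_zero[of A "\<zeta> s"] zero_off by (simp add: Q_def)
  have "continuous_on {0..} (\<lambda>x. Q (\<zeta> x))"
    by (rule continuous_on_compose2[OF has_grad_continuous[OF \<open>has_grad Q Q'\<close>] cont]) auto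
  then have "((\<lambda>x. Q (\<zeta> x)) \<longlongrightarrow> Q (\<zeta> s)) (at s within {0..})" using s by (simp add: continuous_on_def)
  then have lim: "((\<lambda>x. Q (\<zeta> x)) \<longlongrightarrow> Q (\<zeta> s)) (at_right s)"
    by (rule tendsto_within_subset) (use s in auto)
  have "\<forall>\<^sub>F x in at_right s. Q (\<zeta> x) < \<kappa>"
    by (rule order_tendstoD(2)[OF lim]) (simp add: Q0 \<kappa>)
  then obtain b where b: "s < b" "\<And>x. s < x \<Longrightarrow> x < b \<Longrightarrow> Q (\<zeta> x) < \<kappa>"
    unfolding eventually_at_right_field by blast
  have near: "F (\<zeta> x) = f (\<zeta> x)" "G (\<zeta> x) = g (\<zeta> x)" if "s \<le> x" "x < b" for x
  proof -
    have "Q (\<zeta> x) \<le> \<kappa>" using b(2)[of x] that Q0 \<kappa> by (cases "x = s") auto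
    then show "F (\<zeta> x) = f (\<zeta> x)" "G (\<zeta> x) = g (\<zeta> x)" using \<phi>(3) by (simp_all add: F_def G_def)
  qed
  have "f (\<zeta> t) = f (\<zeta> s) + integral {s..t} (\<lambda>x. g (\<zeta> x) \<bullet> drift r)" if "s < t" "t < b" for t
  proof -
    have "integral {s..t} (\<lambda>x. G (\<zeta> x) \<bullet> drift r) = integral {s..t} (\<lambda>x. g (\<zeta> x) \<bullet> drift r)"
      by (rule Henstock_Kurzweil_Integration.integral_cong) (use that near in auto)
    then show ?thesis using F_incr[of t] near[of t] near[of s] that b(1) by simp
  qed
  then show ?thesis unfolding eventually_at_right_field using b(1) by blast
qed

end

section \<open>Solutions of the (lambda, D)-problem\<close>

context irreducible_walk
begin

text \<open>Along the path supports are absorbing, so each equals its hull and the drift vanishes on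
  every zero coordinate. From a start that is not absorbing, the rest of the hull is entered at
  once.\<close>

lemma linear_path_off_supp:
  assumes u: "u \<in> prob_simplex" "absorbing r (supp u)" and "i \<notin> supp u" "0 \<le> t"
  shows "linear_path r u t $ i = 0"
  using \<open>0 \<le> t\<close>
proof (rule eq_of_right_local_eq[of 0 "\<lambda>t. linear_path r u t $ i" "\<lambda>_. 0", rotated 3])
  show "continuous_on {0..} (\<lambda>t. linear_path r u t $ i)"
    by (intro continuous_intros linear_path_continuous u(1))
  show "linear_path r u 0 $ i = 0" using supp_zero[OF assms(3) u(1)] by (simp add: linear_path_0[OF u(1)])
next
  fix t :: real assume t: "0 \<le> t" "linear_path r u t $ i = 0"
  let ?v = "linear_path r u t"
  note ne = simplex_supp_nonempty[OF linear_path_simplex[OF u(1) t(1)]]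
  have "absorbing r (supp ?v)" using u t(1) by (intro linear_path_absorbing) auto
  then have "absorbing_hull r (supp ?v) = supp ?v" using ne by (intro absorbing_hull_absorbing)
  then have drift: "local_drift r ?v $ i = 0" using t(2) by (intro local_drift_off_hull) (simp add: supp_def)
  obtain e where e: "0 < e" "\<And>s. t \<le> s \<Longrightarrow> s < t + e \<Longrightarrow> linear_path r u s = ?v + (s - t) *\<^sub>R local_drift r ?v"
    using follows_drift_right[OF linear_path_follows_drift[OF u(1)] t(1)] by metis
  have "linear_path r u s $ i = 0" if "t < s" "s < t + e" for s
    using e(2)[of s] that t(2) drift by simp
  with e(1) show "\<exists>e>0. \<forall>s. t < s \<and> s < t + e \<longrightarrow> linear_path r u s $ i = 0" by blast
qed simp

context
  fixes \<zeta> :: "real \<Rightarrow> real ^ 'v"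
  assumes sol: "solves_problem r \<zeta>"
begin

lemma
  shows sol_continuous: "continuous_on {0..} \<zeta>"
    and sol_simplex: "0 \<le> t \<Longrightarrow> \<zeta> t \<in> prob_simplex"
    and sol_extensional: "\<zeta> \<in> extensional {0..}"
    and sol_test: "f \<in> test_functions r \<Longrightarrow> 0 \<le> t \<Longrightarrow>
      f (\<zeta> t) = f (\<zeta> 0) + integral {0..t} (\<lambda>s. dir_deriv (drift r) f (\<zeta> s))"
  using sol by (auto simp: solves_problem_def simplex_paths_def PiE_iff)

text \<open>The energy of the mass off an absorbing set \<open>A\<close> does not increase, hence stays zero;
  on the face \<open>A\<close> the harmonic coordinates are the coordinates.\<close>
lemma sol_right_local:
  assumes s: "0 \<le> s" and abs: "absorbing r (supp (\<zeta> s))"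
  obtains e where "0 < e" "\<And>t. s \<le> t \<Longrightarrow> t < s + e \<Longrightarrow> \<zeta> t = \<zeta> s + (t - s) *\<^sub>R local_drift r (\<zeta> s)"
proof -
  define A where "A = supp (\<zeta> s)"
  let ?K = "super_cone A"
  have ne: "A \<noteq> {}" unfolding A_def by (rule simplex_supp_nonempty[OF sol_simplex[OF s]])
  have hull: "absorbing_hull r A = A" using ne abs by (intro absorbing_hull_absorbing) (auto simp: A_def)
  have zero_off: "\<zeta> s $ k = 0" if "k \<notin> A" for k
    using that sol_simplex[OF s] unfolding A_def by (intro supp_zero)
  have K: "closed ?K" "convex ?K" "?K \<noteq> {}"
    using closed_super_cone convex_super_cone zero_in_super_cone by auto
  obtain \<gamma> where \<gamma>: "\<gamma> \<in> ?K" "\<And>k. k \<notin> A \<Longrightarrow> 0 < \<gamma> $ k"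
    using strict_superharmonic_exists[OF ne] by metis
  have \<gamma>0: "0 \<le> \<gamma> $ k" for k using super_cone_nonneg[OF ne \<gamma>(1)] .
  define h :: "'v \<Rightarrow> real ^ 'v" where "h j = (\<chi> k. hit_prob A j k)" for j
  have h: "($) (h j) = hit_prob A j" for j by (simp add: h_def fun_eq_iff)
  have h_coord: "h j \<bullet> v = v $ j" if "j \<in> A" "\<And>k. k \<notin> A \<Longrightarrow> v $ k = 0" for j v
  proof -
    have "h j \<bullet> v = (\<Sum>k\<in>UNIV. if k = j then v $ j else 0)"
      unfolding inner_vec_def using that by (intro sum.cong) (auto simp: h_def hit_prob_def)
    then show ?thesis by simp
  qed
  \<comment> \<open>As h j is harmonic off A, the weights 1 in its pairing with the drift may be
    replaced by the trace profile, and duality picks out the trace drift at j.\<close>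
  have h_drift: "h j \<bullet> drift r = local_drift r (\<zeta> s) $ j" if "j \<in> A" for j
  proof -
    have "h j \<bullet> drift r = (\<Sum>i\<in>UNIV. gen r (hit_prob A j) i)" by (simp add: drift_inner h)
    also have "\<dots> = (\<Sum>i\<in>UNIV. trace_profile A i * gen r (hit_prob A j) i)"
    proof (rule sum.cong)
      show "gen r (hit_prob A j) i = trace_profile A i * gen r (hit_prob A j) i" for i
        using that trace_profile_on[OF ne, of i] gen_hit_prob[OF that, of i] by (cases "i \<in> A") auto
    qed simp
    also have "\<dots> = (\<Sum>i\<in>UNIV. adj r (trace_profile A) i * hit_prob A j i)" by (rule sum_mult_gen)
    also have "\<dots> = (\<Sum>i\<in>UNIV. if i = j then adj r (trace_profile A) j else 0)"
      using that adj_trace_profile_off[OF ne] by (intro sum.cong) (auto simp: hit_prob_def)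
    finally show ?thesis
      using local_drift_nth[of "\<zeta> s" j] ne hull by (simp add: A_def hull_profile_def)
  qed
  have "\<forall>\<^sub>F t in at_right s. envelope ?K (\<zeta> t) = envelope ?K (\<zeta> s) +
      integral {s..t} (\<lambda>x. closest_point ?K (\<zeta> x) \<bullet> drift r)"
    using gen_projection_zero[OF ne]
    by (intro local_test_function[OF sol_continuous sol_simplex sol_test s has_grad_envelope[OF K]]) (auto simp: A_def)
  moreover have "\<forall>\<^sub>F t in at_right s. \<forall>j\<in>A. h j \<bullet> \<zeta> t = h j \<bullet> \<zeta> s + integral {s..t} (\<lambda>x. h j \<bullet> drift r)"
  proof (rule eventually_ball_finite)
    show "\<forall>j\<in>A. \<forall>\<^sub>F t in at_right s. h j \<bullet> \<zeta> t = h j \<bullet> \<zeta> s + integral {s..t} (\<lambda>x. h j \<bullet> drift r)"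
    proof
      fix j assume j: "j \<in> A"
      show "\<forall>\<^sub>F t in at_right s. h j \<bullet> \<zeta> t = h j \<bullet> \<zeta> s + integral {s..t} (\<lambda>x. h j \<bullet> drift r)"
        using gen_hit_prob[OF j]
        by (intro local_test_function[OF sol_continuous sol_simplex sol_test s has_grad_linear]) (auto simp: A_def h)
    qed
  qed simp
  moreover have "\<forall>\<^sub>F t in at_right s. s < t" by (rule eventually_at_right_less)
  ultimately have "\<forall>\<^sub>F t in at_right s. \<zeta> t = \<zeta> s + (t - s) *\<^sub>R local_drift r (\<zeta> s)"
  proof eventually_elim
    case (elim t)
    have t: "0 \<le> t" using elim(3) s by simp
    have "integral {s..t} (\<lambda>x. closest_point ?K (\<zeta> x) \<bullet> drift r) \<le> integral {s..t} (\<lambda>x. 0)"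
    proof (rule integral_le)
      have "continuous_on {s..t} \<zeta>" by (rule continuous_on_subset[OF sol_continuous]) (use s in auto)
      then have "continuous_on {s..t} (\<lambda>x. closest_point ?K (\<zeta> x))"
        by (rule continuous_on_compose2[OF continuous_on_closest_point[OF K(2,1,3), of UNIV]]) simp
      then show "(\<lambda>x. closest_point ?K (\<zeta> x) \<bullet> drift r) integrable_on {s..t}"
        by (intro integrable_continuous_real continuous_on_inner continuous_on_const)
      show "closest_point ?K (\<zeta> x) \<bullet> drift r \<le> 0" for x
        using ne abs by (intro drift_super_cone[of A] closest_point_in_set K) (auto simp: A_def)
    qed auto
    then have le: "envelope ?K (\<zeta> t) \<le> 0"
      using elim(1) envelope_super_cone_zero[of A "\<zeta> s"] zero_off by simp
    have nn: "0 \<le> \<zeta> t $ k" for k using sol_simplex[OF t] by (simp add: prob_simplex_iff)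
    have "\<gamma> \<bullet> \<zeta> t \<le> 0"
    proof (rule ccontr)
      assume "\<not> ?thesis"
      then have pos: "0 < \<gamma> \<bullet> \<zeta> t" by simp
      \<comment> \<open>Any c > 0 with c (\<gamma> \<bullet> \<gamma>) < 2 (\<gamma> \<bullet>
        \<zeta> t) makes the lower bound for the envelope positive; the added 1 keeps the
        denominator positive.\<close>
      define c where "c = (\<gamma> \<bullet> \<zeta> t) / (1 + \<gamma> \<bullet> \<gamma>)"
      have p1: "0 < 1 + \<gamma> \<bullet> \<gamma>" by (intro add_pos_nonneg) auto
      have c: "0 < c" unfolding c_def using pos p1 by (intro divide_pos_pos)
      have "(c *\<^sub>R \<gamma>) \<bullet> \<zeta> t - ((c *\<^sub>R \<gamma>) \<bullet> (c *\<^sub>R \<gamma>)) / 2 \<le> 0"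
        by (rule order_trans[OF envelope_ge[OF K(1) super_cone_scale[OF \<gamma>(1) less_imp_le[OF c]]] le])
      then have "c * (\<gamma> \<bullet> \<zeta> t) \<le> c * (c * (\<gamma> \<bullet> \<gamma>)) / 2"
        unfolding inner_scaleR_left inner_scaleR_right by linarith
      then have "c * (\<gamma> \<bullet> \<zeta> t) \<le> c * (c * (\<gamma> \<bullet> \<gamma>) / 2)" by (simp only: times_divide_eq_right)
      then have "\<gamma> \<bullet> \<zeta> t \<le> c * (\<gamma> \<bullet> \<gamma>) / 2" using c by simp
      also have "\<dots> \<le> c * (1 + \<gamma> \<bullet> \<gamma>) / 2" using c by (intro divide_right_mono mult_left_mono) auto
      also have "\<dots> = (\<gamma> \<bullet> \<zeta> t) / 2" using p1 by (simp add: c_def)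
      finally show False using pos by simp
    qed
    then have "(\<Sum>k\<in>UNIV. \<gamma> $ k * \<zeta> t $ k) = 0"
      using nn \<gamma>0 by (intro antisym) (auto simp: inner_vec_def intro!: sum_nonneg)
    then have "\<gamma> $ k * \<zeta> t $ k = 0" for k
      using nn \<gamma>0 by (simp add: sum_nonneg_eq_0_iff)
    then have off: "\<zeta> t $ k = 0" if "k \<notin> A" for k using \<gamma>(2)[OF that] by (metis less_irrefl mult_eq_0_iff)
    have "\<zeta> t $ j = \<zeta> s $ j + (t - s) * local_drift r (\<zeta> s) $ j" for j
    proof (cases "j \<in> A")
      case True
      then show ?thesis
        using elim(2,3) h_coord[OF True, of "\<zeta> t"] h_coord[OF True, of "\<zeta> s"] off zero_off h_drift[OF True] by simp
    next
      case False
      then show ?thesis using off zero_off local_drift_off_hull[of j "\<zeta> s"] hull by (simp add: A_def)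
    qed
    then show ?case by (simp add: vec_eq_iff)
  qed
  then obtain b where b: "s < b" "\<And>t. s < t \<Longrightarrow> t < b \<Longrightarrow> \<zeta> t = \<zeta> s + (t - s) *\<^sub>R local_drift r (\<zeta> s)"
    unfolding eventually_at_right_field by blast
  show thesis
  proof (rule that)
    show "0 < b - s" using b by simp
    show "\<zeta> t = \<zeta> s + (t - s) *\<^sub>R local_drift r (\<zeta> s)" if "s \<le> t" "t < s + (b - s)" for t
      using that b(2)[of t] by (cases "s = t") auto
  qed
qed

text \<open>\<open>sol_right_local\<close> needs an absorbing support, and agreement with the linear
  path up to a time provides one at that time, so the local statement can be applied again.\<close>

lemma sol_after_absorbing:
  assumes s: "0 \<le> s" and abs: "absorbing r (supp (\<zeta> s))" and "s \<le> t"
  shows "\<zeta> t = linear_path r (\<zeta> s) (t - s)"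
  using \<open>s \<le> t\<close>
proof (rule eq_of_right_local_eq[of s, rotated 3])
  note sx = sol_simplex[OF s]
  note path = follows_drift_shift[OF linear_path_follows_drift[OF sx], of s]
  show "continuous_on {s..} \<zeta>" by (rule continuous_on_subset[OF sol_continuous]) (use s in auto)
  show "continuous_on {s..} (\<lambda>t. linear_path r (\<zeta> s) (t - s))" by (rule follows_drift_continuous[OF path])
  show "\<zeta> s = linear_path r (\<zeta> s) (s - s)" by (simp add: linear_path_0[OF sx])
  fix t assume t: "s \<le> t" "\<zeta> t = linear_path r (\<zeta> s) (t - s)"
  have "absorbing r (supp (\<zeta> t))"
    unfolding t(2) by (rule linear_path_absorbing[OF sx]) (use t(1) abs in auto)
  then obtain e where e: "0 < e" "\<And>x. t \<le> x \<Longrightarrow> x < t + e \<Longrightarrow> \<zeta> x = \<zeta> t + (x - t) *\<^sub>R local_drift r (\<zeta> t)"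
    using sol_right_local[of t] s t(1) by (metis order_trans)
  obtain d where d: "0 < d" "\<And>x. t \<le> x \<Longrightarrow> x < t + d \<Longrightarrow>
      linear_path r (\<zeta> s) (x - s) = linear_path r (\<zeta> s) (t - s) + (x - t) *\<^sub>R local_drift r (linear_path r (\<zeta> s) (t - s))"
    using follows_drift_right[OF path t(1)] by metis
  show "\<exists>e>0. \<forall>x. t < x \<and> x < t + e \<longrightarrow> \<zeta> x = linear_path r (\<zeta> s) (x - s)"
  proof (intro exI[of _ "min e d"] conjI allI impI)
    show "0 < min e d" using e(1) d(1) by simp
    fix x assume x: "t < x \<and> x < t + min e d"
    have "\<zeta> x = \<zeta> t + (x - t) *\<^sub>R local_drift r (\<zeta> t)" by (rule e(2)) (use x in auto)
    also have "\<dots> = linear_path r (\<zeta> s) (x - s)" unfolding t(2) by (rule d(2)[symmetric]) (use x in auto)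
    finally show "\<zeta> x = linear_path r (\<zeta> s) (x - s)" .
  qed
qed

lemma sol_absorbing_time:
  assumes "0 < e"
  obtains s where "0 \<le> s" "s < e" "absorbing r (supp (\<zeta> s))"
proof -
  have "Inf (ereal ` {t. 0 \<le> t \<and> \<zeta> t \<in> absorbing_simplex r}) < ereal e"
    using sol assms by (simp add: solves_problem_def)
  then show thesis using that by (auto simp: Inf_less_iff absorbing_simplex_def)
qed

lemma sol_absorbing:
  assumes "0 < t"
  shows "absorbing r (supp (\<zeta> t))"
proof -
  obtain s where s: "0 \<le> s" "s < t" "absorbing r (supp (\<zeta> s))" using sol_absorbing_time[OF assms] .
  then show ?thesis
    using sol_after_absorbing[OF s(1,3), of t] linear_path_absorbing[OF sol_simplex[OF s(1)], of "t - s"] by simp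
qed

text \<open>After time zero the supports decrease, so just after time zero the support is a constant
  absorbing set \<open>A\<close> and the path moves with the drift of \<open>A\<close>. Uniqueness in the
  obstacle problem identifies that drift as the one prescribed by the support of the starting point.\<close>
lemma sol_right_local_0:
  obtains e where "0 < e" "\<And>t. 0 \<le> t \<Longrightarrow> t < e \<Longrightarrow> \<zeta> t = \<zeta> 0 + t *\<^sub>R local_drift r (\<zeta> 0)"
proof -
  have decr: "supp (\<zeta> t) \<subseteq> supp (\<zeta> s)" if "0 < s" "s \<le> t" for s t
  proof
    fix i assume i: "i \<in> supp (\<zeta> t)"
    show "i \<in> supp (\<zeta> s)"
    proof (rule ccontr)
      assume no: "i \<notin> supp (\<zeta> s)"
      have s0: "0 \<le> s" using that by simp
      have "\<zeta> t $ i = 0"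
        unfolding sol_after_absorbing[OF s0 sol_absorbing[OF that(1)] that(2)]
        by (rule linear_path_off_supp[OF sol_simplex[OF s0] sol_absorbing[OF that(1)] no]) (use that in simp)
      with i show False by (simp add: supp_def)
    qed
  qed
  \<comment> \<open>Supports decrease in time and t1 attains the largest cardinality, so the support
    is constant on the whole of {0<..t1}.\<close>
  define N where "N = (\<lambda>t. card (supp (\<zeta> t))) ` {0<..}"
  have "finite N" unfolding N_def
    by (rule finite_subset[of _ "{..card (UNIV :: 'v set)}"]) (auto intro: card_mono)
  moreover have "N \<noteq> {}" by (auto simp: N_def)
  ultimately have "Max N \<in> N" "\<And>n. n \<in> N \<Longrightarrow> n \<le> Max N" by auto
  then obtain t1 where t1: "0 < t1" "\<And>t. 0 < t \<Longrightarrow> card (supp (\<zeta> t)) \<le> card (supp (\<zeta> t1))"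
    by (auto simp: N_def)
  define A where "A = supp (\<zeta> t1)"
  have A: "supp (\<zeta> t) = A" if "0 < t" "t \<le> t1" for t
    unfolding A_def by (rule card_seteq[OF _ decr[OF that] t1(2)[OF that(1)], symmetric]) simp
  have neA: "A \<noteq> {}" unfolding A_def using t1 by (intro simplex_supp_nonempty sol_simplex) simp
  have absA: "absorbing r A" unfolding A_def using t1 by (intro sol_absorbing)
  define b where "b = local_drift r (\<zeta> t1)"
  have drift: "local_drift r (\<zeta> t) = b" if "0 < t" "t \<le> t1" for t
    unfolding b_def by (rule local_drift_cong) (use A[OF that] in \<open>simp add: A_def\<close>)
  have seg: "\<zeta> t = \<zeta> s + (t - s) *\<^sub>R b" if st: "0 < s" "s \<le> t" "t \<le> t1" for s t
  proof -
    \<comment> \<open>Freezing both sides at t1 turns a statement on {s..t1} into one on a half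
      line, as \<open>eq_of_right_local_eq\<close> requires.\<close>
    have "\<zeta> (min t t1) = \<zeta> s + (min t t1 - s) *\<^sub>R b"
      using st(2)
    proof (rule eq_of_right_local_eq[of s, rotated 3])
      show "continuous_on {s..} (\<lambda>t. \<zeta> (min t t1))"
        by (rule continuous_on_compose2[OF sol_continuous])
          (use st t1 in \<open>auto intro!: continuous_on_min continuous_on_id continuous_on_const\<close>)
      show "continuous_on {s..} (\<lambda>t. \<zeta> s + (min t t1 - s) *\<^sub>R b)" by (intro continuous_intros)
      show "\<zeta> (min s t1) = \<zeta> s + (min s t1 - s) *\<^sub>R b" using st by (simp add: min_def)
      fix t assume t: "s \<le> t" "\<zeta> (min t t1) = \<zeta> s + (min t t1 - s) *\<^sub>R b"
      show "\<exists>e>0. \<forall>x. t < x \<and> x < t + e \<longrightarrow> \<zeta> (min x t1) = \<zeta> s + (min x t1 - s) *\<^sub>R b"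
      proof (cases "t < t1")
        case True
        have t0: "0 < t" using st t(1) by simp
        obtain e where e: "0 < e" "\<And>x. t \<le> x \<Longrightarrow> x < t + e \<Longrightarrow> \<zeta> x = \<zeta> t + (x - t) *\<^sub>R local_drift r (\<zeta> t)"
          using sol_right_local[OF less_imp_le[OF t0] sol_absorbing[OF t0]] by metis
        show ?thesis
        proof (intro exI[of _ "min e (t1 - t)"] conjI allI impI)
          show "0 < min e (t1 - t)" using e(1) True by simp
          fix x assume x: "t < x \<and> x < t + min e (t1 - t)"
          then have "t \<le> x" "x < t + e" by auto
          then have path: "\<zeta> x = \<zeta> t + (x - t) *\<^sub>R b" using e(2)[of x] drift[OF t0] True by simp
          have min: "min x t1 = x" "min t t1 = t" using x True by auto
          show "\<zeta> (min x t1) = \<zeta> s + (min x t1 - s) *\<^sub>R b"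
          proof -
            have "\<zeta> t = \<zeta> s + (t - s) *\<^sub>R b" using t(2) unfolding min(2) .
            then have "\<zeta> x = (\<zeta> s + (t - s) *\<^sub>R b) + (x - t) *\<^sub>R b" using path by (simp only:)
            also have "\<dots> = \<zeta> s + (x - s) *\<^sub>R b" by (simp add: algebra_simps)
            finally show ?thesis unfolding min(1) .
          qed
        qed
      next
        case False
        have "\<zeta> (min x t1) = \<zeta> s + (min x t1 - s) *\<^sub>R b" if "t < x" for x
        proof -
          have "min x t1 = min t t1" using that False by simp
          then show ?thesis using t(2) by simp
        qed
        then show ?thesis using zero_less_one by blast
      qed
    qed
    then show ?thesis using st by (simp add: min_def)
  qed
  have lim0: "(\<zeta> \<longlongrightarrow> \<zeta> 0) (at_right 0)"
    using sol_continuous by (auto simp: continuous_on_def intro: tendsto_within_subset)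
  \<comment> \<open>Let s decrease to 0 in \<open>seg\<close>. Continuity at 0 links the starting
    point to the motion after it.\<close>
  have start: "\<zeta> t = \<zeta> 0 + t *\<^sub>R b" if t: "0 < t" "t \<le> t1" for t
  proof (rule tendsto_unique[of "at_right (0::real)"])
    show "((\<lambda>s. \<zeta> s + (t - s) *\<^sub>R b) \<longlongrightarrow> \<zeta> 0 + t *\<^sub>R b) (at_right 0)"
      using lim0 by (auto intro!: tendsto_eq_intros)
    have "\<zeta> s + (t - s) *\<^sub>R b = \<zeta> t" if "0 < s" "s < t" for s
      by (rule seg[symmetric]) (use that t in auto)
    then have "\<forall>\<^sub>F s in at_right 0. \<zeta> s + (t - s) *\<^sub>R b = \<zeta> t"
      unfolding eventually_at_right_field using t(1) by blast
    then show "((\<lambda>s. \<zeta> s + (t - s) *\<^sub>R b) \<longlongrightarrow> \<zeta> t) (at_right 0)"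
      by (rule tendsto_eventually)
  qed simp
  let ?S = "supp (\<zeta> 0)"
  note sx0 = sol_simplex[OF order_refl]
  note ne0 = simplex_supp_nonempty[OF sx0]
  have b_nth: "b $ i = adj r (trace_profile A) i" for i
    using local_drift_nth[of "\<zeta> t1" i] neA absorbing_hull_absorbing[OF neA absA]
    by (simp add: b_def A_def hull_profile_def)
  have "?S \<subseteq> A"
  proof -
    obtain e where e: "0 < e" "\<And>s. 0 \<le> s \<Longrightarrow> \<bar>s - 0\<bar> < e \<Longrightarrow> ?S \<subseteq> supp (\<zeta> s)"
      using supp_persists[OF sol_continuous order_refl] by blast
    define s where "s = min (e / 2) t1"
    have "0 < s" "s < e" "s \<le> t1" using e(1) t1(1) by (auto simp: s_def)
    then show ?thesis using e(2)[of s] A[of s] by simp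
  qed
  \<comment> \<open>A coordinate of A that starts at 0 is positive at t1 and moves linearly in
    between, so its slope, which is L* of the profile, is positive.\<close>
  have "0 \<le> adj r (trace_profile A) i" if i: "i \<notin> ?S" for i
  proof (cases "i \<in> A")
    case True
    then have "0 < \<zeta> t1 $ i" by (simp add: A_def supp_def)
    then have "0 < t1 * b $ i" using start[OF t1(1) order_refl] supp_zero[OF i sx0] by simp
    then show ?thesis using t1(1) b_nth[of i] by (simp add: zero_less_mult_iff)
  qed (simp add: adj_trace_profile_off[OF neA])
  moreover have "trace_profile A i \<le> 1" for i using absorbing_iff_trace_profile_le[OF neA] absA by blast
  moreover have "adj r (trace_profile A) i = 0" if "trace_profile A i < 1" for i
    using that trace_profile_on[OF neA, of i] adj_trace_profile_off[OF neA, of i] by (cases "i \<in> A") auto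
  ultimately have "obstacle ?S (trace_profile A)"
    using trace_profile_on[OF neA] \<open>?S \<subseteq> A\<close> by (auto simp: obstacle_def)
  then have "hull_profile ?S = trace_profile A" by (rule obstacle_unique[OF ne0 obstacle_hull_profile[OF ne0]])
  then have "local_drift r (\<zeta> 0) = b" by (simp add: vec_eq_iff local_drift_nth[OF ne0] b_nth)
  then have "\<zeta> t = \<zeta> 0 + t *\<^sub>R local_drift r (\<zeta> 0)" if "0 \<le> t" "t < t1" for t
    using start[of t] that by (cases "t = 0") auto
  with t1(1) show thesis by (rule that)
qed

lemma sol_follows_drift: "follows_drift 0 \<zeta>"
  unfolding follows_drift_def
proof (intro conjI allI impI)
  show "continuous_on {0..} \<zeta>" by (rule sol_continuous)
  fix t :: real assume t: "0 \<le> t"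
  show "\<exists>e>0. \<forall>s. t \<le> s \<and> s < t + e \<longrightarrow> \<zeta> s = \<zeta> t + (s - t) *\<^sub>R local_drift r (\<zeta> t)"
  proof (cases "t = 0")
    case True
    then show ?thesis using sol_right_local_0 by (metis add_0 diff_zero)
  next
    case False
    then have "absorbing r (supp (\<zeta> t))" using t by (intro sol_absorbing) simp
    then show ?thesis using sol_right_local[OF t] by metis
  qed
qed

end

section \<open>Existence, uniqueness and agreement of the three paths\<close>

lemma linear_path_extensional: "linear_path r u \<in> extensional {0..}"
  by (simp add: linear_path_def)

lemma linear_path_solves:
  assumes u: "u \<in> prob_simplex"
  shows "solves_problem r (linear_path r u)"
  unfolding solves_problem_def
proof (intro conjI ballI allI impI)
  show "linear_path r u \<in> simplex_paths"
    using linear_path_simplex[OF u] linear_path_continuous[OF u] linear_path_extensional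
    by (simp add: simplex_paths_def PiE_iff)
  show "f (linear_path r u t) = f (linear_path r u 0) +
      integral {0..t} (\<lambda>s. dir_deriv (drift r) f (linear_path r u s))"
    if "f \<in> test_functions r" "0 \<le> t" for f t
    by (rule follows_drift_test_function[OF linear_path_follows_drift[OF u] linear_path_simplex[OF u] that])
  let ?T = "{t. 0 \<le> t \<and> linear_path r u t \<in> absorbing_simplex r}"
  have in_T: "t \<in> ?T" if "0 < t" for t
    using that linear_path_simplex[OF u, of t] linear_path_absorbing[OF u, of t] by (simp add: absorbing_simplex_def)
  show "Inf (ereal ` ?T) = 0"
  proof (rule antisym)
    show "0 \<le> Inf (ereal ` ?T)" by (rule INF_greatest) auto
    show "Inf (ereal ` ?T) \<le> 0"
    proof (rule ereal_le_epsilon2)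
      fix e :: real assume "0 < e"
      then have "Inf (ereal ` ?T) \<le> ereal e" by (intro INF_lower in_T)
      then show "Inf (ereal ` ?T) \<le> 0 + ereal e" by simp
    qed
  qed
qed

lemma solves_problem_unique:
  assumes "solves_problem r \<zeta>"
  shows "\<zeta> = linear_path r (\<zeta> 0)"
proof (rule extensionalityI[OF sol_extensional[OF assms] linear_path_extensional])
  fix t :: real assume "t \<in> {0..}"
  have sx: "\<zeta> 0 \<in> prob_simplex" by (rule sol_simplex[OF assms order_refl])
  show "\<zeta> t = linear_path r (\<zeta> 0) t"
    by (rule follows_drift_unique[OF sol_follows_drift[OF assms] linear_path_follows_drift[OF sx]])
      (use \<open>t \<in> {0..}\<close> linear_path_0[OF sx] in auto)
qed

lemma linear_path_orp:
  assumes u: "u \<in> prob_simplex"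
  obtains \<rho> where "(linear_path r u, \<rho>) \<in> orp_solutions r (linear_input r u)"
  using follows_drift_orp[OF linear_path_follows_drift[OF u] linear_path_simplex[OF u] linear_path_extensional]
  by (simp add: linear_path_0[OF u])

lemma orp_path_eq_linear_path:
  assumes u: "u \<in> prob_simplex"
  shows "\<exists>!p. p \<in> orp_solutions r (linear_input r u)" "orp_path r u = linear_path r u"
proof -
  obtain \<rho> where \<rho>: "(linear_path r u, \<rho>) \<in> orp_solutions r (linear_input r u)"
    using linear_path_orp[OF u] .
  have uniq: "p = (linear_path r u, \<rho>)" if "p \<in> orp_solutions r (linear_input r u)" for p
    using that by (cases p) (auto dest: orp_unique[OF u _ \<rho>])
  show "\<exists>!p. p \<in> orp_solutions r (linear_input r u)" using \<rho> uniq by blast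
  have "(THE p. p \<in> orp_solutions r (linear_input r u)) = (linear_path r u, \<rho>)"
    using \<rho> uniq by (rule the_equality)
  then show "orp_path r u = linear_path r u" by (simp add: orp_path_def)
qed

end

theorem proposition3p15:
  fixes r :: "'v::finite \<Rightarrow> 'v \<Rightarrow> real" and u :: "real ^ 'v"
  assumes "irreducible_rates r"
    and "\<And>i. r i i = 0"
    and "u \<in> prob_simplex"
  shows "(\<exists>!\<zeta>. solves_problem r \<zeta> \<and> \<zeta> 0 = u) \<and>
         (\<exists>!p. p \<in> orp_solutions r (linear_input r u)) \<and>
         solves_problem r (orp_path r u) \<and> orp_path r u 0 = u \<and>
         orp_path r u = linear_path r u"
proof -
  interpret irreducible_walk r by unfold_locales (rule assms(1))
  note u = assms(3)
  have "\<exists>!\<zeta>. solves_problem r \<zeta> \<and> \<zeta> 0 = u"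
  proof (rule ex1I)
    show "solves_problem r (linear_path r u) \<and> linear_path r u 0 = u"
      using linear_path_solves[OF u] linear_path_0[OF u] by simp
    show "\<zeta> = linear_path r u" if "solves_problem r \<zeta> \<and> \<zeta> 0 = u" for \<zeta>
      using solves_problem_unique[of \<zeta>] that by simp
  qed
  then show ?thesis
    using orp_path_eq_linear_path[OF u] linear_path_solves[OF u] linear_path_0[OF u] by simp
qed

end
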